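(* For any compact interval $I$ in $(0,\infty)\times\mathbb R^N$ there exists a constant $0<C<\infty$ such that $$\lim_{\varepsilon\to0}\ \sup_{\substack{(t,x),(s,y)\in I,\\ 0<|t-s|+|x-y|\le\varepsilon}}\frac{|u(t,x)-u(s,y)|}{(|t-s|+|x-y|)^\alpha\sqrt{\log\big[1+(|t-s|+|x-y|)^{-1}\big]}}=C\quad\text{a.s.}$$
   Context: Fix integers $N\ge1$, $d\ge1$, and $H\in[1/2,1)$, $\beta\in(0,N)$. Let $h_\beta:\mathbb R^N\to[0,\infty)$ be measurable with $c_1|\xi|^{-\beta}\le h_\beta(\xi)\le c_2|\xi|^{-\beta}$ for constants $0<c_1\le c_2<\infty$. Assume $N-2H-1<\beta<N-2H+1$ and set $\alpha=\frac{2H+1-N+\beta}{2}\in(0,1)$. For $t\ge0$, $x\in\mathbb R^N$, $\tau\in\mathbb R$, $\xi\in\mathbb R^N$ let $\mathcal F g_{t,x}(\tau,\xi)=\frac{e^{-ix\cdot\xi}}{2|\xi|}\Big(\frac{e^{-it\tau}-e^{it|\xi|}}{\tau+|\xi|}-\frac{e^{-it\tau}-e^{-it|\xi|}}{\tau-|\xi|}\Big)$. The field $u=(u_1,\dots,u_d)$ is the (continuous version of the) random field solution of $\partial_t^2u_j=\Delta u_j+\dot W_j$ on $[0,\infty)\times\mathbb R^N$ with zero initial data, where $\dot W_j$ are i.i.d. centered Gaussian noises with formal covariance $\rho_H(t-s)f_\beta(x-y)$ ($\rho_H=\delta$ if $H=1/2$, $\rho_H(r)=|r|^{2H-2}$ if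 $H>1/2$, $f_\beta$ the Fourier transform of $h_\beta(\xi)d\xi$). Concretely, $u_1,\dots,u_d$ are i.i.d. centered Gaussian random fields with $\mathbb E[u_1(t,x)u_1(s,y)]=c_H\int_{\mathbb R}\int_{\mathbb R^N}\mathcal F g_{t,x}(\tau,\xi)\overline{\mathcal F g_{s,y}(\tau,\xi)}\,|\tau|^{1-2H}h_\beta(\xi)\,d\xi\,d\tau$ for a constant $c_H>0$. *)

theory Defs
  imports "HOL-Probability.Probability"
begin

text \<open>Fourier transform of the fundamental solution of the wave equation,
  restricted to [0,t]: F g_{t,x}(tau, xi).  Division by zero yields 0 in HOL,
  which only affects a Lebesgue null set.\<close>
definition Fg :: "real \<Rightarrow> real^'n \<Rightarrow> real \<Rightarrow> real^'n \<Rightarrow> complex" where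
  "Fg t x \<tau> \<xi> =
     exp (- \<i> * complex_of_real (x \<bullet> \<xi>)) / complex_of_real (2 * norm \<xi>) *
     ((exp (- \<i> * complex_of_real (t * \<tau>)) - exp (\<i> * complex_of_real (t * norm \<xi>)))
         / complex_of_real (\<tau> + norm \<xi>)
      - (exp (- \<i> * complex_of_real (t * \<tau>)) - exp (- \<i> * complex_of_real (t * norm \<xi>)))
         / complex_of_real (\<tau> - norm \<xi>))"

definition centered_normal_rv :: "'a measure \<Rightarrow> ('a \<Rightarrow> real) \<Rightarrow> bool" where
  "centered_normal_rv M X \<longleftrightarrow> X \<in> borel_measurable M \<and>
     ((AE \<omega> in M. X \<omega> = 0) \<or>
      (\<exists>\<sigma>>0. distributed M lborel X (normal_density 0 \<sigma>)))"

definition centered_gaussian_field :: "'a measure \<Rightarrow> 'i set \<Rightarrow> ('i \<Rightarrow> 'a \<Rightarrow> real) \<Rightarrow> bool" where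
  "centered_gaussian_field M S X \<longleftrightarrow>
     (\<forall>F c. finite F \<and> F \<subseteq> S \<longrightarrow> centered_normal_rv M (\<lambda>\<omega>. \<Sum>p\<in>F. c p * X p \<omega>))"

definition cov_kernel :: "real \<Rightarrow> real \<Rightarrow> (real^'n \<Rightarrow> real) \<Rightarrow>
     real \<Rightarrow> real^'n \<Rightarrow> real \<Rightarrow> real^'n \<Rightarrow> complex" where
  "cov_kernel cH H h t x s y =
     complex_of_real cH *
     integral\<^sup>L (lborel :: (real \<times> (real^'n)) measure)
       (\<lambda>(\<tau>, \<xi>). Fg t x \<tau> \<xi> * cnj (Fg s y \<tau> \<xi>)
                    * complex_of_real (\<bar>\<tau>\<bar> powr (1 - 2 * H) * h \<xi>))"

definition pdist :: "real \<Rightarrow> real^'n \<Rightarrow> real \<Rightarrow> real^'n \<Rightarrow> real" where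
  "pdist t x s y = \<bar>t - s\<bar> + norm (x - y)"

end

theory Submission
  imports Defs "HOL-Real_Asymp.Real_Asymp"
begin

text \<open>
  Write $L$ for the limit.  The spectral representation and the bound
  $\int |\mathcal F g_{t,x}-\mathcal F g_{s,y}|^2|\tau|^{1-2H}d\tau
  \lesssim \min(\delta,2/|\xi|)^2|\xi|^{1-2H}$, with $\delta=|t-s|+|x-y|$, give
  $E|u(t,x)-u(s,y)|^2\lesssim\delta^{2\alpha}$, and dyadic chaining yields $L<\infty$ almost surely.
  For $L>0$, at a fixed time take increments of length $\delta$ at spacing $4\delta$ along a coordinate
  axis.  Restricting the spectral integral to a frequency box on which the exponentials
  $e^{-4ik\delta\xi_1}$ are orthogonal shows that their Gram matrix is at least $c\delta^{2\alpha}$ times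
  the identity, so by successive conditioning the maximum of $2^n$ of them is as large as for independent ones.
  Finally, by Cauchy--Schwarz, covariance functions $E[u(\cdot)Z]$ are Hoelder of order $\alpha$ without
  logarithm; hence $L$ does not change when finitely many Gram--Schmidt coordinates of the field are
  removed, and Kolmogorov's zero-one law makes it constant.
\<close>

section \<open>Gaussian random variables and independence from characteristic functions\<close>

text \<open>The constant is never identified: it is only enclosed between two bounds and shown to be
  deterministic, so every estimate may lose constant factors, and one component on one axis suffices
  from below. The spacing is 4 delta, not delta, because orthogonality of the exponentials needs a
  window of full period 2 pi / spacing, while the increment factor exp(-i delta s) - 1 vanishes at
  multiples of 2 pi / delta. With spacing 4 delta the window fits around pi / delta, away from these
  zeros. The exponent comes from counting on the box: its volume is of order delta^(-N), |xi| is of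
  order 1 / delta there, and near the cone tau = |xi| the squared kernel times the weights has order
  |xi|^(-1-2H-beta), which gives delta^(1+2H+beta-N) = delta^(2 alpha). For the zero-one law the
  field is sampled on a countable dense set. Gram-Schmidt on this sequence is triangular, so every
  sample is a finite sum of independent variables and no orthogonal expansion has to
  converge.\<close>

context prob_space begin

lemma centered_normal_rv_cases:
  assumes "centered_normal_rv M X"
  obtains (zero) "AE \<omega> in M. X \<omega> = 0"
    | (normal) \<sigma> where "0 < \<sigma>" "distributed M lborel X (normal_density 0 \<sigma>)"
        "expectation (\<lambda>\<omega>. (X \<omega>)\<^sup>2) = \<sigma>\<^sup>2"
        "distributed M lborel (\<lambda>\<omega>. X \<omega> / \<sigma>) std_normal_density"
proof -
  from assms consider "AE \<omega> in M. X \<omega> = 0"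
    | \<sigma> where "\<sigma> > 0" "distributed M lborel X (normal_density 0 \<sigma>)"
    unfolding centered_normal_rv_def by blast
  then show thesis
  proof cases
    case (2 \<sigma>)
    from normal_distributed_variance[OF 2] normal_distributed_expectation[OF 2]
    have "expectation (\<lambda>\<omega>. (X \<omega>)\<^sup>2) = \<sigma>\<^sup>2"
      using 2 by simp
    moreover have "distributed M lborel (\<lambda>\<omega>. X \<omega> / \<sigma>) std_normal_density"
      using normal_standard_normal_convert[OF 2(1), of X 0] 2(2) by simp
    ultimately show ?thesis using that(2) 2 by blast
  qed (use that(1) in blast)
qed

lemma centered_normal_rv_measurable: "centered_normal_rv M X \<Longrightarrow> X \<in> borel_measurable M"
  by (simp add: centered_normal_rv_def)

lemma centered_normal_rv_square_integrable:
  assumes "centered_normal_rv M X"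
  shows "integrable M (\<lambda>\<omega>. (X \<omega>)\<^sup>2)"
  using assms
proof (cases rule: centered_normal_rv_cases)
  case zero
  have "integrable M (\<lambda>\<omega>. (X \<omega>)\<^sup>2) \<longleftrightarrow> integrable M (\<lambda>\<omega>. 0::real)"
    using zero centered_normal_rv_measurable[OF assms] by (intro integrable_cong_AE) auto
  then show ?thesis by simp
next
  case (normal \<sigma>)
  then show ?thesis
    by (subst distributed_integrable[OF normal(2), symmetric])
       (use integrable_normal_moment[OF normal(1), of 0 2] in auto)
qed

lemma expectation_iexp_eq_char:
  assumes "X \<in> borel_measurable M"
  shows "expectation (\<lambda>\<omega>. iexp (s * X \<omega>)) = char (distr M borel X) s"
  unfolding char_def using assms by (subst integral_distr) auto

text \<open>The degenerate and the normal case obey one formula, with variance 0 allowed, so later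
  factorisation arguments need no case split.\<close>

lemma centered_normal_rv_char:
  assumes "centered_normal_rv M X"
  shows "expectation (\<lambda>\<omega>. iexp (s * X \<omega>))
    = complex_of_real (exp (- (s\<^sup>2 * expectation (\<lambda>\<omega>. (X \<omega>)\<^sup>2)) / 2))"
  using assms
proof (cases rule: centered_normal_rv_cases)
  case zero
  have "expectation (\<lambda>\<omega>. iexp (s * X \<omega>)) = expectation (\<lambda>\<omega>. 1::complex)"
    using zero centered_normal_rv_measurable[OF assms] by (intro integral_cong_AE) auto
  moreover have "expectation (\<lambda>\<omega>. (X \<omega>)\<^sup>2) = expectation (\<lambda>\<omega>. 0::real)"
    using zero centered_normal_rv_measurable[OF assms] by (intro integral_cong_AE) auto
  ultimately show ?thesis by (simp add: prob_space)
next
  case (normal \<sigma>)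
  let ?Z = "\<lambda>\<omega>. X \<omega> / \<sigma>"
  have [measurable]: "X \<in> borel_measurable M"
    by (rule centered_normal_rv_measurable[OF assms])
  have "expectation (\<lambda>\<omega>. iexp (s * X \<omega>)) = expectation (\<lambda>\<omega>. iexp ((s * \<sigma>) * ?Z \<omega>))"
    using normal(1) by simp
  also have "\<dots> = char (distr M borel ?Z) (s * \<sigma>)"
    by (rule expectation_iexp_eq_char) simp
  also have "distr M borel ?Z = std_normal_distribution"
    using distributed_distr_eq_density[OF normal(4)] by (simp cong: distr_cong)
  finally show ?thesis
    by (simp add: char_std_normal_distribution normal power_mult_distrib)
qed

text \<open>Reweighting: under the density \<open>Z / expectation Z\<close> the variable
  \<open>X\<close> keeps its characteristic function, hence by Levy's uniqueness theorem its law,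
  and evaluating both laws on \<open>A\<close> gives the product. If
  \<open>expectation Z = 0\<close>, then \<open>Z\<close> vanishes almost surely and there is
  nothing to reweight.\<close>

lemma indicator_factor_of_char_factor:
  fixes X Z :: "'a \<Rightarrow> real"
  assumes [measurable]: "X \<in> borel_measurable M" "Z \<in> borel_measurable M"
    and nonneg: "\<And>\<omega>. 0 \<le> Z \<omega>" and int: "integrable M Z"
    and fac: "\<And>s. expectation (\<lambda>\<omega>. iexp (s * X \<omega>) * complex_of_real (Z \<omega>))
       = expectation (\<lambda>\<omega>. iexp (s * X \<omega>)) * expectation (\<lambda>\<omega>. complex_of_real (Z \<omega>))"
    and A[measurable]: "A \<in> sets borel"
  shows "expectation (\<lambda>\<omega>. indicator A (X \<omega>) * Z \<omega>) = prob (X -` A \<inter> space M) * expectation Z"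
proof (cases "expectation Z = 0")
  case True
  then have "AE \<omega> in M. Z \<omega> = 0"
    using integral_nonneg_eq_0_iff_AE[OF int] nonneg by simp
  then have "expectation (\<lambda>\<omega>. indicator A (X \<omega>) * Z \<omega>) = expectation (\<lambda>\<omega>. 0)"
    by (intro integral_cong_AE) auto
  then show ?thesis using True by simp
next
  case False
  define c where "c = expectation Z"
  have c: "c > 0" using False nonneg unfolding c_def by (simp add: less_le)
  define N where "N = density M (\<lambda>\<omega>. ennreal (Z \<omega> / c))"
  have N: "prob_space N"
    unfolding N_def
  proof (rule prob_spaceI)
    have "emeasure (density M (\<lambda>\<omega>. ennreal (Z \<omega> / c))) (space M) = (\<integral>\<^sup>+\<omega>. ennreal (Z \<omega> / c) \<partial>M)"
      by (subst emeasure_density) (auto intro!: nn_integral_cong)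
    also have "\<dots> = ennreal (\<integral>\<omega>. Z \<omega> / c \<partial>M)"
      using int nonneg c by (intro nn_integral_eq_integral) auto
    also have "\<dots> = 1" using c by (simp add: c_def[symmetric])
    finally show "emeasure (density M (\<lambda>\<omega>. ennreal (Z \<omega> / c)))
       (space (density M (\<lambda>\<omega>. ennreal (Z \<omega> / c)))) = 1" by simp
  qed
  interpret N: prob_space N by (rule N)
  have XN[measurable]: "X \<in> borel_measurable N" by (simp add: N_def)
  have "distr M borel X = distr N borel X"
  proof (rule Levy_uniqueness)
    show "real_distribution (distr M borel X)" by (rule real_distribution_distr) simp
    show "real_distribution (distr N borel X)" by (rule N.real_distribution_distr) simp
    show "char (distr M borel X) = char (distr N borel X)"
    proof
      fix s
      have "char (distr N borel X) s = (\<integral>\<omega>. iexp (s * X \<omega>) \<partial>N)"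
        by (rule N.expectation_iexp_eq_char[symmetric]) simp
      also have "\<dots> = (\<integral>\<omega>. (Z \<omega> / c) *\<^sub>R iexp (s * X \<omega>) \<partial>M)"
        unfolding N_def using nonneg c by (subst integral_density) auto
      also have "\<dots> = (\<integral>\<omega>. (iexp (s * X \<omega>) * complex_of_real (Z \<omega>)) / complex_of_real c \<partial>M)"
        by (intro Bochner_Integration.integral_cong) (auto simp: scaleR_conv_of_real)
      also have "\<dots> = expectation (\<lambda>\<omega>. iexp (s * X \<omega>))"
        using c unfolding integral_divide_zero fac by (simp add: c_def del: of_real_mult)
      finally show "char (distr M borel X) s = char (distr N borel X) s"
        by (simp add: expectation_iexp_eq_char del: of_real_mult)
    qed
  qed
  then have "measure (distr M borel X) A = measure (distr N borel X) A" by simp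
  then have "prob (X -` A \<inter> space M) = measure N (X -` A \<inter> space N)"
    by (simp add: measure_distr)
  also have "\<dots> = (\<integral>\<omega>. indicator (X -` A \<inter> space N) \<omega> \<partial>N)"
    by simp
  also have "\<dots> = (\<integral>\<omega>. indicator A (X \<omega>) \<partial>N)"
    by (intro Bochner_Integration.integral_cong) (auto simp: indicator_def)
  also have "\<dots> = (\<integral>\<omega>. (Z \<omega> / c) *\<^sub>R indicator A (X \<omega>) \<partial>M)"
    unfolding N_def using nonneg c by (subst integral_density) auto
  also have "\<dots> = (\<integral>\<omega>. indicator A (X \<omega>) * Z \<omega> / c \<partial>M)"
    by (intro Bochner_Integration.integral_cong) auto
  finally show ?thesis using c by (simp add: c_def field_simps)
qed

lemma integrable_bounded_complex:
  fixes f :: "'a \<Rightarrow> complex"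
  assumes "f \<in> borel_measurable M" "\<And>\<omega>. norm (f \<omega>) \<le> B"
  shows "integrable M f"
  using assms by (intro integrable_const_bound[of _ B]) auto

text \<open>The weight \<open>I * iexp W\<close> is complex and cannot serve as a density. It is
  reached through the nonnegative weights \<open>I\<close>, \<open>I * (1 + cos W)\<close> and
  \<open>I * (1 + sin W)\<close>; the hypotheses for \<open>W\<close> and \<open>- W\<close> supply
  the exponentials that make up cosine and sine.\<close>

lemma indicator_factor_iexp:
  fixes X W I :: "'a \<Rightarrow> real"
  assumes [measurable]: "X \<in> borel_measurable M" "W \<in> borel_measurable M" "I \<in> borel_measurable M"
    and I: "\<And>\<omega>. 0 \<le> I \<omega>" "\<And>\<omega>. I \<omega> \<le> 1"
    and fac0: "\<And>s. expectation (\<lambda>\<omega>. iexp (s * X \<omega>) * complex_of_real (I \<omega>))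
       = expectation (\<lambda>\<omega>. iexp (s * X \<omega>)) * expectation (\<lambda>\<omega>. complex_of_real (I \<omega>))"
    and fac1: "\<And>s. expectation (\<lambda>\<omega>. iexp (s * X \<omega>) * (complex_of_real (I \<omega>) * iexp (W \<omega>)))
       = expectation (\<lambda>\<omega>. iexp (s * X \<omega>)) * expectation (\<lambda>\<omega>. complex_of_real (I \<omega>) * iexp (W \<omega>))"
    and fac2: "\<And>s. expectation (\<lambda>\<omega>. iexp (s * X \<omega>) * (complex_of_real (I \<omega>) * iexp (- W \<omega>)))
       = expectation (\<lambda>\<omega>. iexp (s * X \<omega>)) * expectation (\<lambda>\<omega>. complex_of_real (I \<omega>) * iexp (- W \<omega>))"
    and A[measurable]: "A \<in> sets borel"
  shows "expectation (\<lambda>\<omega>. complex_of_real (indicator A (X \<omega>) * I \<omega>) * iexp (W \<omega>))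
    = prob (X -` A \<inter> space M) * expectation (\<lambda>\<omega>. complex_of_real (I \<omega>) * iexp (W \<omega>))"
proof -
  have Iabs: "\<bar>I \<omega>\<bar> \<le> 1" for \<omega> using I[of \<omega>] by auto
  have bd: "\<bar>I \<omega> * r\<bar> \<le> 2" if "\<bar>r\<bar> \<le> 2" for \<omega> r
    using mult_mono[OF Iabs that, of \<omega>] by (simp add: abs_mult)
  have int1: "integrable M (\<lambda>\<omega>. I \<omega> * g \<omega>)" if "g \<in> borel_measurable M" "\<And>\<omega>. \<bar>g \<omega>\<bar> \<le> 2" for g
    using that(1) by (intro integrable_const_bound[of _ 2]) (auto intro!: bd that(2) AE_I2)
  have int2: "integrable M (\<lambda>\<omega>. indicator A (X \<omega>) * (I \<omega> * g \<omega>))"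
    if "g \<in> borel_measurable M" "\<And>\<omega>. \<bar>g \<omega>\<bar> \<le> 2" for g
    using that(1) by (intro integrable_const_bound[of _ 2])
      (auto intro!: bd that(2) AE_I2 simp: indicator_def)
  have cint: "integrable M (\<lambda>\<omega>. iexp (s * X \<omega>) * complex_of_real (I \<omega>))"
    "integrable M (\<lambda>\<omega>. iexp (s * X \<omega>) * (complex_of_real (I \<omega>) * iexp (W \<omega>)))"
    "integrable M (\<lambda>\<omega>. iexp (s * X \<omega>) * (complex_of_real (I \<omega>) * iexp (- W \<omega>)))"
    "integrable M (\<lambda>\<omega>. complex_of_real (I \<omega>))"
    "integrable M (\<lambda>\<omega>. complex_of_real (I \<omega>) * iexp (W \<omega>))"
    "integrable M (\<lambda>\<omega>. complex_of_real (I \<omega>) * iexp (- W \<omega>))" for s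
    by (rule integrable_bounded_complex[of _ 1], measurable, simp add: norm_mult Iabs)+
  define p where "p = prob (X -` A \<inter> space M)"
  let ?E = "\<lambda>g. expectation (\<lambda>\<omega>. indicator A (X \<omega>) * (I \<omega> * g \<omega>)) = p * expectation (\<lambda>\<omega>. I \<omega> * g \<omega>)"
  have e0: "?E (\<lambda>\<omega>. 1)"
    using indicator_factor_of_char_factor[of X "\<lambda>\<omega>. I \<omega>" A] fac0 I int1[of "\<lambda>_. 1"]
    by (simp add: p_def)
  \<comment> \<open>Adding 1 makes the weight nonnegative; its share is subtracted again by means of
    \<open>e0\<close>.\<close>
  have trig: "?E g" if [measurable]: "g \<in> borel_measurable M" and g: "\<And>\<omega>. \<bar>g \<omega>\<bar> \<le> 1"
    and eq: "\<And>\<omega>. complex_of_real (g \<omega>) = a * iexp (W \<omega>) + b * iexp (- W \<omega>)" for g a b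
  proof -
    have g2: "\<bar>1 + g \<omega>\<bar> \<le> 2" "0 \<le> 1 + g \<omega>" "\<bar>g \<omega>\<bar> \<le> 2" for \<omega> using g[of \<omega>] by auto
    have eq': "complex_of_real (I \<omega> * (1 + g \<omega>)) = complex_of_real (I \<omega>)
        + a * (complex_of_real (I \<omega>) * iexp (W \<omega>)) + b * (complex_of_real (I \<omega>) * iexp (- W \<omega>))" for \<omega>
      by (simp add: eq algebra_simps)
    have "?E (\<lambda>\<omega>. 1 + g \<omega>)"
      unfolding p_def
    proof (rule indicator_factor_of_char_factor)
      fix s
      have "expectation (\<lambda>\<omega>. iexp (s * X \<omega>) * complex_of_real (I \<omega> * (1 + g \<omega>)))
        = expectation (\<lambda>\<omega>. iexp (s * X \<omega>) * complex_of_real (I \<omega>)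
           + a * (iexp (s * X \<omega>) * (complex_of_real (I \<omega>) * iexp (W \<omega>)))
           + b * (iexp (s * X \<omega>) * (complex_of_real (I \<omega>) * iexp (- W \<omega>))))"
        unfolding eq' by (intro Bochner_Integration.integral_cong) (auto simp: algebra_simps)
      also have "\<dots> = expectation (\<lambda>\<omega>. iexp (s * X \<omega>) * complex_of_real (I \<omega>))
           + a * expectation (\<lambda>\<omega>. iexp (s * X \<omega>) * (complex_of_real (I \<omega>) * iexp (W \<omega>)))
           + b * expectation (\<lambda>\<omega>. iexp (s * X \<omega>) * (complex_of_real (I \<omega>) * iexp (- W \<omega>)))"
        using cint by (simp del: of_real_mult of_real_minus)
      also have "\<dots> = expectation (\<lambda>\<omega>. iexp (s * X \<omega>)) * (expectation (\<lambda>\<omega>. complex_of_real (I \<omega>))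
           + a * expectation (\<lambda>\<omega>. complex_of_real (I \<omega>) * iexp (W \<omega>))
           + b * expectation (\<lambda>\<omega>. complex_of_real (I \<omega>) * iexp (- W \<omega>)))"
        unfolding fac0 fac1 fac2 by (simp only: algebra_simps)
      also have "expectation (\<lambda>\<omega>. complex_of_real (I \<omega>))
           + a * expectation (\<lambda>\<omega>. complex_of_real (I \<omega>) * iexp (W \<omega>))
           + b * expectation (\<lambda>\<omega>. complex_of_real (I \<omega>) * iexp (- W \<omega>))
         = expectation (\<lambda>\<omega>. complex_of_real (I \<omega> * (1 + g \<omega>)))"
        unfolding eq' using cint by (simp del: of_real_mult of_real_minus)
      finally show "expectation (\<lambda>\<omega>. iexp (s * X \<omega>) * complex_of_real (I \<omega> * (1 + g \<omega>)))
       = expectation (\<lambda>\<omega>. iexp (s * X \<omega>)) * expectation (\<lambda>\<omega>. complex_of_real (I \<omega> * (1 + g \<omega>)))" .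
    next
      show "0 \<le> I \<omega> * (1 + g \<omega>)" for \<omega> using I g2 by simp
      show "integrable M (\<lambda>\<omega>. I \<omega> * (1 + g \<omega>))" by (rule int1) (auto intro: g2)
    qed auto
    then show ?thesis
      using e0 int1[of g] int1[of "\<lambda>_. 1"] int2[of g] int2[of "\<lambda>_. 1"] g2(3)
      by (simp add: distrib_left)
  qed
  have ec: "?E (\<lambda>\<omega>. cos (W \<omega>))"
    by (rule trig[of _ "1/2" "1/2"])
       (auto simp: cos_of_real[symmetric] cos_exp_eq add_divide_distrib simp del: cos_of_real)
  have es: "?E (\<lambda>\<omega>. sin (W \<omega>))"
    by (rule trig[of _ "1/(2*\<i>)" "-1/(2*\<i>)"])
       (auto simp: sin_of_real[symmetric] sin_exp_eq field_simps simp del: sin_of_real)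
  have eul: "complex_of_real r * iexp w = complex_of_real (r * cos w) + \<i> * complex_of_real (r * sin w)" for r w
    by (simp add: exp_Euler algebra_simps cos_of_real sin_of_real)
  have "expectation (\<lambda>\<omega>. complex_of_real (indicator A (X \<omega>) * I \<omega>) * iexp (W \<omega>))
     = complex_of_real (expectation (\<lambda>\<omega>. indicator A (X \<omega>) * (I \<omega> * cos (W \<omega>))))
      + \<i> * complex_of_real (expectation (\<lambda>\<omega>. indicator A (X \<omega>) * (I \<omega> * sin (W \<omega>))))"
    unfolding eul using int2[of "\<lambda>\<omega>. cos (W \<omega>)"] int2[of "\<lambda>\<omega>. sin (W \<omega>)"]
    abs_cos_le_one abs_sin_le_one
    by (simp add: order_trans[OF abs_cos_le_one] order_trans[OF abs_sin_le_one] mult.assoc del: of_real_mult)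
  also have "\<dots> = p * (complex_of_real (expectation (\<lambda>\<omega>. I \<omega> * cos (W \<omega>)))
      + \<i> * complex_of_real (expectation (\<lambda>\<omega>. I \<omega> * sin (W \<omega>))))"
    unfolding ec es by (simp add: algebra_simps)
  also have "\<dots> = p * expectation (\<lambda>\<omega>. complex_of_real (I \<omega>) * iexp (W \<omega>))"
    unfolding eul using int1[of "\<lambda>\<omega>. cos (W \<omega>)"] int1[of "\<lambda>\<omega>. sin (W \<omega>)"]
    abs_cos_le_one abs_sin_le_one
    by (simp add: order_trans[OF abs_cos_le_one] order_trans[OF abs_sin_le_one] del: of_real_mult)
  finally show ?thesis unfolding p_def .
qed

text \<open>Exponentials are exchanged for indicators one variable at a time, so that only the
  uniqueness theorem on the real line is needed, not one for joint laws.\<close>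

lemma indep_vars_of_char_factor:
  fixes R :: "'i \<Rightarrow> 'a \<Rightarrow> real"
  assumes [measurable]: "\<And>i. R i \<in> borel_measurable M"
    and fac: "\<And>F c. finite F \<Longrightarrow> expectation (\<lambda>\<omega>. iexp (\<Sum>i\<in>F. c i * R i \<omega>))
        = (\<Prod>i\<in>F. expectation (\<lambda>\<omega>. iexp (c i * R i \<omega>)))"
  shows "indep_vars (\<lambda>_. borel) R UNIV"
proof -
  \<comment> \<open>Interpolates between the two descriptions: \<open>J\<close> holds the variables
    already turned into events, \<open>F\<close> those still under an exponential. The case
    \<open>J = {}\<close> is trivial, and \<open>F = {}\<close> is the product formula
    wanted.\<close>
  have key: "expectation (\<lambda>\<omega>. complex_of_real (\<Prod>j\<in>J. indicator (A j) (R j \<omega>)) * iexp (\<Sum>i\<in>F. c i * R i \<omega>))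
    = complex_of_real (\<Prod>j\<in>J. prob (R j -` A j \<inter> space M)) * expectation (\<lambda>\<omega>. iexp (\<Sum>i\<in>F. c i * R i \<omega>))"
    if "finite J" "\<And>j. j \<in> J \<Longrightarrow> A j \<in> sets borel" "finite F" "F \<inter> J = {}" for J A F c
    using that
  proof (induction J arbitrary: F c rule: finite_induct)
    case empty
    then show ?case by simp
  next
    case (insert a J)
    have A[measurable]: "\<And>j. j \<in> J \<Longrightarrow> A j \<in> sets borel" "A a \<in> sets borel" using insert.prems by auto
    have aF: "a \<notin> F" using insert.prems by auto
    define I where "I = (\<lambda>\<omega>. \<Prod>j\<in>J. indicator (A j) (R j \<omega>) :: real)"
    define p where "p = complex_of_real (\<Prod>j\<in>J. prob (R j -` A j \<inter> space M))"
    have [measurable]: "I \<in> borel_measurable M" unfolding I_def by measurable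
    have I: "0 \<le> I \<omega>" "I \<omega> \<le> 1" for \<omega>
      unfolding I_def by (auto intro!: prod_nonneg prod_le_1)
    have IH: "expectation (\<lambda>\<omega>. complex_of_real (I \<omega>) * iexp (\<Sum>i\<in>F'. c' i * R i \<omega>))
      = p * expectation (\<lambda>\<omega>. iexp (\<Sum>i\<in>F'. c' i * R i \<omega>))" if "F' \<subseteq> insert a F" for F' c'
      unfolding I_def p_def
    proof (rule insert.IH)
      show "finite F'" using that insert.prems finite_subset by auto
      show "F' \<inter> J = {}" using that insert.prems insert.hyps by auto
    qed (use A in auto)
    have fac': "expectation (\<lambda>\<omega>. iexp (s * R a \<omega>) * (complex_of_real (I \<omega>) * iexp (\<Sum>i\<in>F'. c' i * R i \<omega>)))
       = expectation (\<lambda>\<omega>. iexp (s * R a \<omega>)) * expectation (\<lambda>\<omega>. complex_of_real (I \<omega>) * iexp (\<Sum>i\<in>F'. c' i * R i \<omega>))"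
      if F': "F' \<subseteq> F" for s F' c'
    proof -
      have fin: "finite F'" and a: "a \<notin> F'" using F' insert.prems finite_subset aF by auto
      \<comment> \<open>Seen as one more exponential, the variable \<open>a\<close> joins
        \<open>F'\<close>, so the induction hypothesis removes the indicators of \<open>J\<close>
        before \<open>fac\<close> splits \<open>a\<close> off.\<close>
      define c2 where "c2 = c'(a := s)"
      have c2: "(\<Sum>i\<in>insert a F'. c2 i * R i \<omega>) = s * R a \<omega> + (\<Sum>i\<in>F'. c' i * R i \<omega>)" for \<omega>
        using fin a by (auto simp: c2_def intro!: sum.cong)
      have "expectation (\<lambda>\<omega>. iexp (s * R a \<omega>) * (complex_of_real (I \<omega>) * iexp (\<Sum>i\<in>F'. c' i * R i \<omega>)))
        = expectation (\<lambda>\<omega>. complex_of_real (I \<omega>) * iexp (\<Sum>i\<in>insert a F'. c2 i * R i \<omega>))"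
        unfolding c2 by (intro Bochner_Integration.integral_cong)
          (auto simp: distrib_left exp_add simp del: of_real_mult of_real_sum)
      also have "\<dots> = p * expectation (\<lambda>\<omega>. iexp (\<Sum>i\<in>insert a F'. c2 i * R i \<omega>))"
        using F' by (intro IH) auto
      also have "expectation (\<lambda>\<omega>. iexp (\<Sum>i\<in>insert a F'. c2 i * R i \<omega>))
         = (\<Prod>i\<in>insert a F'. expectation (\<lambda>\<omega>. iexp (c2 i * R i \<omega>)))"
        using fin by (intro fac) auto
      also have "\<dots> = expectation (\<lambda>\<omega>. iexp (s * R a \<omega>)) * (\<Prod>i\<in>F'. expectation (\<lambda>\<omega>. iexp (c2 i * R i \<omega>)))"
        using fin a by (simp add: c2_def)
      also have "(\<Prod>i\<in>F'. expectation (\<lambda>\<omega>. iexp (c2 i * R i \<omega>))) = (\<Prod>i\<in>F'. expectation (\<lambda>\<omega>. iexp (c' i * R i \<omega>)))"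
        using a by (intro prod.cong) (auto simp: c2_def)
      also have "\<dots> = expectation (\<lambda>\<omega>. iexp (\<Sum>i\<in>F'. c' i * R i \<omega>))"
        using fin by (intro fac[symmetric]) auto
      finally show ?thesis
        using IH[of F' c'] F' by (simp add: subset_insertI2 algebra_simps del: of_real_mult of_real_sum)
    qed
    have "expectation (\<lambda>\<omega>. complex_of_real (indicator (A a) (R a \<omega>) * I \<omega>) * iexp (\<Sum>i\<in>F. c i * R i \<omega>))
      = prob (R a -` A a \<inter> space M) * expectation (\<lambda>\<omega>. complex_of_real (I \<omega>) * iexp (\<Sum>i\<in>F. c i * R i \<omega>))"
      using fac'[of F _ c] fac'[of F _ "\<lambda>i. - c i"] fac'[of "{}"]
      by (intro indicator_factor_iexp I)
         (simp_all add: sum_negf del: of_real_mult of_real_sum)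
    also have "\<dots> = prob (R a -` A a \<inter> space M) * (p * expectation (\<lambda>\<omega>. iexp (\<Sum>i\<in>F. c i * R i \<omega>)))"
      by (subst IH) auto
    finally show ?case
      using insert.hyps by (simp add: p_def I_def mult.assoc)
  qed
  show ?thesis
    unfolding indep_vars_def2
  proof (intro conjI ballI)
    show "indep_sets (\<lambda>i. {R i -` A \<inter> space M |A. A \<in> sets borel}) UNIV"
    proof (rule indep_setsI)
      fix B J assume J: "J \<noteq> {}" "finite J" and B: "\<forall>j\<in>J. B j \<in> {R j -` A \<inter> space M |A. A \<in> sets borel}"
      then obtain A where A: "\<And>j. j \<in> J \<Longrightarrow> B j = R j -` A j \<inter> space M" "\<And>j. j \<in> J \<Longrightarrow> A j \<in> sets borel"
        by (atomize_elim) (simp add: choice_iff' Ball_def, metis)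
      have "prob (\<Inter>j\<in>J. B j) = expectation (indicator (\<Inter>j\<in>J. B j))"
        using J A by (subst Bochner_Integration.integral_indicator) (auto intro!: arg_cong[where f=prob])
      also have "\<dots> = expectation (\<lambda>\<omega>. \<Prod>j\<in>J. indicator (A j) (R j \<omega>))"
        using J A by (intro Bochner_Integration.integral_cong) (auto simp: indicator_def prod_eq_1_iff)
      also have "complex_of_real \<dots> = complex_of_real (\<Prod>j\<in>J. prob (R j -` A j \<inter> space M))"
        using key[of J A "{}" undefined] J(2) A(2) by (simp only: finite.emptyI sum.empty Int_empty_left)
          (simp del: of_real_prod add: prob_space)
      finally show "prob (\<Inter>j\<in>J. B j) = (\<Prod>j\<in>J. prob (B j))"
        using A by (simp only: of_real_eq_iff cong: prod.cong)
    qed auto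
  qed auto
qed

end

section \<open>Gram--Schmidt orthogonalisation of Gaussian sequences\<close>

definition lincomb :: "('i \<Rightarrow> 'a \<Rightarrow> real) \<Rightarrow> ('a \<Rightarrow> real) set" where
  "lincomb Y = {V. \<exists>F c. finite F \<and> V = (\<lambda>\<omega>. \<Sum>i\<in>F. c i * Y i \<omega>)}"

lemma lincomb_zero: "(\<lambda>\<omega>. 0) \<in> lincomb Y"
  unfolding lincomb_def by (auto intro!: exI[of _ "{}"])

lemma lincomb_base: "Y i \<in> lincomb Y"
  unfolding lincomb_def by (auto intro!: exI[of _ "{i}"] exI[of _ "\<lambda>_. 1"])

lemma lincomb_scale:
  assumes "V \<in> lincomb Y" shows "(\<lambda>\<omega>. a * V \<omega>) \<in> lincomb Y"
proof -
  from assms obtain F c where "finite F" "V = (\<lambda>\<omega>. \<Sum>i\<in>F. c i * Y i \<omega>)"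
    unfolding lincomb_def by auto
  then show ?thesis unfolding lincomb_def
    by (auto intro!: exI[of _ F] exI[of _ "\<lambda>i. a * c i"] simp: sum_distrib_left mult.assoc)
qed

lemma lincomb_add:
  assumes "V \<in> lincomb Y" "W \<in> lincomb Y" shows "(\<lambda>\<omega>. V \<omega> + W \<omega>) \<in> lincomb Y"
proof -
  from assms obtain F c G d where *: "finite F" "V = (\<lambda>\<omega>. \<Sum>i\<in>F. c i * Y i \<omega>)"
    "finite G" "W = (\<lambda>\<omega>. \<Sum>i\<in>G. d i * Y i \<omega>)"
    unfolding lincomb_def by auto
  define e where "e i = (if i \<in> F then c i else 0) + (if i \<in> G then d i else 0)" for i
  have "V \<omega> + W \<omega> = (\<Sum>i\<in>F \<union> G. e i * Y i \<omega>)" for \<omega>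
  proof -
    have "(\<Sum>i\<in>F. c i * Y i \<omega>) = (\<Sum>i\<in>F \<union> G. (if i \<in> F then c i else 0) * Y i \<omega>)"
      using * by (intro sum.mono_neutral_cong_left) auto
    moreover have "(\<Sum>i\<in>G. d i * Y i \<omega>) = (\<Sum>i\<in>F \<union> G. (if i \<in> G then d i else 0) * Y i \<omega>)"
      using * by (intro sum.mono_neutral_cong_left) auto
    ultimately show ?thesis by (simp add: * e_def distrib_right sum.distrib)
  qed
  then show ?thesis using * unfolding lincomb_def by blast
qed

lemma lincomb_diff:
  assumes "V \<in> lincomb Y" "W \<in> lincomb Y" shows "(\<lambda>\<omega>. V \<omega> - W \<omega>) \<in> lincomb Y"
  using lincomb_add[OF assms(1) lincomb_scale[OF assms(2), of "-1"]] by simp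

lemma lincomb_sum:
  assumes "\<And>i. i \<in> I \<Longrightarrow> V i \<in> lincomb Y" shows "(\<lambda>\<omega>. \<Sum>i\<in>I. c i * V i \<omega>) \<in> lincomb Y"
  using assms
proof (induction I rule: infinite_finite_induct)
  case (insert x F)
  then show ?case using lincomb_add[OF lincomb_scale[of "V x" Y "c x"], of "\<lambda>\<omega>. \<Sum>i\<in>F. c i * V i \<omega>"]
    by simp
qed (auto intro: lincomb_zero)

lemma lincomb_centered_normal:
  assumes "centered_gaussian_field M UNIV Y" "V \<in> lincomb Y"
  shows "centered_normal_rv M V"
  using assms unfolding lincomb_def centered_gaussian_field_def by auto

lemma integrable_mult_of_squares:
  fixes f g :: "'a \<Rightarrow> real"
  assumes [measurable]: "f \<in> borel_measurable M" "g \<in> borel_measurable M"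
    and "integrable M (\<lambda>\<omega>. (f \<omega>)\<^sup>2)" "integrable M (\<lambda>\<omega>. (g \<omega>)\<^sup>2)"
  shows "integrable M (\<lambda>\<omega>. f \<omega> * g \<omega>)"
proof (rule Bochner_Integration.integrable_bound)
  show "integrable M (\<lambda>\<omega>. (f \<omega>)\<^sup>2 + (g \<omega>)\<^sup>2)" using assms by simp
  have "\<bar>a * b\<bar> \<le> a\<^sup>2 + b\<^sup>2" for a b :: real
    using sum_squares_bound[of "\<bar>a\<bar>" "\<bar>b\<bar>"] zero_le_power2[of a] zero_le_power2[of b]
    unfolding power2_abs abs_mult by linarith
  then show "AE x in M. norm (f x * g x) \<le> norm ((f x)\<^sup>2 + (g x)\<^sup>2)" by simp
qed simp

text \<open>Directions stay unnormalised. A variable that depends linearly on its predecessors then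
  yields an almost surely zero direction instead of an undefined one, and no index has to be
  dropped.\<close>

function gram_schmidt :: "'a measure \<Rightarrow> (nat \<Rightarrow> 'a \<Rightarrow> real) \<Rightarrow> nat \<Rightarrow> 'a \<Rightarrow> real" where
  "gram_schmidt M Y n = (\<lambda>\<omega>. Y n \<omega> - (\<Sum>l<n.
     ((\<integral>\<omega>'. Y n \<omega>' * gram_schmidt M Y l \<omega>' \<partial>M) / (\<integral>\<omega>'. (gram_schmidt M Y l \<omega>')\<^sup>2 \<partial>M))
       * gram_schmidt M Y l \<omega>))"
  by auto
termination by (relation "Wellfounded.measure (\<lambda>(M, Y, n). n)") auto

declare gram_schmidt.simps[simp del]

text \<open>With \<open>x / 0 = 0\<close>, the coefficient vanishes when the projection direction is null.\<close>
definition gs_coeff :: "'a measure \<Rightarrow> (nat \<Rightarrow> 'a \<Rightarrow> real) \<Rightarrow> nat \<Rightarrow> nat \<Rightarrow> real" where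
  "gs_coeff M Y l k = (\<integral>\<omega>. Y k \<omega> * gram_schmidt M Y l \<omega> \<partial>M) / (\<integral>\<omega>. (gram_schmidt M Y l \<omega>)\<^sup>2 \<partial>M)"

lemma gram_schmidt_eq:
  "gram_schmidt M Y n \<omega> = Y n \<omega> - (\<Sum>l<n. gs_coeff M Y l n * gram_schmidt M Y l \<omega>)"
  by (subst gram_schmidt.simps) (simp add: gs_coeff_def)

lemma gram_schmidt_lincomb: "gram_schmidt M Y n \<in> lincomb Y"
proof (induction n rule: less_induct)
  case (less n)
  have "(\<lambda>\<omega>. Y n \<omega> - (\<Sum>l<n. gs_coeff M Y l n * gram_schmidt M Y l \<omega>)) \<in> lincomb Y"
    by (intro lincomb_diff lincomb_base lincomb_sum less) auto
  also have "(\<lambda>\<omega>. Y n \<omega> - (\<Sum>l<n. gs_coeff M Y l n * gram_schmidt M Y l \<omega>)) = gram_schmidt M Y n"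
    by (rule ext, rule gram_schmidt_eq[symmetric])
  finally show ?case .
qed

locale gaussian_sequence = prob_space M for M :: "'a measure" +
  fixes Y :: "nat \<Rightarrow> 'a \<Rightarrow> real"
  assumes gaussian: "centered_gaussian_field M UNIV Y"
begin

abbreviation "\<xi> \<equiv> gram_schmidt M Y"
abbreviation "a \<equiv> gs_coeff M Y"

lemma lincomb_normal: "V \<in> lincomb Y \<Longrightarrow> centered_normal_rv M V"
  by (rule lincomb_centered_normal[OF gaussian])

lemma lincomb_measurable: "V \<in> lincomb Y \<Longrightarrow> V \<in> borel_measurable M"
  by (intro centered_normal_rv_measurable lincomb_normal)

lemma lincomb_integrable_mult:
  "V \<in> lincomb Y \<Longrightarrow> W \<in> lincomb Y \<Longrightarrow> integrable M (\<lambda>\<omega>. V \<omega> * W \<omega>)"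
  by (intro integrable_mult_of_squares lincomb_measurable centered_normal_rv_square_integrable lincomb_normal)

lemma measurable_xi[measurable]: "\<xi> n \<in> borel_measurable M"
  by (intro lincomb_measurable gram_schmidt_lincomb)

lemma measurable_Y[measurable]: "Y n \<in> borel_measurable M"
  by (intro lincomb_measurable lincomb_base)

lemma AE_xi_zero: "expectation (\<lambda>\<omega>. (\<xi> n \<omega>)\<^sup>2) = 0 \<Longrightarrow> AE \<omega> in M. \<xi> n \<omega> = 0"
  using integral_nonneg_eq_0_iff_AE[OF centered_normal_rv_square_integrable
      [OF lincomb_normal[OF gram_schmidt_lincomb[of M Y n]]]] by simp

text \<open>Valid for a null direction too, where both sides are 0; later computations thus never
  have to exclude a zero denominator.\<close>

lemma coeff_mult: "a l k * expectation (\<lambda>\<omega>. (\<xi> l \<omega>)\<^sup>2) = expectation (\<lambda>\<omega>. Y k \<omega> * \<xi> l \<omega>)"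
proof (cases "expectation (\<lambda>\<omega>. (\<xi> l \<omega>)\<^sup>2) = 0")
  case True
  from AE_xi_zero[OF this] have "expectation (\<lambda>\<omega>. Y k \<omega> * \<xi> l \<omega>) = expectation (\<lambda>\<omega>. 0)"
    by (intro integral_cong_AE) auto
  then show ?thesis using True by simp
qed (simp add: gs_coeff_def)

lemma expectation_expand:
  assumes "V \<in> lincomb Y" "W \<in> lincomb Y"
  shows "expectation (\<lambda>\<omega>. (V \<omega> + (\<Sum>i\<in>I. c i * \<xi> i \<omega>)) * W \<omega>)
    = expectation (\<lambda>\<omega>. V \<omega> * W \<omega>) + (\<Sum>i\<in>I. c i * expectation (\<lambda>\<omega>. \<xi> i \<omega> * W \<omega>))"
proof -
  have int: "integrable M (\<lambda>\<omega>. V \<omega> * W \<omega>)" "\<And>i. integrable M (\<lambda>\<omega>. \<xi> i \<omega> * W \<omega>)"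
    using assms by (auto intro: lincomb_integrable_mult gram_schmidt_lincomb)
  have "expectation (\<lambda>\<omega>. (V \<omega> + (\<Sum>i\<in>I. c i * \<xi> i \<omega>)) * W \<omega>)
    = expectation (\<lambda>\<omega>. V \<omega> * W \<omega> + (\<Sum>i\<in>I. c i * (\<xi> i \<omega> * W \<omega>)))"
    by (simp add: distrib_right sum_distrib_right mult.assoc)
  also have "\<dots> = expectation (\<lambda>\<omega>. V \<omega> * W \<omega>) + (\<Sum>i\<in>I. c i * expectation (\<lambda>\<omega>. \<xi> i \<omega> * W \<omega>))"
    using int by simp
  finally show ?thesis .
qed

definition v :: "nat \<Rightarrow> real" where "v n = expectation (\<lambda>\<omega>. (\<xi> n \<omega>)\<^sup>2)"

lemma v_eq: "expectation (\<lambda>\<omega>. \<xi> n \<omega> * \<xi> n \<omega>) = v n"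
  by (simp add: v_def power2_eq_square)

lemma orthogonal_less: "m < n \<Longrightarrow> expectation (\<lambda>\<omega>. \<xi> n \<omega> * \<xi> m \<omega>) = 0"
proof (induction n arbitrary: m rule: less_induct)
  case (less n)
  have "expectation (\<lambda>\<omega>. \<xi> l \<omega> * \<xi> m \<omega>) = (if l = m then v m else 0)" if "l < n" for l
    using less.IH[of l m] less.IH[of m l] that less.prems v_eq[of m]
    by (cases l m rule: linorder_cases) (auto simp: mult.commute)
  then have s: "(\<Sum>l<n. - a l n * expectation (\<lambda>\<omega>. \<xi> l \<omega> * \<xi> m \<omega>))
      = (\<Sum>l<n. if l = m then - a l n * v m else 0)"
    by (intro sum.cong) auto
  have "\<xi> n \<omega> = Y n \<omega> + (\<Sum>l<n. - a l n * \<xi> l \<omega>)" for \<omega>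
    by (subst gram_schmidt_eq) (simp add: sum_negf)
  then have "expectation (\<lambda>\<omega>. \<xi> n \<omega> * \<xi> m \<omega>)
    = expectation (\<lambda>\<omega>. (Y n \<omega> + (\<Sum>l<n. - a l n * \<xi> l \<omega>)) * \<xi> m \<omega>)" by simp
  also have "\<dots> = expectation (\<lambda>\<omega>. Y n \<omega> * \<xi> m \<omega>) - a m n * v m"
    using less.prems by (subst expectation_expand[OF lincomb_base gram_schmidt_lincomb], subst s) simp
  finally show ?case by (simp add: coeff_mult v_def)
qed

lemma orthogonal: "expectation (\<lambda>\<omega>. \<xi> m \<omega> * \<xi> n \<omega>) = (if m = n then v n else 0)"
  using orthogonal_less[of m n] orthogonal_less[of n m] v_eq[of n]
  by (cases m n rule: linorder_cases) (auto simp: mult.commute)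

lemma Y_decomp: "Y k \<omega> = \<xi> k \<omega> + (\<Sum>i<k. a i k * \<xi> i \<omega>)"
  using gram_schmidt_eq[of M Y k \<omega>] by simp

lemma expectation_Y_xi:
  "k \<le> l \<Longrightarrow> expectation (\<lambda>\<omega>. Y k \<omega> * \<xi> l \<omega>) = (if k = l then v k else 0)"
  unfolding Y_decomp[of k] 
  by (subst expectation_expand[OF gram_schmidt_lincomb gram_schmidt_lincomb]) (simp add: orthogonal)

lemma coeff_eq_0: "k < l \<Longrightarrow> a l k = 0"
  by (simp add: gs_coeff_def expectation_Y_xi)

text \<open>The difference from \<open>Y_decomp\<close> is the diagonal coefficient,
  \<open>a k k\<close> instead of 1. The two agree unless \<open>\<xi> k\<close> is null; then
  \<open>a k k = 0\<close>, but \<open>\<xi> k = 0\<close> almost surely. This form is wanted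
  because the \<open>a l k\<close> are, up to scale, covariances with \<open>\<xi> l\<close>, hence
  admissible shifts in the zero-one law.\<close>

lemma AE_representation: "AE \<omega> in M. \<forall>k. Y k \<omega> = (\<Sum>l\<le>k. a l k * \<xi> l \<omega>)"
  unfolding AE_all_countable
proof
  fix k
  have S: "(\<Sum>l\<le>k. a l k * \<xi> l \<omega>) = (\<Sum>i<k. a i k * \<xi> i \<omega>) + a k k * \<xi> k \<omega>" for \<omega>
    by (simp add: lessThan_Suc_atMost[symmetric])
  show "AE \<omega> in M. Y k \<omega> = (\<Sum>l\<le>k. a l k * \<xi> l \<omega>)"
  proof (cases "expectation (\<lambda>\<omega>. (\<xi> k \<omega>)\<^sup>2) = 0")
    case True
    from AE_xi_zero[OF this] show ?thesis by eventually_elim (simp add: Y_decomp[of k] S)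
  next
    case False
    then have "a k k = 1" by (simp add: gs_coeff_def expectation_Y_xi v_def)
    then show ?thesis by (simp only: Y_decomp S) simp
  qed
qed

lemma variance_combination:
  assumes "finite F"
  shows "expectation (\<lambda>\<omega>. (\<Sum>i\<in>F. c i * \<xi> i \<omega>)\<^sup>2) = (\<Sum>i\<in>F. (c i)\<^sup>2 * v i)"
proof -
  define S where "S = (\<lambda>\<omega>. \<Sum>i\<in>F. c i * \<xi> i \<omega>)"
  have S: "S \<in> lincomb Y" unfolding S_def by (intro lincomb_sum gram_schmidt_lincomb)
  have "expectation (\<lambda>\<omega>. \<xi> j \<omega> * S \<omega>) = c j * v j" if "j \<in> F" for j
  proof -
    have "expectation (\<lambda>\<omega>. \<xi> j \<omega> * S \<omega>) = expectation (\<lambda>\<omega>. (0 + (\<Sum>i\<in>F. c i * \<xi> i \<omega>)) * \<xi> j \<omega>)"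
      by (simp add: S_def mult.commute)
    also have "\<dots> = (\<Sum>i\<in>F. if i = j then c i * v i else 0)"
      by (subst expectation_expand[OF lincomb_zero gram_schmidt_lincomb])
         (auto simp: orthogonal intro!: sum.cong)
    finally show ?thesis using that assms by simp
  qed
  moreover have "expectation (\<lambda>\<omega>. (S \<omega>)\<^sup>2) = expectation (\<lambda>\<omega>. (0 + (\<Sum>i\<in>F. c i * \<xi> i \<omega>)) * S \<omega>)"
    by (simp add: S_def power2_eq_square)
  ultimately have "expectation (\<lambda>\<omega>. (S \<omega>)\<^sup>2) = (\<Sum>i\<in>F. (c i)\<^sup>2 * v i)"
    using expectation_expand[OF lincomb_zero S, of c F]
    by (simp add: power2_eq_square mult.assoc)
  then show ?thesis by (simp add: S_def)
qed

text \<open>Orthogonality makes the variance of a combination additive, and the Gaussian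
  characteristic function turns this sum into a product.\<close>

lemma indep_xi: "indep_vars (\<lambda>_. borel) \<xi> UNIV"
proof (rule indep_vars_of_char_factor)
  fix F :: "nat set" and c :: "nat \<Rightarrow> real" assume F: "finite F"
  have n: "centered_normal_rv M (\<lambda>\<omega>. \<Sum>i\<in>F. c i * \<xi> i \<omega>)"
    by (intro lincomb_normal lincomb_sum gram_schmidt_lincomb)
  have "expectation (\<lambda>\<omega>. iexp (\<Sum>i\<in>F. c i * \<xi> i \<omega>))
     = complex_of_real (exp (- (\<Sum>i\<in>F. (c i)\<^sup>2 * v i) / 2))"
    using centered_normal_rv_char[OF n, of 1] variance_combination[OF F, of c]
    by (simp del: of_real_sum of_real_mult)
  also have "- (\<Sum>i\<in>F. (c i)\<^sup>2 * v i) / 2 = (\<Sum>i\<in>F. - ((c i)\<^sup>2 * v i) / 2)"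
    by (simp add: sum_negf sum_divide_distrib)
  also have "complex_of_real (exp \<dots>) = (\<Prod>i\<in>F. complex_of_real (exp (- ((c i)\<^sup>2 * v i) / 2)))"
    using F by (simp add: exp_sum)
  also have "\<dots> = (\<Prod>i\<in>F. expectation (\<lambda>\<omega>. iexp (c i * \<xi> i \<omega>)))"
    unfolding v_def by (simp only: centered_normal_rv_char[OF lincomb_normal[OF gram_schmidt_lincomb]])
  finally show "expectation (\<lambda>\<omega>. iexp (\<Sum>i\<in>F. c i * \<xi> i \<omega>)) = (\<Prod>i\<in>F. expectation (\<lambda>\<omega>. iexp (c i * \<xi> i \<omega>)))" .
qed simp

end

section \<open>Gaussian tails and small-ball probabilities\<close>

lemma std_normal_density_antimono:
  assumes "\<bar>x\<bar> \<le> y" shows "std_normal_density y \<le> std_normal_density x"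
  using power_mono[OF assms, of 2] by (simp add: std_normal_density_def divide_right_mono)

context prob_space begin

lemma std_normal_prob:
  assumes "distributed M lborel Z std_normal_density" and [measurable]: "A \<in> sets borel"
  shows "ennreal (prob (Z -` A \<inter> space M)) = (\<integral>\<^sup>+z. ennreal (std_normal_density z) * indicator A z \<partial>lborel)"
proof -
  have "emeasure M (Z -` A \<inter> space M) = emeasure (distr M lborel Z) A"
    using distributed_measurable[OF assms(1)] by (subst emeasure_distr) auto
  also have "\<dots> = (\<integral>\<^sup>+z. ennreal (std_normal_density z) * indicator A z \<partial>lborel)"
    unfolding distributed_distr_eq_density[OF assms(1)] by (subst emeasure_density) auto
  finally show ?thesis by (simp add: emeasure_eq_measure)
qed

text \<open>Only the mass of \<open>X / \<sigma>\<close> on the unit interval just above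
  \<open>x / \<sigma>\<close> is kept. The density there is at least its value at the right end,
  which explains the \<open>+ 1\<close>, and \<open>s \<le> \<sigma>\<close> brings that end below
  \<open>x / s + 1\<close>.\<close>

lemma centered_normal_lower_tail:
  assumes X: "centered_normal_rv M X" and s: "0 < s" "s\<^sup>2 \<le> expectation (\<lambda>\<omega>. (X \<omega>)\<^sup>2)" and x: "0 \<le> x"
  shows "std_normal_density (x / s + 1) \<le> prob {\<omega>\<in>space M. x < X \<omega>}"
  using X
proof (cases rule: centered_normal_rv_cases)
  case zero
  have "expectation (\<lambda>\<omega>. (X \<omega>)\<^sup>2) = expectation (\<lambda>\<omega>. 0::real)"
    using zero centered_normal_rv_measurable[OF X] by (intro integral_cong_AE) auto
  then show ?thesis using s by (simp add: zero_less_power[of s 2] not_le)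
next
  case (normal \<sigma>)
  have [measurable]: "X \<in> borel_measurable M" by (rule centered_normal_rv_measurable[OF X])
  have \<sigma>: "s \<le> \<sigma>" using s normal by (simp add: power2_le_iff_abs_le)
  define y where "y = x / \<sigma>"
  have y: "0 \<le> y" "y \<le> x / s" using x \<sigma> s by (auto simp: y_def intro: divide_left_mono)
  have "ennreal (std_normal_density (y + 1)) = (\<integral>\<^sup>+z. ennreal (std_normal_density (y + 1)) * indicator {y<..y + 1} z \<partial>lborel)"
    by (subst nn_integral_cmult_indicator) auto
  also have "\<dots> \<le> (\<integral>\<^sup>+z. ennreal (std_normal_density z) * indicator {y<..y + 1} z \<partial>lborel)"
    using y by (intro nn_integral_mono) (auto simp: indicator_def intro!: ennreal_leI std_normal_density_antimono)
  also have "\<dots> = prob ((\<lambda>\<omega>. X \<omega> / \<sigma>) -` {y<..y + 1} \<inter> space M)"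
    by (rule std_normal_prob[symmetric]) (auto intro: normal)
  also have "\<dots> \<le> prob {\<omega>\<in>space M. x < X \<omega>}"
    using normal(1) by (intro ennreal_leI finite_measure_mono) (auto simp: y_def divide_less_cancel)
  finally have "std_normal_density (y + 1) \<le> prob {\<omega>\<in>space M. x < X \<omega>}" by (simp add: ennreal_le_iff)
  moreover have "std_normal_density (x / s + 1) \<le> std_normal_density (y + 1)"
    using y by (intro std_normal_density_antimono) auto
  ultimately show ?thesis by simp
qed

text \<open>The factor 4 in place of the sharp 2 lets one pointwise comparison do: for
  \<open>\<bar>z\<bar> \<ge> y\<close> half of the exponent gives
  \<open>exp (- (y\<^sup>2 / 4))\<close>, and the other half is, up to a constant, the density of
  variance 2, whose integral is 1.\<close>

lemma centered_normal_upper_tail: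
  assumes X: "centered_normal_rv M X" and s: "0 < s" "expectation (\<lambda>\<omega>. (X \<omega>)\<^sup>2) \<le> s\<^sup>2" and x: "0 < x"
  shows "prob {\<omega>\<in>space M. x \<le> \<bar>X \<omega>\<bar>} \<le> 2 * exp (- (x\<^sup>2 / (4 * s\<^sup>2)))"
  using X
proof (cases rule: centered_normal_rv_cases)
  case zero
  have [measurable]: "X \<in> borel_measurable M" by (rule centered_normal_rv_measurable[OF X])
  have "prob {\<omega>\<in>space M. x \<le> \<bar>X \<omega>\<bar>} = 0"
    using zero x by (subst prob_eq_0) (auto elim!: eventually_mono)
  then show ?thesis by simp
next
  case (normal \<sigma>)
  have [measurable]: "X \<in> borel_measurable M" by (rule centered_normal_rv_measurable[OF X])
  have \<sigma>: "\<sigma> \<le> s" using s normal by (simp add: power2_le_iff_abs_le)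
  define y where "y = x / \<sigma>"
  have y: "0 \<le> y" "x / s \<le> y" using x \<sigma> s normal by (auto simp: y_def intro: divide_left_mono)
  define A where "A = {z::real. y \<le> \<bar>z\<bar>}"
  have [measurable]: "A \<in> sets borel" unfolding A_def by measurable
  have bd: "std_normal_density z * indicator A z \<le> 2 * exp (- (y\<^sup>2 / 4)) * normal_density 0 (sqrt 2) z" for z
  proof (cases "z \<in> A")
    case True
    then have "y\<^sup>2 \<le> z\<^sup>2" using y by (simp add: A_def abs_le_square_iff[symmetric])
    then have "exp (- z\<^sup>2 / 2) \<le> exp (- (y\<^sup>2 / 4)) * exp (- z\<^sup>2 / 4)"
      by (simp add: exp_add[symmetric])
    moreover have "1 / sqrt (2 * pi) \<le> 2 * (1 / sqrt (2 * pi * 2))"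
    proof -
      have "sqrt (2 * pi * 2) = sqrt (2*pi) * sqrt 2" by (simp add: real_sqrt_mult)
      moreover have "sqrt 2 \<le> 2" by (rule real_le_lsqrt) auto
      ultimately show ?thesis by (simp add: field_simps)
    qed
    ultimately have "1 / sqrt (2 * pi) * exp (- z\<^sup>2 / 2)
       \<le> 2 * (1 / sqrt (2 * pi * 2)) * (exp (- (y\<^sup>2 / 4)) * exp (- z\<^sup>2 / 4))"
      by (intro mult_mono) auto
    then show ?thesis using True by (simp add: std_normal_density_def normal_density_def mult_ac)
  qed simp
  have "ennreal (prob ((\<lambda>\<omega>. X \<omega> / \<sigma>) -` A \<inter> space M)) = (\<integral>\<^sup>+z. ennreal (std_normal_density z) * indicator A z \<partial>lborel)"
    by (rule std_normal_prob) (auto intro: normal)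
  also have "\<dots> = (\<integral>\<^sup>+z. ennreal (std_normal_density z * indicator A z) \<partial>lborel)"
    by (intro nn_integral_cong) (auto simp: indicator_def)
  also have "\<dots> \<le> (\<integral>\<^sup>+z. ennreal (2 * exp (- (y\<^sup>2 / 4)) * normal_density 0 (sqrt 2) z) \<partial>lborel)"
    by (intro nn_integral_mono ennreal_leI bd)
  also have "\<dots> = ennreal (2 * exp (- (y\<^sup>2 / 4)))"
    by (subst nn_integral_eq_integral) auto
  finally have "prob ((\<lambda>\<omega>. X \<omega> / \<sigma>) -` A \<inter> space M) \<le> 2 * exp (- (y\<^sup>2 / 4))"
    by (subst (asm) ennreal_le_iff) auto
  moreover have "(\<lambda>\<omega>. X \<omega> / \<sigma>) -` A \<inter> space M = {\<omega>\<in>space M. x \<le> \<bar>X \<omega>\<bar>}"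
    using normal(1) by (auto simp: A_def y_def divide_le_cancel)
  moreover have "(x / s)\<^sup>2 \<le> y\<^sup>2" using y x s by (intro power_mono) auto
  ultimately have "prob {\<omega>\<in>space M. x \<le> \<bar>X \<omega>\<bar>} \<le> 2 * exp (- (y\<^sup>2 / 4))" "- (y\<^sup>2 / 4) \<le> - (x\<^sup>2 / (4 * s\<^sup>2))"
    by (simp_all add: power_divide mult.commute)
  then show ?thesis
    using exp_le_cancel_iff[of "- (y\<^sup>2 / 4)" "- (x\<^sup>2 / (4 * s\<^sup>2))"] by linarith
qed

end

context gaussian_sequence begin

text \<open>Replacing \<open>Y i\<close> by 0 from index \<open>k\<close> on lets
  \<open>lincomb\<close> describe the span of the first \<open>k\<close> variables.\<close>

lemma xi_lincomb_below:
  "n < k \<Longrightarrow> \<xi> n \<in> lincomb (\<lambda>i \<omega>. if i < k then Y i \<omega> else 0)"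
proof (induction n rule: less_induct)
  case (less n)
  have "(\<lambda>\<omega>. (if n < k then Y n \<omega> else 0) - (\<Sum>l<n. a l n * \<xi> l \<omega>)) \<in> lincomb (\<lambda>i \<omega>. if i < k then Y i \<omega> else 0)"
    using less by (intro lincomb_diff lincomb_sum lincomb_base[where Y="\<lambda>i \<omega>. if i < k then Y i \<omega> else 0"]) auto
  also have "(\<lambda>\<omega>. (if n < k then Y n \<omega> else 0) - (\<Sum>l<n. a l n * \<xi> l \<omega>)) = \<xi> n"
    using less.prems by (intro ext) (simp add: Y_decomp[of n])
  finally show ?case .
qed

text \<open>\<open>v k\<close> is the variance of one particular prediction error, so it inherits
  any bound valid for all linear predictions.\<close>

lemma v_lower:
  assumes "\<And>W. W \<in> lincomb (\<lambda>i \<omega>. if i < k then Y i \<omega> else 0) \<Longrightarrow> s \<le> expectation (\<lambda>\<omega>. (Y k \<omega> - W \<omega>)\<^sup>2)"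
  shows "s \<le> v k"
proof -
  have "s \<le> expectation (\<lambda>\<omega>. (Y k \<omega> - (\<Sum>l<k. a l k * \<xi> l \<omega>))\<^sup>2)"
    by (intro assms lincomb_sum xi_lincomb_below) auto
  then show ?thesis by (simp add: v_def Y_decomp[of k])
qed

text \<open>Successive conditioning: \<open>Y K\<close> is the innovation \<open>\<xi> K\<close>
  plus a prediction \<open>W\<close> that depends on the earlier innovations only. If
  \<open>\<xi> K\<close> leaves \<open>[-x, x]\<close> on the side to which \<open>W\<close> points,
  so does \<open>Y K\<close>. By independence this has chance at least \<open>q\<close> whatever the
  past, so each variable costs a factor \<open>1 - q\<close>.\<close>

lemma small_ball:
  assumes s: "0 < s" "\<And>k. s\<^sup>2 \<le> v k" and x: "0 \<le> x"
  shows "prob {\<omega>\<in>space M. \<forall>k<K. \<bar>Y k \<omega>\<bar> \<le> x} \<le> (1 - std_normal_density (x / s + 1)) ^ K"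
proof (induction K)
  case (Suc K)
  define q where "q = std_normal_density (x / s + 1)"
  define W where "W f = (\<Sum>l<K. a l K * f l)" for f :: "nat \<Rightarrow> real"
  \<comment> \<open>The event for the first \<open>K\<close> variables, rewritten in terms of the
    innovations so that it lives on the product space of the past.\<close>
  define P where "P f \<longleftrightarrow> (\<forall>k<K. \<bar>f k + (\<Sum>l<k. a l k * f l)\<bar> \<le> x)" for f :: "nat \<Rightarrow> real"
  let ?N = "PiM {..<K} (\<lambda>_. borel :: real measure)"
  let ?r = "\<lambda>\<omega>. restrict (\<lambda>i. \<xi> i \<omega>) {..<K}"
  have comp: "(\<lambda>f. f i) \<in> borel_measurable ?N" if "i < K" for i
    using that by (intro measurable_component_singleton) auto
  have Wm[measurable]: "W \<in> borel_measurable ?N"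
    unfolding W_def by (intro borel_measurable_sum borel_measurable_times borel_measurable_const comp) auto
  have Pm[measurable]: "Measurable.pred ?N P"
    unfolding P_def Ball_def[symmetric] lessThan_iff[symmetric]
  proof (intro pred_intros_finite)
    fix k assume "k \<in> {..<K}"
    then have "(\<lambda>f. f k + (\<Sum>l<k. a l k * f l)) \<in> borel_measurable ?N"
      by (intro borel_measurable_add borel_measurable_sum borel_measurable_times borel_measurable_const comp) auto
    then show "Measurable.pred ?N (\<lambda>f. \<bar>f k + (\<Sum>l<k. a l k * f l)\<bar> \<le> x)" by measurable
  qed simp
  have Pr: "P (?r \<omega>) \<longleftrightarrow> (\<forall>k<K. \<bar>Y k \<omega>\<bar> \<le> x)" for \<omega>
  proof -
    have "?r \<omega> k + (\<Sum>l<k. a l k * ?r \<omega> l) = Y k \<omega>" if "k < K" for k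
      using that by (simp add: Y_decomp[of k])
    then show ?thesis unfolding P_def by metis
  qed
  have Wr: "Y K \<omega> = \<xi> K \<omega> + W (?r \<omega>)" for \<omega>
    by (simp add: W_def Y_decomp[of K])
  have ind: "indep_var ?N ?r (PiM {K} (\<lambda>_. borel)) (\<lambda>\<omega>. restrict (\<lambda>i. \<xi> i \<omega>) {K})"
    by (rule indep_var_restrict[OF indep_xi]) auto
  have indep: "prob {\<omega>\<in>space M. ?r \<omega> \<in> S \<and> \<xi> K \<omega> \<in> B} = prob {\<omega>\<in>space M. ?r \<omega> \<in> S} * prob {\<omega>\<in>space M. \<xi> K \<omega> \<in> B}"
    if "S \<in> sets ?N" "B \<in> sets borel" for S B
  proof -
    have B: "(\<lambda>f. f K) -` B \<inter> space (PiM {K} (\<lambda>_. borel :: real measure)) \<in> sets (PiM {K} (\<lambda>_. borel))"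
      using that(2) by (intro measurable_sets[OF measurable_component_singleton]) auto
    have "(\<lambda>\<omega>. (?r \<omega>, restrict (\<lambda>i. \<xi> i \<omega>) {K})) -` (S \<times> ((\<lambda>f. f K) -` B \<inter> space (PiM {K} (\<lambda>_. borel :: real measure)))) \<inter> space M
       = {\<omega>\<in>space M. ?r \<omega> \<in> S \<and> \<xi> K \<omega> \<in> B}"
      by (auto simp: space_PiM)
    moreover have "(\<lambda>\<omega>. restrict (\<lambda>i. \<xi> i \<omega>) {K}) -` ((\<lambda>f. f K) -` B \<inter> space (PiM {K} (\<lambda>_. borel :: real measure))) \<inter> space M
        = {\<omega>\<in>space M. \<xi> K \<omega> \<in> B}" by (auto simp: space_PiM)
    moreover have "?r -` S \<inter> space M = {\<omega>\<in>space M. ?r \<omega> \<in> S}" by auto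
    ultimately show ?thesis using indep_varD[OF ind that(1) B] by simp
  qed
  have tails: "q \<le> prob {\<omega>\<in>space M. x < \<xi> K \<omega>}" "q \<le> prob {\<omega>\<in>space M. x < - \<xi> K \<omega>}"
    unfolding q_def using s x
    by (auto intro!: centered_normal_lower_tail lincomb_normal gram_schmidt_lincomb
          lincomb_scale[where a="-1", simplified] simp: v_def)
  define S where "S = {f\<in>space ?N. P f}"
  \<comment> \<open>The sign of the prediction decides on which side \<open>\<xi> K\<close> must
    escape. For \<open>W f = 0\<close> either side works, and the upper one is taken.\<close>
  define Sp where "Sp = {f\<in>space ?N. P f \<and> 0 \<le> W f}"
  define Sm where "Sm = {f\<in>space ?N. P f \<and> W f < 0}"
  have [measurable]: "S \<in> sets ?N" "Sp \<in> sets ?N" "Sm \<in> sets ?N"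
    unfolding S_def Sp_def Sm_def by measurable
  have rN[measurable]: "?r \<in> measurable M ?N" by measurable
  have rs: "?r \<omega> \<in> space ?N" for \<omega> by (simp add: space_PiM)
  let ?E = "\<lambda>S. {\<omega>\<in>space M. ?r \<omega> \<in> S}"
  let ?Ep = "{\<omega>\<in>space M. ?r \<omega> \<in> Sp \<and> \<xi> K \<omega> \<in> {x<..}}" and ?Em = "{\<omega>\<in>space M. ?r \<omega> \<in> Sm \<and> \<xi> K \<omega> \<in> {..<-x}}"
  have S: "prob (?E S) = prob (?E Sp) + prob (?E Sm)"
  proof -
    have "?E S = ?E Sp \<union> ?E Sm" by (auto simp: S_def Sp_def Sm_def)
    moreover have "prob (?E Sp \<union> ?E Sm) = prob (?E Sp) + prob (?E Sm)"
      by (rule finite_measure_Union) (auto simp: Sp_def Sm_def)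
    ultimately show ?thesis by simp
  qed
  have "{\<omega>\<in>space M. \<forall>k<Suc K. \<bar>Y k \<omega>\<bar> \<le> x} \<subseteq> ?E S - (?Ep \<union> ?Em)"
  proof
    fix \<omega> assume w: "\<omega> \<in> {\<omega>\<in>space M. \<forall>k<Suc K. \<bar>Y k \<omega>\<bar> \<le> x}"
    then have "\<bar>\<xi> K \<omega> + W (?r \<omega>)\<bar> \<le> x" "P (?r \<omega>)" by (auto simp: Pr Wr[symmetric] simp del: restrict_apply)
    then show "\<omega> \<in> ?E S - (?Ep \<union> ?Em)" using w rs by (auto simp: S_def Sp_def Sm_def)
  qed
  then have "prob {\<omega>\<in>space M. \<forall>k<Suc K. \<bar>Y k \<omega>\<bar> \<le> x} \<le> prob (?E S - (?Ep \<union> ?Em))"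
    by (intro finite_measure_mono) auto
  also have "\<dots> = prob (?E S) - prob (?Ep \<union> ?Em)"
    by (intro finite_measure_Diff) (auto simp: S_def Sp_def Sm_def)
  also have "prob (?Ep \<union> ?Em) = prob ?Ep + prob ?Em"
    by (intro finite_measure_Union) (auto simp: Sp_def Sm_def)
  also have "\<dots> = prob (?E Sp) * prob {\<omega>\<in>space M. \<xi> K \<omega> \<in> {x<..}} + prob (?E Sm) * prob {\<omega>\<in>space M. \<xi> K \<omega> \<in> {..<-x}}"
    by (intro arg_cong2[where f="(+)"] indep) auto
  also have "prob (?E S) - \<dots> \<le> prob (?E S) - (prob (?E Sp) * q + prob (?E Sm) * q)"
    using tails by (intro diff_left_mono add_mono mult_left_mono) (auto simp: less_minus_iff)
  also have "\<dots> = prob (?E S) * (1 - q)" unfolding S by (simp add: algebra_simps)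
  also have "\<dots> \<le> (1 - q) ^ K * (1 - q)"
  proof (rule mult_right_mono)
    have "?E S = {\<omega>\<in>space M. \<forall>k<K. \<bar>Y k \<omega>\<bar> \<le> x}" using Pr rs by (auto simp: S_def simp del: restrict_apply)
    then show "prob (?E S) \<le> (1 - q) ^ K" using Suc.IH by (simp add: q_def)
    show "0 \<le> 1 - q" using order_trans[OF tails(1) prob_le_1] by simp
  qed
  finally show ?case by (simp add: q_def mult.commute)
qed (simp add: prob_space)

end

section \<open>A zero-one law\<close>

context prob_space begin

text \<open>The set of rationals \<open>q\<close> with \<open>L \<omega> \<le> q\<close> is almost
  surely one fixed set, and such a cut determines an extended real.\<close>

lemma AE_const_of_zero_one:
  fixes L :: "'a \<Rightarrow> ereal"
  assumes [measurable]: "L \<in> borel_measurable M"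
    and zo: "\<And>c. prob {\<omega>\<in>space M. L \<omega> \<le> c} = 0 \<or> prob {\<omega>\<in>space M. L \<omega> \<le> c} = 1"
  shows "\<exists>c. AE \<omega> in M. L \<omega> = c"
proof -
  have "AE \<omega> in M. \<forall>q::rat. L \<omega> \<le> ereal (of_rat q) \<longleftrightarrow> prob {\<omega>\<in>space M. L \<omega> \<le> ereal (of_rat q)} = 1"
    unfolding AE_all_countable
  proof
    fix q :: rat
    let ?A = "{\<omega>\<in>space M. L \<omega> \<le> ereal (of_rat q)}"
    show "AE \<omega> in M. L \<omega> \<le> ereal (of_rat q) \<longleftrightarrow> prob ?A = 1"
    proof (cases "prob ?A = 1")
      case True
      then have "AE \<omega> in M. \<omega> \<in> ?A" by (subst AE_in_set_eq_1) auto
      then show ?thesis unfolding True by eventually_elim auto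
    next
      case False
      then have "prob ?A = 0" using zo by blast
      then have "AE \<omega> in M. \<omega> \<notin> ?A" by (subst (asm) prob_eq_0) auto
      with AE_space[of M] show ?thesis by eventually_elim (use False in auto)
    qed
  qed
  then have *: "AE \<omega> in M. \<forall>q::rat. L \<omega> \<le> ereal (of_rat q) \<longleftrightarrow> prob {\<omega>\<in>space M. L \<omega> \<le> ereal (of_rat q)} = 1" .
  \<comment> \<open>Any sample point of the full-measure event can name the constant.\<close>
  obtain \<omega>0 where w0: "\<forall>q::rat. L \<omega>0 \<le> ereal (of_rat q) \<longleftrightarrow> prob {\<omega>\<in>space M. L \<omega> \<le> ereal (of_rat q)} = 1"
    using eventually_happens[OF *] prob_space.ae_filter_bot[OF prob_space_axioms] by (auto simp: trivial_limit_def)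
  from * have "AE \<omega> in M. L \<omega> = L \<omega>0"
  proof eventually_elim
    case (elim \<omega>)
    then have eq: "L \<omega> \<le> ereal (of_rat q) \<longleftrightarrow> L \<omega>0 \<le> ereal (of_rat q)" for q :: rat using w0 by auto
    show ?case
    proof (rule ccontr)
      assume "L \<omega> \<noteq> L \<omega>0"
      then consider "L \<omega> < L \<omega>0" | "L \<omega>0 < L \<omega>" by (auto simp: neq_iff)
      then show False
      proof cases
        case 1
        from ereal_dense3[OF this] obtain q :: rat where "L \<omega> < real_of_rat q" "real_of_rat q < L \<omega>0" by auto
        with eq[of q] show False by auto
      next
        case 2
        from ereal_dense3[OF this] obtain q :: rat where "L \<omega>0 < real_of_rat q" "real_of_rat q < L \<omega>" by auto
        with eq[of q] show False by auto
      qed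
    qed
  qed
  then show ?thesis by blast
qed

end

context gaussian_sequence begin

text \<open>The hypothesis \<open>inv\<close> says that \<open>\<Lambda>\<close> does not see shifts by elements of the Cameron--Martin
  space; this makes \<open>\<Lambda> (Y)\<close> a tail function of the orthogonal sequence \<open>\<xi>\<close>.\<close>
lemma shift_invariant_AE_const:
  fixes \<Lambda> :: "(nat \<Rightarrow> real) \<Rightarrow> ereal"
  assumes meas[measurable]: "\<Lambda> \<in> borel_measurable (PiM UNIV (\<lambda>_. borel))"
    and inv: "\<And>w Z. Z \<in> borel_measurable M \<Longrightarrow> integrable M (\<lambda>\<omega>. (Z \<omega>)\<^sup>2)
       \<Longrightarrow> \<Lambda> (\<lambda>k. w k + expectation (\<lambda>\<omega>. Y k \<omega> * Z \<omega>)) = \<Lambda> w"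
  shows "\<exists>c. AE \<omega> in M. \<Lambda> (\<lambda>k. Y k \<omega>) = c"
proof -
  \<comment> \<open>The representation with the first \<open>m\<close> coordinates removed; the
    entries are finite sums.\<close>
  define R where "R m \<omega> k = (\<Sum>l\<in>{m..k}. a l k * \<xi> l \<omega>)" for m \<omega> k
  have inv': "\<Lambda> (\<lambda>k. w k + a m k * r) = \<Lambda> w" for w m r
  proof -
    \<comment> \<open>Covariances with this multiple of \<open>\<xi> m\<close> are \<open>r\<close>
      times the coefficients \<open>a m k\<close>. If \<open>v m = 0\<close>, division by 0 makes
      both the variable and the coefficients 0.\<close>
    let ?Z = "\<lambda>\<omega>. (r / v m) * \<xi> m \<omega>"
    have Z: "?Z \<in> lincomb Y" by (intro lincomb_scale gram_schmidt_lincomb)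
    have "expectation (\<lambda>\<omega>. Y k \<omega> * ?Z \<omega>) = a m k * r" for k
    proof -
      have "expectation (\<lambda>\<omega>. Y k \<omega> * ?Z \<omega>) = expectation (\<lambda>\<omega>. (r / v m) * (Y k \<omega> * \<xi> m \<omega>))"
        by (simp add: mult_ac)
      also have "\<dots> = a m k * r" unfolding integral_mult_right_zero by (simp add: gs_coeff_def v_def)
      finally show ?thesis .
    qed
    then show ?thesis
      using inv[of ?Z w] lincomb_measurable[OF Z] centered_normal_rv_square_integrable[OF lincomb_normal[OF Z]]
      by simp
  qed
  \<comment> \<open>Dropping one more coordinate is an admissible shift, which
    \<open>\<Lambda>\<close> does not see. So, for every \<open>m\<close>, the value
    \<open>\<Lambda> (R 0 \<omega>)\<close> is a function of the \<open>\<xi> i\<close> with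
    \<open>i \<ge> m\<close>.\<close>
  have R_eq: "\<Lambda> (R m \<omega>) = \<Lambda> (R 0 \<omega>)" for m \<omega>
  proof (induction m)
    case (Suc m)
    have "R m \<omega> k = R (Suc m) \<omega> k + a m k * \<xi> m \<omega>" for k
    proof (cases "m \<le> k")
      case True
      then show ?thesis by (simp add: R_def sum.atLeast_Suc_atMost[of m k])
    qed (simp add: R_def coeff_eq_0)
    then have "R m \<omega> = (\<lambda>k. R (Suc m) \<omega> k + a m k * \<xi> m \<omega>)" by auto
    then show ?case using inv'[of "R (Suc m) \<omega>" m "\<xi> m \<omega>"] Suc by simp
  qed simp
  define L where "L \<omega> = \<Lambda> (R 0 \<omega>)" for \<omega>
  define A where "A i = {\<xi> i -` B \<inter> space M | B. B \<in> sets (borel :: real measure)}" for i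
  have A_sub: "A i \<subseteq> events" for i unfolding A_def by auto
  have tail: "{\<omega>\<in>space M. L \<omega> \<le> c} \<in> tail_events A" for c
    unfolding tail_events_def
  proof
    fix m
    define N where "N = sigma (space M) (\<Union> (A ` {m..}))"
    have sub: "\<Union> (A ` {m..}) \<subseteq> Pow (space M)" using A_sub sets.space_closed by blast
    have spN: "space N = space M" and setsN: "sets N = sigma_sets (space M) (\<Union> (A ` {m..}))"
      unfolding N_def using sub by auto
    have xm: "\<xi> i \<in> borel_measurable N" if "m \<le> i" for i
    proof (rule measurableI)
      fix B :: "real set" assume "B \<in> sets borel"
      then have "\<xi> i -` B \<inter> space M \<in> \<Union> (A ` {m..})" using that unfolding A_def by auto
      then show "\<xi> i -` B \<inter> space N \<in> sets N" unfolding spN setsN by (rule sigma_sets.Basic)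
    qed simp
    have "(\<lambda>\<omega>. R m \<omega>) \<in> measurable N (PiM UNIV (\<lambda>_. borel))"
    proof (rule measurable_PiM_single')
      fix k show "(\<lambda>\<omega>. R m \<omega> k) \<in> borel_measurable N"
        unfolding R_def by (intro borel_measurable_sum borel_measurable_times borel_measurable_const xm) auto
    qed simp
    then have "(\<lambda>\<omega>. \<Lambda> (R m \<omega>)) \<in> borel_measurable N" by measurable
    then have "{\<omega>\<in>space N. \<Lambda> (R m \<omega>) \<le> c} \<in> sets N" by measurable
    then show "{\<omega>\<in>space M. L \<omega> \<le> c} \<in> sigma_sets (space M) (\<Union> (A ` {m..}))"
      by (simp only: spN setsN R_eq[of m] L_def)
  qed
  have sig: "sigma_algebra (space M) (A i)" for i
  proof -
    have "A i = sets (vimage_algebra (space M) (\<xi> i) borel)"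
      unfolding A_def by (subst sets_vimage_algebra2) auto
    then show ?thesis using sets.sigma_algebra_axioms[of "vimage_algebra (space M) (\<xi> i) borel"] by simp
  qed
  have "indep_sets A UNIV" using indep_xi unfolding indep_vars_def2 A_def by auto
  then have zo: "prob {\<omega>\<in>space M. L \<omega> \<le> c} = 0 \<or> prob {\<omega>\<in>space M. L \<omega> \<le> c} = 1" for c
    using kolmogorov_0_1_law[OF sig _ tail] by blast
  have [measurable]: "(\<lambda>\<omega>. R 0 \<omega>) \<in> measurable M (PiM UNIV (\<lambda>_. borel))"
    by (rule measurable_PiM_single') (auto simp: R_def)
  have "L \<in> borel_measurable M" unfolding L_def by measurable
  from AE_const_of_zero_one[OF this zo] obtain c where "AE \<omega> in M. L \<omega> = c" by auto
  with AE_representation have "AE \<omega> in M. \<Lambda> (\<lambda>k. Y k \<omega>) = c"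
  proof eventually_elim
    case (elim \<omega>)
    then have "(\<lambda>k. Y k \<omega>) = R 0 \<omega>" by (auto simp: R_def atMost_atLeast0)
    then show ?case using elim by (simp add: L_def)
  qed
  then show ?thesis by blast
qed

end

section \<open>Power-type integrals\<close>

lemma nn_integral_lborel_scale:
  fixes f :: "'a::euclidean_space \<Rightarrow> ennreal"
  assumes [measurable]: "f \<in> borel_measurable borel" and c: "c > 0"
  shows "(\<integral>\<^sup>+x. f x \<partial>lborel) = ennreal (c ^ DIM('a)) * (\<integral>\<^sup>+x. f (c *\<^sub>R x) \<partial>lborel)"
  using c by (subst lborel_affine[of c 0])
    (simp_all add: nn_integral_density nn_integral_distr nn_integral_cmult)

lemma summable_geometric_powr:
  fixes d :: real assumes "d < 0" shows "summable (\<lambda>k::nat. 2 powr (d * real k))"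
proof -
  have "2 powr (d * real k) = (2 powr d) ^ k" for k by (simp add: powr_powr[symmetric] powr_realpow)
  moreover have "2 powr d < 1" using assms by (simp add: powr_less_one)
  ultimately show ?thesis by (simp add: summable_geometric)
qed

lemma ennreal_le_lincomb:
  fixes x y z c d :: real
  assumes "x \<le> c * y + d * z" "0 \<le> c" "0 \<le> d" "0 \<le> y" "0 \<le> z"
  shows "ennreal x \<le> ennreal c * ennreal y + ennreal d * ennreal z"
  using assms by (simp add: ennreal_mult'[symmetric] ennreal_plus[symmetric] ennreal_leI del: ennreal_plus)

lemma nn_integral_lincomb:
  assumes [measurable]: "f \<in> borel_measurable M" "g \<in> borel_measurable M"
  shows "(\<integral>\<^sup>+x. c * f x + d * g x \<partial>M) = c * (\<integral>\<^sup>+x. f x \<partial>M) + d * (\<integral>\<^sup>+x. g x \<partial>M)"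
  by (simp add: nn_integral_add nn_integral_cmult)

lemma ennreal_term_le_suminf:
  fixes F :: "nat \<Rightarrow> ennreal" shows "F k \<le> suminf F"
  using sum_le_suminf[of F "{k}"] by simp

text \<open>Balls stand in for annuli: each point is charged to one ball whose constant dominates
  there, which costs a factor in the applications but requires only volumes of balls.\<close>

lemma nn_integral_shells_finite:
  fixes f :: "'a::euclidean_space \<Rightarrow> real" and c r :: "nat \<Rightarrow> real"
  assumes dom: "\<And>x. x \<noteq> 0 \<Longrightarrow> f x \<noteq> 0 \<Longrightarrow> \<exists>k. norm x \<le> r k \<and> f x \<le> c k"
    and nonneg: "\<And>k. 0 \<le> c k" "\<And>k. 0 \<le> r k"
    and sum: "summable (\<lambda>k. c k * r k ^ DIM('a))"
  shows "(\<integral>\<^sup>+x. ennreal (f x) \<partial>lborel) < \<infinity>"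
proof -
  let ?V = "unit_ball_vol (real DIM('a))"
  have [measurable]: "cball (0::'a) (r k) \<in> sets borel" for k by (intro borel_closed closed_cball)
  have "(\<integral>\<^sup>+x. ennreal (f x) \<partial>lborel) \<le> (\<integral>\<^sup>+x. (\<Sum>k. ennreal (c k) * indicator (cball 0 (r k)) x) \<partial>(lborel :: 'a measure))"
  proof (rule nn_integral_mono_AE)
    show "AE x in lborel. ennreal (f x) \<le> (\<Sum>k. ennreal (c k) * indicator (cball (0::'a) (r k)) x)"
      using AE_lborel_singleton[of "0::'a"]
    proof eventually_elim
      case (elim x)
      show ?case
      proof (cases "f x = 0")
        case False
        with dom[OF elim] obtain k where k: "norm x \<le> r k" "f x \<le> c k" by auto
        have "ennreal (f x) \<le> ennreal (c k) * indicator (cball (0::'a) (r k)) x"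
          using k by (auto intro: ennreal_leI)
        also have "\<dots> \<le> (\<Sum>k. ennreal (c k) * indicator (cball (0::'a) (r k)) x)"
          by (rule ennreal_term_le_suminf)
        finally show ?thesis .
      qed simp
    qed
  qed
  also have "\<dots> = (\<Sum>k. ennreal (c k) * emeasure lborel (cball (0::'a) (r k)))"
    by (subst nn_integral_suminf) (auto simp: nn_integral_cmult_indicator)
  also have "\<dots> = (\<Sum>k. ennreal (?V * (c k * r k ^ DIM('a))))"
    using nonneg by (simp add: emeasure_cball ennreal_mult'[symmetric] mult_ac)
  also have "\<dots> < \<infinity>"
    using nonneg sum by (subst suminf_ennreal_eq[OF _ summable_sums]) (auto intro: summable_mult)
  finally show ?thesis .
qed

text \<open>The ball of radius \<open>2 powr (- k)\<close> contributes at most a constant times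
  \<open>2 powr ((g - d) * k)\<close>, with \<open>d\<close> the dimension, so \<open>g < d\<close>
  makes the series geometric.\<close>

lemma nn_integral_powr_near_0_finite:
  assumes g: "0 \<le> g" "g < real DIM('a::euclidean_space)"
  shows "(\<integral>\<^sup>+x. ennreal (norm (x::'a) powr (- g) * indicator {x. norm x \<le> 1} x) \<partial>lborel) < \<infinity>"
proof (rule nn_integral_shells_finite)
  fix x :: 'a assume x: "x \<noteq> 0" "norm x powr (- g) * indicator {x. norm x \<le> 1} x \<noteq> 0"
  then have n: "0 < norm x" "norm x \<le> 1" by (auto simp: indicator_def split: if_splits)
  define k where "k = nat \<lfloor>- log 2 (norm x)\<rfloor>"
  have l: "0 \<le> - log 2 (norm x)" using n by simp
  have k1: "real k \<le> - log 2 (norm x)" unfolding k_def using l by linarith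
  have k2: "- log 2 (norm x) < real k + 1" unfolding k_def using l by linarith
  have e: "norm x = 2 powr (log 2 (norm x))" using n by simp
  have "norm x \<le> 2 powr (- real k)"
    by (subst e, rule powr_mono) (use k1 in auto)
  moreover have "norm x powr (- g) \<le> 2 powr (g * (real k + 1))"
  proof -
    have "norm x powr (- g) = 2 powr (- log 2 (norm x) * g)"
      by (subst e, subst powr_powr) simp
    also have "\<dots> \<le> 2 powr (g * (real k + 1))"
      using mult_right_mono[of "- log 2 (norm x)" "real k + 1" g] k2 g
      by (intro powr_mono) (auto simp: mult_ac)
    finally show ?thesis .
  qed
  ultimately show "\<exists>k. norm x \<le> 2 powr (- real k) \<and> norm x powr (- g) * indicator {x. norm x \<le> 1} x \<le> 2 powr (g * (real k + 1))"
    using n by (auto intro!: exI[of _ k])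
next
  have "(\<lambda>k. 2 powr (g * (real k + 1)) * (2 powr - real k) ^ DIM('a))
     = (\<lambda>k. 2 powr g * 2 powr ((g - real DIM('a)) * real k))"
    by (auto simp: powr_realpow[symmetric] powr_powr powr_add[symmetric] algebra_simps)
  then show "summable (\<lambda>k. 2 powr (g * (real k + 1)) * (2 powr - real k) ^ DIM('a))"
    using summable_geometric_powr[of "g - real DIM('a)"] g by (simp add: summable_mult)
qed auto

lemma nn_integral_powr_at_infinity_finite:
  assumes g: "real DIM('a::euclidean_space) < g"
  shows "(\<integral>\<^sup>+x. ennreal (norm (x::'a) powr (- g) * indicator {x. 1 \<le> norm x} x) \<partial>lborel) < \<infinity>"
proof (rule nn_integral_shells_finite)
  fix x :: 'a assume x: "x \<noteq> 0" "norm x powr (- g) * indicator {x. 1 \<le> norm x} x \<noteq> 0"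
  then have n: "1 \<le> norm x" by (auto simp: indicator_def split: if_splits)
  have g0: "0 \<le> g" using g by linarith
  define k where "k = nat \<lfloor>log 2 (norm x)\<rfloor>"
  have l: "0 \<le> log 2 (norm x)" using n by (subst zero_le_log_cancel_iff) auto
  have k1: "real k \<le> log 2 (norm x)" unfolding k_def using l by linarith
  have k2: "log 2 (norm x) < real k + 1" unfolding k_def using l by linarith
  have e: "norm x = 2 powr (log 2 (norm x))" using n by (subst powr_log_cancel) auto
  have "norm x \<le> 2 powr (real k + 1)"
    by (subst e, rule powr_mono) (use k2 in auto)
  moreover have "norm x powr (- g) \<le> 2 powr (- g * real k)"
  proof -
    have "norm x powr (- g) = 2 powr (log 2 (norm x) * - g)"
      by (subst e, subst powr_powr) simp
    also have "\<dots> \<le> 2 powr (- g * real k)"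
      using mult_left_mono[OF k1 g0] by (intro powr_mono) (auto simp: mult_ac)
    finally show ?thesis .
  qed
  ultimately show "\<exists>k. norm x \<le> 2 powr (real k + 1) \<and> norm x powr (- g) * indicator {x. 1 \<le> norm x} x \<le> 2 powr (- g * real k)"
    using n by (auto intro!: exI[of _ k])
next
  have "(\<lambda>k. 2 powr (- g * real k) * (2 powr (real k + 1)) ^ DIM('a))
     = (\<lambda>k. 2 powr (real DIM('a)) * 2 powr ((real DIM('a) - g) * real k))"
    by (auto simp: powr_realpow[symmetric] powr_powr powr_add[symmetric] algebra_simps)
  then show "summable (\<lambda>k. 2 powr (- g * real k) * (2 powr (real k + 1)) ^ DIM('a))"
    using summable_geometric_powr[of "real DIM('a) - g"] g by (simp add: summable_mult)
qed auto

lemma nn_integral_cauchy_finite: "(\<integral>\<^sup>+(z::real). ennreal (1 / (1 + z\<^sup>2)) \<partial>lborel) < \<infinity>"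
proof -
  have "integrable lborel (\<lambda>x::real. inverse (1 + x\<^sup>2))"
    using integrable_inverse_1_plus_square by (simp add: set_integrable_def einterval_def)
  from nn_integral_eq_integral[OF this] have "(\<integral>\<^sup>+(z::real). ennreal (inverse (1 + z\<^sup>2)) \<partial>lborel) < \<infinity>"
    by (simp add: add_nonneg_nonneg)
  then show ?thesis by (simp add: inverse_eq_divide)
qed

text \<open>Split at \<open>\<bar>\<tau>\<bar> = \<bar>\<rho>\<bar> / 2\<close>. Beyond it the
  weight is at most \<open>(\<bar>\<rho>\<bar> / 2) powr (- a)\<close> and the kernel is integrable.
  Below it the kernel is at most \<open>1 / \<bar>\<rho>\<bar>\<close>, and \<open>a < 1\<close>
  makes the singular weight integrate to a multiple of
  \<open>\<bar>\<rho>\<bar> powr (1 - a)\<close>. The effect is to move the weight from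
  \<open>\<tau>\<close> to the centre \<open>\<rho>\<close> of the kernel.\<close>

lemma cauchy_kernel_powr_bound:
  fixes a :: real assumes a: "0 \<le> a" "a < 1"
  obtains C where "C > 0"
    "\<And>\<rho>. \<rho> \<noteq> 0 \<Longrightarrow> (\<integral>\<^sup>+\<tau>. ennreal (1 / (1 + (\<tau> - \<rho>)\<^sup>2) * \<bar>\<tau>\<bar> powr (- a)) \<partial>lborel) \<le> ennreal (C * \<bar>\<rho>\<bar> powr (- a))"
proof -
  obtain J where J: "(\<integral>\<^sup>+(z::real). ennreal (1 / (1 + z\<^sup>2)) \<partial>lborel) = ennreal J" "J \<ge> 0"
    using nn_integral_cauchy_finite by (cases "(\<integral>\<^sup>+(z::real). ennreal (1 / (1 + z\<^sup>2)) \<partial>lborel)") auto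
  obtain B where B: "(\<integral>\<^sup>+(x::real). ennreal (norm x powr (- a) * indicator {x. norm x \<le> 1} x) \<partial>lborel) = ennreal B" "B \<ge> 0"
    using nn_integral_powr_near_0_finite[where 'a=real, of a] a
    by (cases "(\<integral>\<^sup>+(x::real). ennreal (norm x powr (- a) * indicator {x. norm x \<le> 1} x) \<partial>lborel)") auto
  define C where "C = 2 powr a * J + (1/2) powr (1 - a) * B + 1"
  have "(\<integral>\<^sup>+\<tau>. ennreal (1 / (1 + (\<tau> - \<rho>)\<^sup>2) * \<bar>\<tau>\<bar> powr (- a)) \<partial>lborel) \<le> ennreal (C * \<bar>\<rho>\<bar> powr (- a))" if \<rho>: "\<rho> \<noteq> 0" for \<rho>
  proof -
    let ?p = "\<bar>\<rho>\<bar>"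
    let ?I = "\<lambda>\<tau>. \<bar>\<tau>\<bar> powr (- a) * indicator {x. norm x \<le> ?p / 2} \<tau> :: real"
    have p: "?p > 0" using \<rho> by simp
    have bd: "1 / (1 + (\<tau> - \<rho>)\<^sup>2) * \<bar>\<tau>\<bar> powr (- a) \<le> (?p/2) powr (- a) * (1 / (1 + (\<tau> - \<rho>)\<^sup>2)) + (1 / ?p) * ?I \<tau>" for \<tau>
    proof (cases "\<bar>\<tau>\<bar> \<le> ?p / 2")
      case True
      then have "?p / 2 \<le> \<bar>\<tau> - \<rho>\<bar>" by linarith
      then have "(?p / 2)\<^sup>2 \<le> (\<tau> - \<rho>)\<^sup>2" by (metis abs_le_square_iff abs_abs abs_divide abs_numeral)
      moreover have "?p \<le> 1 + (?p / 2)\<^sup>2" using zero_le_power2[of "?p/2 - 1"] by (simp add: power2_eq_square algebra_simps)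
      ultimately have "1 / (1 + (\<tau> - \<rho>)\<^sup>2) \<le> 1 / ?p" using p by (intro divide_left_mono) (auto intro!: mult_pos_pos add_pos_nonneg)
      then have "1 / (1 + (\<tau> - \<rho>)\<^sup>2) * \<bar>\<tau>\<bar> powr (- a) \<le> (1 / ?p) * \<bar>\<tau>\<bar> powr (- a)" by (intro mult_right_mono) auto
      moreover have "0 \<le> (?p/2) powr (- a) * (1 / (1 + (\<tau> - \<rho>)\<^sup>2))" by (auto intro!: mult_nonneg_nonneg)
      moreover have "(1 / ?p) * ?I \<tau> = (1 / ?p) * \<bar>\<tau>\<bar> powr (- a)" using True by simp
      ultimately show ?thesis by linarith
    next
      case False
      then have "\<bar>\<tau>\<bar> powr (- a) \<le> (?p/2) powr (- a)" using a p by (intro powr_mono2') auto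
      then have "1 / (1 + (\<tau> - \<rho>)\<^sup>2) * \<bar>\<tau>\<bar> powr (- a) \<le> 1 / (1 + (\<tau> - \<rho>)\<^sup>2) * (?p/2) powr (- a)" by (intro mult_left_mono) auto
      then show ?thesis using False by (simp add: mult.commute)
    qed
    have i1: "(\<integral>\<^sup>+\<tau>. ennreal (1 / (1 + (\<tau> - \<rho>)\<^sup>2)) \<partial>lborel) = ennreal J"
      using nn_integral_real_affine[of "\<lambda>\<tau>. ennreal (1 / (1 + (\<tau> - \<rho>)\<^sup>2))" 1 \<rho>] J by simp
    have i2: "(\<integral>\<^sup>+\<tau>. ennreal (?I \<tau>) \<partial>lborel) = ennreal ((?p/2) powr (1 - a) * B)"
    proof -
      have "(\<integral>\<^sup>+\<tau>. ennreal (?I \<tau>) \<partial>lborel) = ennreal (?p/2) * (\<integral>\<^sup>+\<tau>. ennreal (?I (?p/2 * \<tau>)) \<partial>lborel)"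
        using nn_integral_lborel_scale[of "\<lambda>\<tau>. ennreal (?I \<tau>)" "?p/2"] p by simp
      also have "(\<lambda>\<tau>. ennreal (?I (?p/2 * \<tau>))) = (\<lambda>\<tau>. ennreal ((?p/2) powr (-a)) * ennreal (norm \<tau> powr (- a) * indicator {x. norm x \<le> 1} \<tau>))"
        using p by (auto simp: abs_mult powr_mult indicator_def ennreal_mult'[symmetric] powr_divide field_simps)
      also have "(\<integral>\<^sup>+(\<tau>::real). ennreal ((?p/2) powr (-a)) * ennreal (norm \<tau> powr (- a) * indicator {x. norm x \<le> 1} \<tau>) \<partial>lborel) = ennreal ((?p/2) powr (-a)) * ennreal B"
        unfolding B(1)[symmetric] by (rule nn_integral_cmult) measurable
      also have "ennreal (?p/2) * \<dots> = ennreal ((?p/2) powr (1 - a) * B)"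
        using p B by (simp add: ennreal_mult'[symmetric] powr_diff powr_minus field_simps)
      finally show ?thesis .
    qed
    have "(\<integral>\<^sup>+\<tau>. ennreal (1 / (1 + (\<tau> - \<rho>)\<^sup>2) * \<bar>\<tau>\<bar> powr (- a)) \<partial>lborel)
      \<le> (\<integral>\<^sup>+\<tau>. ennreal ((?p/2) powr (- a)) * ennreal (1 / (1 + (\<tau> - \<rho>)\<^sup>2)) + ennreal (1 / ?p) * ennreal (?I \<tau>) \<partial>lborel)"
      by (intro nn_integral_mono ennreal_le_lincomb bd) auto
    also have "\<dots> = ennreal ((?p/2) powr (- a)) * ennreal J + ennreal (1 / ?p) * ennreal ((?p/2) powr (1 - a) * B)"
      unfolding i1[symmetric] i2[symmetric] by (rule nn_integral_lincomb) measurable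
    also have "\<dots> = ennreal ((?p/2) powr (- a) * J + (1 / ?p) * ((?p/2) powr (1 - a) * B))"
      using p J B by (simp add: ennreal_mult'[symmetric] ennreal_plus[symmetric] del: ennreal_plus)
    also have "\<dots> \<le> ennreal (C * ?p powr (- a))"
    proof (rule ennreal_leI)
      have "(?p/2) powr (- a) = 2 powr a * ?p powr (- a)"
        using p by (simp add: powr_divide powr_minus field_simps)
      moreover have "(1 / ?p) * (?p/2) powr (1 - a) = (1/2) powr (1 - a) * ?p powr (- a)"
        using p by (simp add: powr_divide powr_diff powr_minus field_simps)
      ultimately have "(?p/2) powr (- a) * J + (1 / ?p) * ((?p/2) powr (1 - a) * B)
        = (2 powr a * J + (1/2) powr (1 - a) * B) * ?p powr (- a)" by (simp add: algebra_simps)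
      also have "\<dots> \<le> C * ?p powr (- a)" unfolding C_def by (intro mult_right_mono) auto
      finally show "(?p/2) powr (- a) * J + (1 / ?p) * ((?p/2) powr (1 - a) * B) \<le> C * ?p powr (- a)" .
    qed
    finally show ?thesis .
  qed
  moreover have "C > 0" unfolding C_def using J B by (auto intro!: add_nonneg_pos add_nonneg_nonneg mult_nonneg_nonneg)
  ultimately show thesis using that by blast
qed

text \<open>Scaling by \<open>1 / \<delta>\<close> reduces to \<open>\<delta> = 1\<close>; there
  \<open>g < d\<close> gives integrability at 0 and \<open>d < g + 2\<close> at infinity,
  \<open>d\<close> being the dimension. For \<open>g = 2 * H - 1 + \<beta>\<close> these conditions
  say \<open>\<alpha> < 1\<close> and \<open>\<alpha> > 0\<close>.\<close>

lemma truncated_power_integral_bound: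
  fixes g :: real
  assumes g: "0 \<le> g" "g < real DIM('a::euclidean_space)" "real DIM('a) < g + 2"
  obtains C where "C > 0"
    "\<And>\<delta>. \<delta> > 0 \<Longrightarrow> (\<integral>\<^sup>+(x::'a). ennreal ((min \<delta> (2 / norm x))\<^sup>2 * norm x powr (- g)) \<partial>lborel)
        \<le> ennreal (C * \<delta> powr (g + 2 - real DIM('a)))"
proof -
  let ?f = "\<lambda>\<delta> (x::'a). (min \<delta> (2 / norm x))\<^sup>2 * norm x powr (- g)"
  let ?n = "\<lambda>x::'a. norm x powr (- g) * indicator {x. norm x \<le> 1} x"
  let ?i = "\<lambda>x::'a. norm x powr (- (g + 2)) * indicator {x. 1 \<le> norm x} x"
  have bd: "?f 1 x \<le> ?n x + 4 * ?i x" for x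
  proof (cases "norm x \<le> 1")
    case True
    have "(min 1 (2 / norm x))\<^sup>2 \<le> 1" by (rule power_le_one) (auto simp: min_def)
    then have "?f 1 x \<le> 1 * norm x powr (- g)" by (intro mult_right_mono) auto
    moreover have "0 \<le> 4 * ?i x" by auto
    moreover have "?n x = norm x powr (- g)" using True by simp
    ultimately show ?thesis by linarith
  next
    case False
    then have "0 \<le> min 1 (2 / norm x)" "0 < norm x" by (auto simp: min_def)
    then have "(min 1 (2 / norm x))\<^sup>2 \<le> (2 / norm x)\<^sup>2" by (intro power_mono) auto
    then have "?f 1 x \<le> (2 / norm x)\<^sup>2 * norm x powr (- g)" by (intro mult_right_mono) auto
    also have "\<dots> = 4 * norm x powr (- (g + 2))"
    proof -
      have "norm x powr (- (g + 2)) = norm x powr (- g) * norm x powr (- 2)"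
        by (simp add: powr_add[symmetric])
      also have "norm x powr (- 2) = 1 / (norm x)\<^sup>2"
        using \<open>0 < norm x\<close> by (simp add: powr_minus_divide)
      finally show ?thesis by (simp add: power_divide)
    qed
    finally show ?thesis using False by simp
  qed
  have "(\<integral>\<^sup>+x. ennreal (?f 1 x) \<partial>lborel) \<le> (\<integral>\<^sup>+x. ennreal 1 * ennreal (?n x) + ennreal 4 * ennreal (?i x) \<partial>lborel)"
    using bd by (intro nn_integral_mono ennreal_le_lincomb) auto
  also have "\<dots> = (\<integral>\<^sup>+x. ennreal (?n x) \<partial>lborel) + ennreal 4 * (\<integral>\<^sup>+x. ennreal (?i x) \<partial>lborel)"
    by (subst nn_integral_add) (auto simp: nn_integral_cmult)
  also have "\<dots> < \<infinity>"
    using nn_integral_powr_near_0_finite[where 'a='a, of g] nn_integral_powr_at_infinity_finite[where 'a='a, of "g+2"] g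
    by (auto simp: ennreal_mult_less_top)
  finally obtain B where B: "(\<integral>\<^sup>+x. ennreal (?f 1 x) \<partial>lborel) = ennreal B" "B \<ge> 0"
    by (cases "(\<integral>\<^sup>+x. ennreal (?f 1 x) \<partial>lborel)") auto
  have "(\<integral>\<^sup>+x. ennreal (?f \<delta> x) \<partial>lborel) = ennreal (B * \<delta> powr (g + 2 - real DIM('a)))" if d: "\<delta> > 0" for \<delta>
  proof -
    have "(\<integral>\<^sup>+x. ennreal (?f \<delta> x) \<partial>lborel) = ennreal ((1/\<delta>) ^ DIM('a)) * (\<integral>\<^sup>+x. ennreal (?f \<delta> ((1/\<delta>) *\<^sub>R x)) \<partial>lborel)"
      using d by (intro nn_integral_lborel_scale) auto
    also have "(\<lambda>x. ennreal (?f \<delta> ((1/\<delta>) *\<^sub>R x))) = (\<lambda>x. ennreal (\<delta> powr (g + 2)) * ennreal (?f 1 x))"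
    proof
      fix x :: 'a
      have "min \<delta> (2 / norm ((1/\<delta>) *\<^sub>R x)) = \<delta> * min 1 (2 / norm x)"
        using d by (simp add: min_mult_distrib_left mult.commute)
      moreover have "norm ((1/\<delta>) *\<^sub>R x) powr (- g) = \<delta> powr g * norm x powr (- g)"
        using d by (simp add: powr_divide powr_minus field_simps)
      ultimately have "?f \<delta> ((1/\<delta>) *\<^sub>R x) = \<delta> powr (g + 2) * ?f 1 x"
        using d by (simp add: power_mult_distrib powr_add algebra_simps)
      then show "ennreal (?f \<delta> ((1/\<delta>) *\<^sub>R x)) = ennreal (\<delta> powr (g + 2)) * ennreal (?f 1 x)"
        by (simp add: ennreal_mult')
    qed
    also have "(\<integral>\<^sup>+x. ennreal (\<delta> powr (g + 2)) * ennreal (?f 1 x) \<partial>lborel) = ennreal (\<delta> powr (g + 2)) * ennreal B"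
      by (subst nn_integral_cmult) (auto simp: B)
    also have "ennreal ((1/\<delta>) ^ DIM('a)) * \<dots> = ennreal (B * \<delta> powr (g + 2 - real DIM('a)))"
      using d B by (simp add: ennreal_mult'[symmetric] powr_diff powr_realpow field_simps)
    finally show ?thesis .
  qed
  then have "(\<integral>\<^sup>+x. ennreal (?f \<delta> x) \<partial>lborel) \<le> ennreal ((B + 1) * \<delta> powr (g + 2 - real DIM('a)))" if "\<delta> > 0" for \<delta>
    using that by (auto intro!: ennreal_leI mult_right_mono)
  then show thesis using that[of "B + 1"] B by simp
qed

section \<open>Spectral bounds for the wave kernel\<close>

text \<open>For tau different from rho this is -i times the integral over s in [0, t] of exp(-i s
  tau) exp(-i (t - s) rho). At tau = rho division by zero gives 0 instead of the limit.\<close>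

definition phase_quot :: "real \<Rightarrow> real \<Rightarrow> real \<Rightarrow> complex" where
  "phase_quot t \<tau> \<rho> = (iexp (- (t * \<tau>)) - iexp (- (t * \<rho>))) / complex_of_real (\<tau> - \<rho>)"

text \<open>Off the points tau = r and tau = -r, and for r > 0, this is the Fourier transform in s
  of sin((t - s) r) / r on [0, t], the Duhamel kernel of a mode of frequency r.\<close>

definition wave_symbol :: "real \<Rightarrow> real \<Rightarrow> real \<Rightarrow> complex" where
  "wave_symbol t \<tau> r = (phase_quot t \<tau> (- r) - phase_quot t \<tau> r) / complex_of_real (2 * r)"

lemma Fg_eq: "Fg t x \<tau> \<xi> = iexp (- (x \<bullet> \<xi>)) * wave_symbol t \<tau> (norm \<xi>)"
  by (simp add: Fg_def wave_symbol_def phase_quot_def)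

lemma norm_iexp_diff: "norm (iexp a - iexp b) \<le> \<bar>a - b\<bar>" "norm (iexp a - iexp b) \<le> 2"
proof -
  have "iexp a - iexp b = iexp b * (iexp (a - b) - 1)"
    by (simp add: exp_diff right_diff_distrib)
  then have "norm (iexp a - iexp b) = norm (iexp (a - b) - 1)" by (simp only: norm_mult norm_exp_i_times mult_1)
  also have "\<dots> \<le> \<bar>a - b\<bar>" using iexp_approx1[of "a - b" 0] by simp
  finally show "norm (iexp a - iexp b) \<le> \<bar>a - b\<bar>" .
  show "norm (iexp a - iexp b) \<le> 2" using norm_triangle_ineq4[of "iexp a" "iexp b"] by simp
qed

text \<open>Two bounds merged into one kernel: 2 over the distance to \<open>\<rho>\<close>, good
  far away, and \<open>T\<close> from the Lipschitz estimate, good nearby.\<close>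

lemma phase_quot_bound:
  assumes "0 \<le> t" "t \<le> T"
  shows "(norm (phase_quot t \<tau> \<rho>))\<^sup>2 \<le> (4 + T\<^sup>2) * (1 / (1 + (\<tau> - \<rho>)\<^sup>2))"
proof (cases "\<tau> = \<rho>")
  case True
  then show ?thesis by (simp add: phase_quot_def)
next
  case False
  define z where "z = \<tau> - \<rho>"
  have z: "z \<noteq> 0" using False by (simp add: z_def)
  let ?A = "norm (phase_quot t \<tau> \<rho>)"
  have A: "?A * \<bar>z\<bar> = norm (iexp (- (t * \<tau>)) - iexp (- (t * \<rho>)))"
    using z unfolding phase_quot_def norm_divide norm_of_real z_def[symmetric] by simp
  have "?A * \<bar>z\<bar> \<le> 2" unfolding A by (rule norm_iexp_diff)
  then have 1: "(?A * \<bar>z\<bar>)\<^sup>2 \<le> 2\<^sup>2" by (intro power_mono) auto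
  have "?A * \<bar>z\<bar> \<le> \<bar>t * z\<bar>" unfolding A
    using norm_iexp_diff(1)[of "- (t * \<tau>)" "- (t * \<rho>)"] by (simp add: z_def abs_minus_commute algebra_simps)
  then have "?A \<le> T" using z assms by (simp add: abs_mult)
  then have 2: "?A\<^sup>2 \<le> T\<^sup>2" by (intro power_mono) auto
  have "?A\<^sup>2 * (1 + z\<^sup>2) \<le> 4 + T\<^sup>2" using 1 2 by (simp add: power_mult_distrib algebra_simps)
  moreover have "0 < 1 + z\<^sup>2" by (intro add_pos_nonneg) auto
  ultimately show ?thesis by (simp add: z_def[symmetric] field_simps)
qed

text \<open>The terms \<open>iexp (- (t * \<tau>))\<close> of the two quotients cancel, and the
  factor \<open>r\<close> cancels against the denominator \<open>2 * r\<close>. The time derivative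
  is thus bounded like the quotients themselves, with no factor growing in \<open>\<tau>\<close> or
  \<open>r\<close>.\<close>

lemma wave_symbol_has_vector_derivative:
  assumes "r \<noteq> 0" "\<tau> \<noteq> r" "\<tau> \<noteq> - r"
  shows "((\<lambda>t. wave_symbol t \<tau> r) has_vector_derivative
     (\<i> / 2 * (phase_quot t \<tau> (- r) + phase_quot t \<tau> r))) (at t within S)"
proof -
  have q: "((\<lambda>t. phase_quot t \<tau> \<rho>) has_vector_derivative
      - \<i> * (iexp (- (t * \<tau>)) + complex_of_real \<rho> * phase_quot t \<tau> \<rho>)) (at t within S)" if "\<tau> \<noteq> \<rho>" for \<rho>
  proof -
    have e: "((\<lambda>t. iexp (- (t * c))) has_vector_derivative (- \<i> * complex_of_real c * iexp (- (t * c)))) (at t within S)" for c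
    proof -
      have "((\<lambda>z. exp (- \<i> * complex_of_real c * z)) has_field_derivative
          (- \<i> * complex_of_real c * exp (- \<i> * complex_of_real c * complex_of_real t))) (at (complex_of_real t))"
        by (auto intro!: derivative_eq_intros)
      from has_vector_derivative_real_field[OF this, of S] show ?thesis by (simp add: mult_ac)
    qed
    have "((\<lambda>t. phase_quot t \<tau> \<rho>) has_vector_derivative
      (- \<i> * complex_of_real \<tau> * iexp (- (t * \<tau>)) - - \<i> * complex_of_real \<rho> * iexp (- (t * \<rho>))) / complex_of_real (\<tau> - \<rho>)) (at t within S)"
      unfolding phase_quot_def by (intro has_vector_derivative_divide has_vector_derivative_diff e)
    moreover have "(- \<i> * complex_of_real \<tau> * iexp (- (t * \<tau>)) - - \<i> * complex_of_real \<rho> * iexp (- (t * \<rho>))) / complex_of_real (\<tau> - \<rho>)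
      = - \<i> * (iexp (- (t * \<tau>)) + complex_of_real \<rho> * phase_quot t \<tau> \<rho>)"
    proof -
      have "complex_of_real \<tau> - complex_of_real \<rho> \<noteq> 0" using that by simp
      then show ?thesis unfolding phase_quot_def of_real_diff by (simp add: field_simps)
    qed
    ultimately show ?thesis by simp
  qed
  have "((\<lambda>t. wave_symbol t \<tau> r) has_vector_derivative
     (- \<i> * (iexp (- (t * \<tau>)) + complex_of_real (- r) * phase_quot t \<tau> (- r))
      - - \<i> * (iexp (- (t * \<tau>)) + complex_of_real r * phase_quot t \<tau> r)) / complex_of_real (2 * r)) (at t within S)"
    unfolding wave_symbol_def using assms by (intro has_vector_derivative_divide has_vector_derivative_diff q) auto
  moreover have "(- \<i> * (iexp (- (t * \<tau>)) + complex_of_real (- r) * phase_quot t \<tau> (- r))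
      - - \<i> * (iexp (- (t * \<tau>)) + complex_of_real r * phase_quot t \<tau> r)) / complex_of_real (2 * r)
     = \<i> / 2 * (phase_quot t \<tau> (- r) + phase_quot t \<tau> r)"
    using assms(1) by (simp add: field_simps)
  ultimately show ?thesis by (simp only:)
qed

text \<open>The energy of a mode concentrates at \<open>\<tau> = r\<close> and
  \<open>\<tau> = - r\<close>, and this majorant has one Cauchy kernel for each. The form
  \<open>- - r\<close> keeps both summands instances of \<open>phase_quot_bound\<close>.\<close>

definition cauchy_pair :: "real \<Rightarrow> real \<Rightarrow> real \<Rightarrow> real" where
  "cauchy_pair T \<tau> r = (4 + T\<^sup>2) * (1 / (1 + (\<tau> - r)\<^sup>2) + 1 / (1 + (\<tau> - - r)\<^sup>2))"

lemma cauchy_pair_nonneg: "0 \<le> cauchy_pair T \<tau> r"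
  unfolding cauchy_pair_def by (auto intro!: mult_nonneg_nonneg add_nonneg_nonneg)

lemma phase_quot_pair_bound:
  assumes "0 \<le> t" "t \<le> T"
  shows "(norm (phase_quot t \<tau> r))\<^sup>2 + (norm (phase_quot t \<tau> (- r)))\<^sup>2 \<le> cauchy_pair T \<tau> r"
  using phase_quot_bound[OF assms, of \<tau> r] phase_quot_bound[OF assms, of \<tau> "- r"]
  unfolding cauchy_pair_def distrib_left by (rule add_mono)

lemma norm_add_squared_le: "(norm (a + b))\<^sup>2 \<le> 2 * ((norm a)\<^sup>2 + (norm (b::'a::real_normed_vector))\<^sup>2)"
proof -
  have "(norm (a + b))\<^sup>2 \<le> (norm a + norm b)\<^sup>2" by (intro power_mono norm_triangle_ineq) auto
  also have "\<dots> \<le> 2 * ((norm a)\<^sup>2 + (norm b)\<^sup>2)"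
    using zero_le_power2[of "norm a - norm b"] by (simp add: power2_eq_square algebra_simps)
  finally show ?thesis .
qed

lemma norm_diff_squared_le: "(norm (a - b))\<^sup>2 \<le> 2 * ((norm a)\<^sup>2 + (norm (b::'a::real_normed_vector))\<^sup>2)"
  using norm_add_squared_le[of a "- b"] by simp

lemma wave_symbol_bound:
  assumes "0 \<le> t" "t \<le> T" "0 < r"
  shows "(norm (wave_symbol t \<tau> r))\<^sup>2 \<le> cauchy_pair T \<tau> r / (2 * r\<^sup>2)"
proof -
  have "(norm (phase_quot t \<tau> (- r) - phase_quot t \<tau> r))\<^sup>2 \<le> 2 * cauchy_pair T \<tau> r"
    using norm_diff_squared_le[of "phase_quot t \<tau> (- r)" "phase_quot t \<tau> r"]
      phase_quot_pair_bound[OF assms(1,2), of \<tau> r] by simp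
  then show ?thesis using assms(3)
    unfolding wave_symbol_def norm_divide power_divide norm_of_real
    by (simp add: power_mult_distrib field_simps)
qed

text \<open>Short time steps use the mean value bound, long ones the triangle inequality and the
  \<open>1 / r\<close> decay of the symbol. The two points \<open>\<tau> = r\<close> and
  \<open>\<tau> = - r\<close> are excluded because the conventional value of the quotient there
  breaks the derivative formula; they form a null set.\<close>

lemma wave_symbol_diff_bound:
  assumes t: "0 \<le> t" "t \<le> T" and s: "0 \<le> s" "s \<le> T" and r: "0 < r" and ne: "\<tau> \<noteq> r" "\<tau> \<noteq> - r"
  shows "(norm (wave_symbol t \<tau> r - wave_symbol s \<tau> r))\<^sup>2 \<le> 2 * cauchy_pair T \<tau> r * (min \<bar>t - s\<bar> (1 / r))\<^sup>2"
proof -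
  let ?K = "cauchy_pair T \<tau> r"
  let ?D = "norm (wave_symbol t \<tau> r - wave_symbol s \<tau> r)"
  have "?D \<le> sqrt (?K / 2) * norm (t - s)"
  proof (rule differentiable_bound[where S="{0..T}" and f="\<lambda>t. wave_symbol t \<tau> r"
        and f'="\<lambda>t h. h *\<^sub>R (\<i> / 2 * (phase_quot t \<tau> (- r) + phase_quot t \<tau> r))"])
    fix u assume u: "u \<in> {0..T}"
    then have u': "0 \<le> u" "u \<le> T" by auto
    show "((\<lambda>t. wave_symbol t \<tau> r) has_derivative (\<lambda>h. h *\<^sub>R (\<i> / 2 * (phase_quot u \<tau> (- r) + phase_quot u \<tau> r)))) (at u within {0..T})"
      using wave_symbol_has_vector_derivative[of r \<tau> u "{0..T}"] r ne by (simp add: has_vector_derivative_def)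
    have "(norm (\<i> / 2 * (phase_quot u \<tau> (- r) + phase_quot u \<tau> r)))\<^sup>2
       = (norm (phase_quot u \<tau> (- r) + phase_quot u \<tau> r))\<^sup>2 / 4"
      by (simp add: norm_mult norm_divide power_mult_distrib power_divide)
    also have "\<dots> \<le> ?K / 2"
      using norm_add_squared_le[of "phase_quot u \<tau> (- r)" "phase_quot u \<tau> r"]
        phase_quot_pair_bound[OF u', of \<tau> r] by simp
    finally have "norm (\<i> / 2 * (phase_quot u \<tau> (- r) + phase_quot u \<tau> r)) \<le> sqrt (?K / 2)"
      by (rule real_le_rsqrt)
    moreover have "onorm (\<lambda>h. h *\<^sub>R z) \<le> norm z" for z :: complex
      by (rule onorm_le) (simp add: mult.commute)
    ultimately show "onorm (\<lambda>h. h *\<^sub>R (\<i> / 2 * (phase_quot u \<tau> (- r) + phase_quot u \<tau> r))) \<le> sqrt (?K / 2)"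
      using order_trans by blast
  qed (use t s in auto)
  then have "?D\<^sup>2 \<le> (sqrt (?K / 2) * \<bar>t - s\<bar>)\<^sup>2" by (intro power_mono) auto
  then have 1: "?D\<^sup>2 \<le> 2 * ?K * \<bar>t - s\<bar>\<^sup>2"
  proof -
    have "(sqrt (?K / 2) * \<bar>t - s\<bar>)\<^sup>2 = (?K * (t - s)\<^sup>2) / 2"
      by (simp add: power_mult_distrib real_sqrt_pow2 cauchy_pair_nonneg)
    moreover have "0 \<le> ?K * (t - s)\<^sup>2" by (intro mult_nonneg_nonneg cauchy_pair_nonneg) auto
    moreover have "2 * ?K * \<bar>t - s\<bar>\<^sup>2 = 2 * (?K * (t - s)\<^sup>2)" by simp
    ultimately show ?thesis using \<open>?D\<^sup>2 \<le> (sqrt (?K / 2) * \<bar>t - s\<bar>)\<^sup>2\<close> by linarith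
  qed
  have 2: "?D\<^sup>2 \<le> 2 * ?K * (1 / r)\<^sup>2"
    using norm_diff_squared_le[of "wave_symbol t \<tau> r" "wave_symbol s \<tau> r"]
      wave_symbol_bound[OF t r, of \<tau>] wave_symbol_bound[OF s r, of \<tau>]
    by (simp add: power_divide)
  show ?thesis using 1 2 by (cases "\<bar>t - s\<bar> \<le> 1 / r") (auto simp: min_def)
qed

text \<open>Time is moved at the fixed point \<open>x\<close>, then space at the fixed time
  \<open>s\<close>. The two squares contribute 2 and 1/2 times the pair kernel, and squaring a sum
  doubles them, whence 5. The cut-off \<open>2 / norm \<xi>\<close> accommodates the trivial bound 2
  for a difference of phases.\<close>

lemma Fg_diff_bound:
  fixes x y \<xi> :: "real^'n"
  assumes t: "0 \<le> t" "t \<le> T" and s: "0 \<le> s" "s \<le> T" and \<xi>: "\<xi> \<noteq> 0" and ne: "\<tau> \<noteq> norm \<xi>" "\<tau> \<noteq> - norm \<xi>"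
  shows "(norm (Fg t x \<tau> \<xi> - Fg s y \<tau> \<xi>))\<^sup>2
     \<le> 5 * cauchy_pair T \<tau> (norm \<xi>) * (min (pdist t x s y) (2 / norm \<xi>))\<^sup>2"
proof -
  let ?r = "norm \<xi>" and ?K = "cauchy_pair T \<tau> (norm \<xi>)" and ?d = "pdist t x s y"
  have r: "0 < ?r" using \<xi> by simp
  have K: "0 \<le> ?K" by (rule cauchy_pair_nonneg)
  have d: "\<bar>t - s\<bar> \<le> ?d" "norm (x - y) \<le> ?d" by (auto simp: pdist_def)
  let ?a = "iexp (- (x \<bullet> \<xi>)) * (wave_symbol t \<tau> ?r - wave_symbol s \<tau> ?r)"
  let ?b = "(iexp (- (x \<bullet> \<xi>)) - iexp (- (y \<bullet> \<xi>))) * wave_symbol s \<tau> ?r"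
  have "Fg t x \<tau> \<xi> - Fg s y \<tau> \<xi> = ?a + ?b" by (simp add: Fg_eq algebra_simps)
  then have "(norm (Fg t x \<tau> \<xi> - Fg s y \<tau> \<xi>))\<^sup>2 \<le> 2 * ((norm ?a)\<^sup>2 + (norm ?b)\<^sup>2)"
    by (simp only: norm_add_squared_le)
  moreover have "(norm ?a)\<^sup>2 \<le> 2 * ?K * (min ?d (2 / ?r))\<^sup>2"
  proof -
    have "(norm ?a)\<^sup>2 = (norm (wave_symbol t \<tau> ?r - wave_symbol s \<tau> ?r))\<^sup>2"
      by (simp only: norm_mult norm_exp_i_times mult_1)
    also have "\<dots> \<le> 2 * ?K * (min \<bar>t - s\<bar> (1 / ?r))\<^sup>2" by (rule wave_symbol_diff_bound[OF t s r ne])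
    also have "\<dots> \<le> 2 * ?K * (min ?d (2 / ?r))\<^sup>2"
      using d K r by (intro mult_left_mono power_mono min.mono divide_right_mono) auto
    finally show ?thesis .
  qed
  moreover have "(norm ?b)\<^sup>2 \<le> ?K / 2 * (min ?d (2 / ?r))\<^sup>2"
  proof -
    let ?e = "norm (iexp (- (x \<bullet> \<xi>)) - iexp (- (y \<bullet> \<xi>)))"
    have "?e \<le> \<bar>(x - y) \<bullet> \<xi>\<bar>"
      using norm_iexp_diff(1)[of "- (x \<bullet> \<xi>)" "- (y \<bullet> \<xi>)"] by (simp add: inner_diff_left abs_minus_commute)
    also have "\<dots> \<le> norm (x - y) * ?r" by (rule Cauchy_Schwarz_ineq2)
    also have "\<dots> \<le> ?d * ?r" using d by (intro mult_right_mono) auto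
    finally have "?e \<le> ?d * ?r" .
    moreover have "?e \<le> 2" by (rule norm_iexp_diff)
    ultimately have "?e / ?r \<le> min ?d (2 / ?r)" using r by (simp add: field_simps)
    then have "(?e / ?r)\<^sup>2 \<le> (min ?d (2 / ?r))\<^sup>2" by (intro power_mono) auto
    then have "?K / 2 * (?e / ?r)\<^sup>2 \<le> ?K / 2 * (min ?d (2 / ?r))\<^sup>2" using K by (intro mult_left_mono) auto
    moreover have "(norm ?b)\<^sup>2 \<le> ?e\<^sup>2 * (?K / (2 * ?r\<^sup>2))"
      unfolding norm_mult power_mult_distrib by (intro mult_left_mono wave_symbol_bound s r) auto
    moreover have "?e\<^sup>2 * (?K / (2 * ?r\<^sup>2)) = ?K / 2 * (?e / ?r)\<^sup>2" by (simp add: power_divide)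
    ultimately show ?thesis by linarith
  qed
  ultimately show ?thesis by (simp add: algebra_simps)
qed

lemma Fg_measurable[measurable]:
  "(\<lambda>p. Fg t (x::real^'n) (fst p) (snd p)) \<in> borel_measurable (borel \<Otimes>\<^sub>M borel)"
  unfolding Fg_def by measurable

lemma Fg_0: "Fg 0 x \<tau> \<xi> = 0"
  by (simp add: Fg_def)

abbreviation spaced_diff :: "('v::real_vector \<Rightarrow> 'b::minus) \<Rightarrow> 'v \<Rightarrow> 'v \<Rightarrow> real \<Rightarrow> nat \<Rightarrow> 'b" where
  "spaced_diff f x0 e \<delta> k \<equiv> f (x0 + (4 * real k * \<delta> + \<delta>) *\<^sub>R e) - f (x0 + (4 * real k * \<delta>) *\<^sub>R e)"

locale spectral =
  fixes H \<beta> c1 c2 \<alpha> :: real and h :: "real^'n \<Rightarrow> real"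
  assumes H: "1/2 \<le> H" "H < 1" and \<beta>: "0 < \<beta>" "\<beta> < real CARD('n)"
    and \<beta>H: "real CARD('n) - 2*H - 1 < \<beta>" "\<beta> < real CARD('n) - 2*H + 1"
    and h_meas[measurable]: "h \<in> borel_measurable borel"
    and c: "0 < c1" "c1 \<le> c2"
    and h_bounds: "\<And>\<xi>. \<xi> \<noteq> 0 \<Longrightarrow> c1 * norm \<xi> powr (-\<beta>) \<le> h \<xi> \<and> h \<xi> \<le> c2 * norm \<xi> powr (-\<beta>)"
    and h_nonneg: "\<And>\<xi>. 0 \<le> h \<xi>"
    and alpha_eq: "\<alpha> = (2*H + 1 - real CARD('n) + \<beta>) / 2"
begin

abbreviation wt :: "real \<Rightarrow> real^'n \<Rightarrow> real" where
  "wt \<tau> \<xi> \<equiv> \<bar>\<tau>\<bar> powr (1 - 2 * H) * h \<xi>"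

abbreviation energy :: "(real \<Rightarrow> real^'n \<Rightarrow> complex) \<Rightarrow> ennreal" where
  "energy \<phi> \<equiv> (\<integral>\<^sup>+p. ennreal ((norm (\<phi> (fst p) (snd p)))\<^sup>2 * wt (fst p) (snd p)) \<partial>lborel)"

text \<open>Integration over \<open>\<tau>\<close> comes first: the kernels are centred at distance
  \<open>norm \<xi>\<close> from 0, so the weight in \<open>\<tau>\<close> turns into a multiple of
  \<open>norm \<xi> powr (1 - 2 * H)\<close>. What remains is a truncated power integral with
  exponent \<open>2 * H - 1 + \<beta>\<close>.\<close>

lemma energy_Fg_diff:
  assumes T: "0 < T"
  obtains K where "K > 0"
    "\<And>t x s y. 0 \<le> t \<Longrightarrow> t \<le> T \<Longrightarrow> 0 \<le> s \<Longrightarrow> s \<le> T \<Longrightarrow>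
      energy (\<lambda>\<tau> \<xi>. Fg t x \<tau> \<xi> - Fg s y \<tau> \<xi>)
        \<le> ennreal (K * pdist t x s y powr (2 * \<alpha>))"
proof -
  let ?a = "2 * H - 1"
  obtain C where C: "C > 0" "\<And>\<rho>. \<rho> \<noteq> 0 \<Longrightarrow> (\<integral>\<^sup>+\<tau>. ennreal (1 / (1 + (\<tau> - \<rho>)\<^sup>2) * \<bar>\<tau>\<bar> powr (- ?a)) \<partial>lborel) \<le> ennreal (C * \<bar>\<rho>\<bar> powr (- ?a))"
    using cauchy_kernel_powr_bound[of ?a] H by auto
  obtain B where B: "B > 0" "\<And>\<delta>. \<delta> > 0 \<Longrightarrow> (\<integral>\<^sup>+(x::real^'n). ennreal ((min \<delta> (2 / norm x))\<^sup>2 * norm x powr (- (?a + \<beta>))) \<partial>lborel)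
        \<le> ennreal (B * \<delta> powr (?a + \<beta> + 2 - real DIM(real^'n)))"
    using truncated_power_integral_bound[where 'a="real^'n", of "?a + \<beta>"] H \<beta> \<beta>H by auto
  define D where "D = 5 * (4 + T\<^sup>2) * (2 * C) * c2"
  have Dpos: "D > 0" unfolding D_def using C c by (auto intro!: mult_pos_pos add_pos_nonneg)
  have inner: "(\<integral>\<^sup>+\<tau>. ennreal (cauchy_pair T \<tau> r * \<bar>\<tau>\<bar> powr (- ?a)) \<partial>lborel) \<le> ennreal ((4 + T\<^sup>2) * (2 * C) * r powr (- ?a))" if r: "r > 0" for r
  proof -
    let ?f = "\<lambda>\<rho> \<tau>. 1 / (1 + (\<tau> - \<rho>)\<^sup>2) * \<bar>\<tau>\<bar> powr (- ?a)"
    have "(\<integral>\<^sup>+\<tau>. ennreal (cauchy_pair T \<tau> r * \<bar>\<tau>\<bar> powr (- ?a)) \<partial>lborel)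
       = (\<integral>\<^sup>+\<tau>. ennreal (4 + T\<^sup>2) * ennreal (?f r \<tau>) + ennreal (4 + T\<^sup>2) * ennreal (?f (- r) \<tau>) \<partial>lborel)"
      unfolding cauchy_pair_def
      by (intro nn_integral_cong) (simp add: ennreal_mult'[symmetric] ennreal_plus[symmetric] algebra_simps del: ennreal_plus)
    also have "\<dots> = ennreal (4 + T\<^sup>2) * (\<integral>\<^sup>+\<tau>. ennreal (?f r \<tau>) \<partial>lborel) + ennreal (4 + T\<^sup>2) * (\<integral>\<^sup>+\<tau>. ennreal (?f (- r) \<tau>) \<partial>lborel)"
      by (rule nn_integral_lincomb) measurable
    also have "\<dots> \<le> ennreal (4 + T\<^sup>2) * ennreal (C * r powr (- ?a)) + ennreal (4 + T\<^sup>2) * ennreal (C * r powr (- ?a))"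
      using C(2)[of r] C(2)[of "- r"] r by (intro add_mono mult_left_mono) auto
    also have "\<dots> = ennreal ((4 + T\<^sup>2) * (2 * C) * r powr (- ?a))"
      using C(1) by (simp add: ennreal_mult'[symmetric] ennreal_plus[symmetric] algebra_simps del: ennreal_plus)
    finally show ?thesis .
  qed
  have main: "energy (\<lambda>\<tau> \<xi>. Fg t x \<tau> \<xi> - Fg s y \<tau> \<xi>)
        \<le> ennreal (D * B * pdist t x s y powr (2 * \<alpha>))"
    if ts: "0 \<le> t" "t \<le> T" "0 \<le> s" "s \<le> T" for t s and x y :: "real^'n"
  proof (cases "pdist t x s y = 0")
    case True
    then have "t = s \<and> x = y" unfolding pdist_def
      by (smt (verit) norm_ge_zero norm_eq_zero right_minus_eq)
    then show ?thesis by simp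
  next
    case False
    let ?d = "pdist t x s y"
    have d: "?d > 0" using False by (simp add: pdist_def add_nonneg_nonneg less_le)
    let ?F = "\<lambda>\<tau> \<xi>. ennreal ((norm (Fg t x \<tau> \<xi> - Fg s y \<tau> \<xi>))\<^sup>2 * wt \<tau> \<xi>)"
    have "(\<lambda>p. ?F (fst p) (snd p)) \<in> borel_measurable (borel \<Otimes>\<^sub>M borel)"
      by measurable
    then have [measurable]: "(\<lambda>p. ?F (fst p) (snd p)) \<in> borel_measurable (borel :: (real \<times> (real^'n)) measure)"
      unfolding borel_prod .
    have "(\<integral>\<^sup>+p. ?F (fst p) (snd p) \<partial>lborel) = (\<integral>\<^sup>+p. ?F (fst p) (snd p) \<partial>(lborel \<Otimes>\<^sub>M lborel))"
      by (simp add: lborel_prod)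
    also have "\<dots> = (\<integral>\<^sup>+\<xi>. \<integral>\<^sup>+\<tau>. ?F \<tau> \<xi> \<partial>lborel \<partial>lborel)"
      by (subst lborel_pair.nn_integral_snd[symmetric]) (simp_all add: lborel_prod)
    also have "\<dots> \<le> (\<integral>\<^sup>+(\<xi>::real^'n). ennreal D * ennreal ((min ?d (2 / norm \<xi>))\<^sup>2 * norm \<xi> powr (- (?a + \<beta>))) \<partial>lborel)"
    proof (rule nn_integral_mono_AE)
      show "AE \<xi> in lborel. (\<integral>\<^sup>+\<tau>. ?F \<tau> \<xi> \<partial>lborel) \<le> ennreal D * ennreal ((min ?d (2 / norm \<xi>))\<^sup>2 * norm \<xi> powr (- (?a + \<beta>)))"
        using AE_lborel_singleton[of "0::real^'n"]
      proof eventually_elim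
        case (elim \<xi>)
        let ?r = "norm \<xi>" and ?m = "(min ?d (2 / norm \<xi>))\<^sup>2"
        have r: "?r > 0" using elim by simp
        have "(\<integral>\<^sup>+\<tau>. ?F \<tau> \<xi> \<partial>lborel) \<le> (\<integral>\<^sup>+\<tau>. ennreal (5 * ?m * (c2 * ?r powr (- \<beta>))) * ennreal (cauchy_pair T \<tau> ?r * \<bar>\<tau>\<bar> powr (- ?a)) \<partial>lborel)"
        proof (rule nn_integral_mono_AE)
          show "AE \<tau> in lborel. ?F \<tau> \<xi> \<le> ennreal (5 * ?m * (c2 * ?r powr (- \<beta>))) * ennreal (cauchy_pair T \<tau> ?r * \<bar>\<tau>\<bar> powr (- ?a))"
            using AE_lborel_singleton[of "?r"] AE_lborel_singleton[of "- ?r"]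
          proof eventually_elim
            case (elim \<tau>)
            have "(norm (Fg t x \<tau> \<xi> - Fg s y \<tau> \<xi>))\<^sup>2 * wt \<tau> \<xi>
              \<le> (5 * cauchy_pair T \<tau> ?r * ?m) * (\<bar>\<tau>\<bar> powr (1 - 2 * H) * (c2 * ?r powr (- \<beta>)))"
              using h_bounds[of \<xi>] h_nonneg cauchy_pair_nonneg[of T \<tau> ?r] \<open>\<xi> \<noteq> 0\<close> elim ts
              by (intro mult_mono Fg_diff_bound mult_left_mono) auto
            also have "\<dots> = (5 * ?m * (c2 * ?r powr (- \<beta>))) * (cauchy_pair T \<tau> ?r * \<bar>\<tau>\<bar> powr (- ?a))"
              by simp
            finally show ?case
              using c by (subst ennreal_mult'[symmetric]) (auto intro!: ennreal_leI)
          qed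
        qed
        also have "\<dots> = ennreal (5 * ?m * (c2 * ?r powr (- \<beta>))) * (\<integral>\<^sup>+\<tau>. ennreal (cauchy_pair T \<tau> ?r * \<bar>\<tau>\<bar> powr (- ?a)) \<partial>lborel)"
          unfolding cauchy_pair_def by (rule nn_integral_cmult) measurable
        also have "\<dots> \<le> ennreal (5 * ?m * (c2 * ?r powr (- \<beta>))) * ennreal ((4 + T\<^sup>2) * (2 * C) * ?r powr (- ?a))"
          by (intro mult_left_mono inner r) auto
        also have "\<dots> = ennreal (D * (?m * ?r powr (- (?a + \<beta>))))"
        proof -
          have "?r powr (- (?a + \<beta>)) = ?r powr (- \<beta>) * ?r powr (- ?a)" by (simp add: powr_add[symmetric])
          then have "(5 * ?m * (c2 * ?r powr (- \<beta>))) * ((4 + T\<^sup>2) * (2 * C) * ?r powr (- ?a)) = D * (?m * ?r powr (- (?a + \<beta>)))"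
            unfolding D_def by (simp only: mult_ac)
          then show ?thesis using c by (simp only: ennreal_mult'[symmetric] mult_nonneg_nonneg powr_ge_zero
                zero_le_power2 zero_le_numeral order_trans[OF less_imp_le, of 0 c1 c2])
        qed
        also have "\<dots> = ennreal D * ennreal (?m * ?r powr (- (?a + \<beta>)))"
          using Dpos by (subst ennreal_mult') auto
        finally show ?case .
      qed
    qed
    also have "\<dots> = ennreal D * (\<integral>\<^sup>+(\<xi>::real^'n). ennreal ((min ?d (2 / norm \<xi>))\<^sup>2 * norm \<xi> powr (- (?a + \<beta>))) \<partial>lborel)"
      by (rule nn_integral_cmult) measurable
    also have "\<dots> \<le> ennreal D * ennreal (B * ?d powr (?a + \<beta> + 2 - real DIM(real^'n)))"
      by (intro mult_left_mono B(2) d) auto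
    also have "\<dots> = ennreal (D * B * ?d powr (2 * \<alpha>))"
    proof -
      have "?a + \<beta> + 2 - real DIM(real^'n) = 2 * \<alpha>" by (simp add: alpha_eq field_simps)
      then show ?thesis using Dpos by (subst ennreal_mult'[symmetric]) (auto simp: mult.assoc)
    qed
    finally show ?thesis .
  qed
  show thesis by (rule that[of "D * B", OF _ main]) (use Dpos B in auto)
qed

end

section \<open>Trigonometric sums on a frequency box\<close>

lemma norm_trig_sum_squared:
  fixes b :: "nat \<Rightarrow> real" and \<theta> :: "nat \<Rightarrow> real"
  shows "(norm (\<Sum>k\<in>F. complex_of_real (b k) * iexp (\<theta> k)))\<^sup>2 = (\<Sum>k\<in>F. \<Sum>l\<in>F. b k * b l * cos (\<theta> k - \<theta> l))"
proof -
  have e: "iexp x = complex_of_real (cos x) + \<i> * complex_of_real (sin x)" for x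
    by (simp add: exp_Euler cos_of_real sin_of_real)
  have "Re (\<Sum>k\<in>F. complex_of_real (b k) * iexp (\<theta> k)) = (\<Sum>k\<in>F. b k * cos (\<theta> k))"
    "Im (\<Sum>k\<in>F. complex_of_real (b k) * iexp (\<theta> k)) = (\<Sum>k\<in>F. b k * sin (\<theta> k))"
    unfolding e by simp_all
  then have "(norm (\<Sum>k\<in>F. complex_of_real (b k) * iexp (\<theta> k)))\<^sup>2
     = (\<Sum>k\<in>F. b k * cos (\<theta> k)) * (\<Sum>k\<in>F. b k * cos (\<theta> k)) + (\<Sum>k\<in>F. b k * sin (\<theta> k)) * (\<Sum>k\<in>F. b k * sin (\<theta> k))"
    unfolding cmod_power2 by (simp only: power2_eq_square)
  also have "\<dots> = (\<Sum>k\<in>F. \<Sum>l\<in>F. b k * b l * cos (\<theta> k - \<theta> l))"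
    by (simp add: sum_product sum.distrib[symmetric] cos_diff algebra_simps)
  finally show ?thesis .
qed

text \<open>The window has length \<open>\<pi> / 2\<close>, a full period of the exponentials of frequency \<open>4 k\<close>.\<close>
lemma nn_integral_trig_sum:
  fixes b :: "nat \<Rightarrow> real"
  assumes F: "finite F" and d: "0 < \<delta>"
  shows "(\<integral>\<^sup>+(s::real). ennreal ((norm (\<Sum>k\<in>F. complex_of_real (b k) * iexp (- (4 * real k * \<delta> * s))))\<^sup>2
      * indicator {3 * pi / (4 * \<delta>)..5 * pi / (4 * \<delta>)} s) \<partial>lborel)
    = ennreal (pi / (2 * \<delta>) * (\<Sum>k\<in>F. (b k)\<^sup>2))"
proof -
  let ?A = "3 * pi / (4 * \<delta>)" and ?B = "5 * pi / (4 * \<delta>)"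
  define f where "f s = (norm (\<Sum>k\<in>F. complex_of_real (b k) * iexp (- (4 * real k * \<delta> * s))))\<^sup>2" for s
  define m where "m k l = 4 * (real l - real k) * \<delta>" for k l :: nat
  define \<Phi> where "\<Phi> s = (\<Sum>k\<in>F. \<Sum>l\<in>F. b k * b l * (if k = l then s else sin (m k l * s) / m k l))" for s
  have m0: "k \<noteq> l \<Longrightarrow> m k l \<noteq> 0" for k l using d by (simp add: m_def)
  have f: "f s = (\<Sum>k\<in>F. \<Sum>l\<in>F. b k * b l * cos (m k l * s))" for s
    unfolding f_def norm_trig_sum_squared m_def by (intro sum.cong refl) (simp add: algebra_simps)
  have der: "DERIV \<Phi> s :> f s" for s
    unfolding \<Phi>_def f
  proof (intro DERIV_sum DERIV_cmult)
    fix k l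
    show "((\<lambda>s. if k = l then s else sin (m k l * s) / m k l) has_real_derivative cos (m k l * s)) (at s)"
      using m0[of k l] by (cases "k = l") (auto intro!: derivative_eq_intros simp: m_def)
  qed
  have "(\<integral>\<^sup>+s. ennreal (f s) * indicator {?A..?B} s \<partial>lborel) = ennreal (\<Phi> ?B - \<Phi> ?A)"
  proof (rule nn_integral_FTC_Icc)
    show "f \<in> borel_measurable borel" unfolding f_def by measurable
    show "?A \<le> ?B" using d by (auto intro!: divide_right_mono)
    show "DERIV \<Phi> s :> f s" for s by (rule der)
    show "0 \<le> f s" for s by (simp add: f_def)
  qed
  also have "\<Phi> ?B - \<Phi> ?A = (\<Sum>k\<in>F. \<Sum>l\<in>F. if k = l then (b k)\<^sup>2 * (pi / (2 * \<delta>)) else 0)"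
    unfolding \<Phi>_def sum_subtractf[symmetric]
  proof (intro sum.cong refl)
    fix k l
    \<comment> \<open>Both window ends are integer multiples of \<open>pi / (4 * \<delta>)\<close>,
      and \<open>m k l\<close> is \<open>4 * \<delta>\<close> times an integer, so every
      off-diagonal antiderivative vanishes at both ends.\<close>
    have s: "sin (m k l * (real j * pi / (4 * \<delta>))) = 0" for j
    proof -
      have "m k l * (real j * pi / (4 * \<delta>)) = of_int ((int l - int k) * int j) * pi"
        using d by (simp add: m_def field_simps)
      then show ?thesis by (metis sin_zero_iff_int2)
    qed
    show "b k * b l * (if k = l then ?B else sin (m k l * ?B) / m k l) - b k * b l * (if k = l then ?A else sin (m k l * ?A) / m k l)
       = (if k = l then (b k)\<^sup>2 * (pi / (2 * \<delta>)) else 0)"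
      using s[of 3] s[of 5] d by (simp add: power2_eq_square field_simps)
  qed
  also have "\<dots> = pi / (2 * \<delta>) * (\<Sum>k\<in>F. (b k)\<^sup>2)"
    using F by (simp add: sum_distrib_left mult.commute)
  finally have "(\<integral>\<^sup>+s. ennreal (f s) * indicator {?A..?B} s \<partial>lborel) = ennreal (pi / (2 * \<delta>) * (\<Sum>k\<in>F. (b k)\<^sup>2))" .
  moreover have "ennreal (f s) * indicator {?A..?B} s = ennreal (f s * indicator {?A..?B} s)" for s
    by (auto simp: indicator_def)
  ultimately show ?thesis by (simp add: f_def)
qed

text \<open>Along \<open>e\<close> the window is centred at \<open>pi / \<delta>\<close>, where
  \<open>iexp (- (\<delta> * s)) - 1\<close> is largest in norm. The extent
  \<open>1 / \<delta>\<close> in the other directions makes the volume as large as possible in order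
  while all frequencies keep the size \<open>1 / \<delta>\<close>.\<close>

definition freq_box :: "'a::euclidean_space \<Rightarrow> real \<Rightarrow> 'a set" where
  "freq_box e \<delta> = {\<xi>. \<xi> \<bullet> e \<in> {3 * pi / (4 * \<delta>)..5 * pi / (4 * \<delta>)} \<and> (\<forall>b\<in>Basis - {e}. \<xi> \<bullet> b \<in> {0..1 / \<delta>})}"

text \<open>The sum depends on one coordinate only, so the integral factors, and each remaining
  coordinate contributes \<open>1 / \<delta>\<close>.\<close>

lemma nn_integral_trig_sum_box:
  fixes b :: "nat \<Rightarrow> real" and e :: "'a::euclidean_space"
  assumes F: "finite F" and d: "0 < \<delta>" and e: "e \<in> Basis"
  shows "(\<integral>\<^sup>+\<xi>. ennreal ((norm (\<Sum>k\<in>F. complex_of_real (b k) * iexp (- (4 * real k * \<delta> * (\<xi> \<bullet> e)))))\<^sup>2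
      * indicator (freq_box e \<delta>) \<xi>) \<partial>lborel)
    = ennreal (pi / 2 * (\<Sum>k\<in>F. (b k)\<^sup>2) * (1 / \<delta>) ^ DIM('a))"
proof -
  define g where "g s = (norm (\<Sum>k\<in>F. complex_of_real (b k) * iexp (- (4 * real k * \<delta> * s))))\<^sup>2
      * indicator {3 * pi / (4 * \<delta>)..5 * pi / (4 * \<delta>)} s" for s
  have [measurable]: "g \<in> borel_measurable borel" unfolding g_def by measurable
  define G where "G c = (if c = e then g else indicator {0..1 / \<delta>})" for c
  have prod: "(\<Prod>c\<in>Basis. G c (\<xi> \<bullet> c)) = (norm (\<Sum>k\<in>F. complex_of_real (b k) * iexp (- (4 * real k * \<delta> * (\<xi> \<bullet> e)))))\<^sup>2
      * indicator (freq_box e \<delta>) \<xi>" for \<xi>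
  proof -
    have "(\<Prod>c\<in>Basis. G c (\<xi> \<bullet> c)) = g (\<xi> \<bullet> e) * (\<Prod>c\<in>Basis - {e}. G c (\<xi> \<bullet> c))"
      using e by (subst prod.remove[of _ e]) (auto simp: G_def)
    also have "(\<Prod>c\<in>Basis - {e}. G c (\<xi> \<bullet> c)) = (\<Prod>c\<in>Basis - {e}. indicator {0..1 / \<delta>} (\<xi> \<bullet> c))"
      by (intro prod.cong) (auto simp: G_def)
    also have "\<dots> = (if \<forall>c\<in>Basis - {e}. \<xi> \<bullet> c \<in> {0..1 / \<delta>} then 1 else 0)"
      by (auto simp: indicator_def prod_eq_1_iff)
    finally show ?thesis by (auto simp: g_def freq_box_def indicator_def)
  qed
  have "(\<integral>\<^sup>+\<xi>. ennreal (\<Prod>c\<in>Basis. G c (\<xi> \<bullet> c)) \<partial>lborel) = (\<integral>\<^sup>+\<xi>. (\<Prod>c\<in>Basis. ennreal (G c (\<xi> \<bullet> c))) \<partial>(lborel :: 'a measure))"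
    by (intro nn_integral_cong) (auto intro!: prod_ennreal[symmetric] simp: G_def g_def)
  also have "\<dots> = (\<Prod>c\<in>(Basis :: 'a set). (\<integral>\<^sup>+s. ennreal (G c s) \<partial>lborel))"
    by (rule nn_integral_lborel_prod) (auto simp: G_def g_def)
  also have "\<dots> = (\<integral>\<^sup>+s. ennreal (g s) \<partial>lborel) * (\<Prod>c\<in>Basis - {e}. (\<integral>\<^sup>+s. ennreal (G c s) \<partial>lborel))"
    using e by (subst prod.remove[of _ e]) (auto simp: G_def)
  also have "(\<Prod>c\<in>Basis - {e}. (\<integral>\<^sup>+s. ennreal (G c s) \<partial>lborel)) = (\<Prod>c\<in>Basis - {e}. ennreal (1 / \<delta>))"
    using d by (intro prod.cong) (auto simp: G_def ennreal_indicator)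
  also have "(\<integral>\<^sup>+s. ennreal (g s) \<partial>lborel) * \<dots> = ennreal (pi / (2 * \<delta>) * (\<Sum>k\<in>F. (b k)\<^sup>2) * (1 / \<delta>) ^ (DIM('a) - 1))"
    unfolding g_def nn_integral_trig_sum[OF F d] using d e
    by (simp add: ennreal_power ennreal_mult'[symmetric] card_Diff_singleton sum_nonneg del: power_one_over)
  also have "pi / (2 * \<delta>) * (\<Sum>k\<in>F. (b k)\<^sup>2) * (1 / \<delta>) ^ (DIM('a) - 1) = pi / 2 * (\<Sum>k\<in>F. (b k)\<^sup>2) * (1 / \<delta>) ^ DIM('a)"
  proof -
    have "(1 / \<delta>) ^ DIM('a) = (1 / \<delta>) * (1 / \<delta>) ^ (DIM('a) - 1)"
      using DIM_positive[where 'a='a] by (metis power_minus_mult mult.commute)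
    then show ?thesis by simp
  qed
  finally show ?thesis unfolding prod .
qed

lemma freq_box_norm:
  fixes e :: "'a::euclidean_space"
  assumes d: "0 < \<delta>" and e: "e \<in> Basis" and \<xi>: "\<xi> \<in> freq_box e \<delta>"
  shows "3 * pi / (4 * \<delta>) \<le> norm \<xi>" "norm \<xi> \<le> (4 + real DIM('a)) / \<delta>"
proof -
  show "3 * pi / (4 * \<delta>) \<le> norm \<xi>"
    using Basis_le_norm[OF e, of \<xi>] \<xi> by (auto simp: freq_box_def)
  have "norm \<xi> \<le> (\<Sum>c\<in>Basis. \<bar>\<xi> \<bullet> c\<bar>)" by (rule norm_le_l1)
  also have "\<dots> = \<bar>\<xi> \<bullet> e\<bar> + (\<Sum>c\<in>Basis - {e}. \<bar>\<xi> \<bullet> c\<bar>)" using e by (subst sum.remove[of _ e]) auto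
  also have "\<dots> \<le> 5 * pi / (4 * \<delta>) + (\<Sum>c\<in>Basis - {e}. 1 / \<delta>)"
  proof (intro add_mono sum_mono)
    have "0 \<le> 3 * pi / (4 * \<delta>)" using d by simp
    then show "\<bar>\<xi> \<bullet> e\<bar> \<le> 5 * pi / (4 * \<delta>)" using \<xi> by (auto simp: freq_box_def)
    show "\<bar>\<xi> \<bullet> c\<bar> \<le> 1 / \<delta>" if "c \<in> Basis - {e}" for c using \<xi> that by (auto simp: freq_box_def)
  qed
  also have "\<dots> = (5 * pi / 4 + (real DIM('a) - 1)) / \<delta>"
    using e d DIM_positive[where 'a='a] by (simp add: card_Diff_singleton of_nat_diff field_simps)
  also have "\<dots> \<le> (4 + real DIM('a)) / \<delta>"
    using pi_less_4 d by (intro divide_right_mono) auto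
  finally show "norm \<xi> \<le> (4 + real DIM('a)) / \<delta>" .
qed

text \<open>The squared norm is \<open>2 - 2 * cos x\<close>, and the cosine is not positive on this
  interval around \<open>pi\<close>.\<close>

lemma norm_iexp_minus_1_lower:
  assumes "3 * pi / 4 \<le> x" "x \<le> 5 * pi / 4"
  shows "2 \<le> (norm (iexp (- x) - 1))\<^sup>2"
proof -
  have "cos (x - pi) \<ge> 0" using assms by (intro cos_ge_zero) auto
  then have "cos x \<le> 0" by (simp add: cos_diff)
  have "iexp (- x) = complex_of_real (cos x) - \<i> * complex_of_real (sin x)"
    by (simp add: exp_minus_Euler cos_of_real sin_of_real)
  then have "(norm (iexp (- x) - 1))\<^sup>2 = (cos x - 1)\<^sup>2 + (sin x)\<^sup>2"
    by (simp add: cmod_power2)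
  also have "\<dots> = 2 - 2 * cos x" using sin_cos_squared_add[of x] by (simp add: power2_eq_square algebra_simps)
  finally show ?thesis using \<open>cos x \<le> 0\<close> by simp
qed

text \<open>For a phase of size at most 1 the quadratic remainder of the exponential is at most half
  of the linear term.\<close>

lemma phase_quot_lower:
  assumes "0 < t" "\<tau> \<noteq> r" "\<bar>\<tau> - r\<bar> \<le> 1 / t"
  shows "t / 2 \<le> norm (phase_quot t \<tau> r)"
proof -
  define y where "y = - (t * (\<tau> - r))"
  have y2: "\<bar>y\<bar> = t * \<bar>\<tau> - r\<bar>" using assms(1) unfolding y_def abs_minus_cancel abs_mult by simp
  then have y: "\<bar>y\<bar> \<le> 1" "\<bar>y\<bar> = t * \<bar>\<tau> - r\<bar>" using assms by (auto simp: field_simps)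
  have "norm (iexp y - (1 + \<i> * complex_of_real y)) \<le> \<bar>y\<bar>\<^sup>2 / 2"
    using iexp_approx1[of y 1] by (simp add: numeral_2_eq_2)
  moreover have "norm (\<i> * complex_of_real y) \<le> norm (iexp y - 1) + norm (iexp y - (1 + \<i> * complex_of_real y))"
    using norm_triangle_ineq4[of "iexp y - 1" "iexp y - (1 + \<i> * complex_of_real y)"] by (simp add: algebra_simps)
  moreover have "\<bar>y\<bar>\<^sup>2 \<le> \<bar>y\<bar>" using y mult_right_mono[of "\<bar>y\<bar>" 1 "\<bar>y\<bar>"] by (simp add: power2_eq_square)
  ultimately have low: "\<bar>y\<bar> / 2 \<le> norm (iexp y - 1)" by (simp add: norm_mult)
  have "iexp (- (t * \<tau>)) - iexp (- (t * r)) = iexp (- (t * r)) * (iexp y - 1)"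
    by (simp add: y_def right_diff_distrib exp_add[symmetric] algebra_simps)
  then have "norm (phase_quot t \<tau> r) = norm (iexp y - 1) / \<bar>\<tau> - r\<bar>"
    unfolding phase_quot_def norm_divide norm_of_real by (simp only: norm_mult norm_exp_i_times mult_1)
  moreover have "t / 2 \<le> norm (iexp y - 1) / \<bar>\<tau> - r\<bar>"
    using low assms(2) unfolding y2 by (subst pos_le_divide_eq) auto
  ultimately show ?thesis by (simp only:)
qed

text \<open>Close to \<open>\<tau> = r\<close> the resonant quotient is at least
  \<open>t / 2\<close>, whereas the one centred at \<open>- r\<close> is at most
  \<open>2 / r\<close>, which \<open>8 / t \<le> r\<close> bounds by \<open>t / 4\<close>. Division
  of the remaining \<open>t / 4\<close> by \<open>2 * r\<close> gives the claim.\<close>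

lemma wave_symbol_lower:
  assumes t: "0 < t" and r: "8 / t \<le> r" and \<tau>: "\<tau> \<noteq> r" "\<bar>\<tau> - r\<bar> \<le> 1 / t"
  shows "t / (8 * r) \<le> norm (wave_symbol t \<tau> r)"
proof -
  have r0: "0 < r" using t r less_le_trans[of 0 "8/t" r] by simp
  have "1 / t \<le> 8 / t" using t by (intro divide_right_mono) auto
  then have tr: "r \<le> \<tau> + r" using \<tau> r by linarith
  have "norm (phase_quot t \<tau> (- r)) \<le> 2 / (\<tau> + r)"
    unfolding phase_quot_def norm_divide norm_of_real
    using norm_iexp_diff(2)[of "- (t * \<tau>)" "- (t * - r)"] tr r0 by (intro frac_le) auto
  also have "\<dots> \<le> 2 / r" using tr r0 by (intro divide_left_mono) auto
  also have "\<dots> \<le> t / 4" using t r r0 by (simp add: field_simps)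
  finally have "t / 4 \<le> norm (phase_quot t \<tau> (- r) - phase_quot t \<tau> r)"
    using phase_quot_lower[OF t \<tau>] norm_triangle_ineq3[of "phase_quot t \<tau> (- r)" "phase_quot t \<tau> r"] by linarith
  then show ?thesis using r0 unfolding wave_symbol_def norm_divide norm_of_real by (simp add: field_simps)
qed

section \<open>Covariance of the solution\<close>

context spectral begin

lemma wt_nonneg: "0 \<le> wt \<tau> \<xi>" by (simp add: h_nonneg)

lemma Fg_borel_measurable: "(\<lambda>p. Fg t (x::real^'n) (fst p) (snd p)) \<in> borel_measurable borel"
  using Fg_measurable[of t x] unfolding borel_prod .

lemma wt_borel_measurable: "(\<lambda>p. wt (fst p) (snd p)) \<in> borel_measurable borel"
proof -
  have "(\<lambda>p. wt (fst p) (snd p)) \<in> borel_measurable (borel \<Otimes>\<^sub>M borel)" by measurable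
  then show ?thesis unfolding borel_prod .
qed

text \<open>\<open>Fg\<close> vanishes at time 0, so the integral is the energy of an increment
  between the times 0 and \<open>t\<close>.\<close>

lemma integrable_Fg_square:
  assumes "0 \<le> t"
  shows "integrable lborel (\<lambda>p. (norm (Fg t (x::real^'n) (fst p) (snd p)))\<^sup>2 * wt (fst p) (snd p))"
proof (rule integrableI_bounded)
  have "0 < t + 1" using assms by simp
  then obtain K where "K > 0" and K: "\<And>t' x s y. 0 \<le> t' \<Longrightarrow> t' \<le> t + 1 \<Longrightarrow> 0 \<le> s \<Longrightarrow> s \<le> t + 1 \<Longrightarrow>
      energy (\<lambda>\<tau> \<xi>. Fg t' x \<tau> \<xi> - Fg s y \<tau> \<xi>)
        \<le> ennreal (K * pdist t' x s y powr (2 * \<alpha>))"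
    by (rule energy_Fg_diff) (rule that)
  have "energy (\<lambda>\<tau> \<xi>. Fg t x \<tau> \<xi> - Fg 0 x \<tau> \<xi>)
        \<le> ennreal (K * pdist t x 0 x powr (2 * \<alpha>))" using assms by (intro K) auto
  then show "(\<integral>\<^sup>+p. ennreal (norm ((norm (Fg t x (fst p) (snd p)))\<^sup>2 * wt (fst p) (snd p))) \<partial>lborel) < \<infinity>"
    by (simp add: Fg_0 wt_nonneg h_nonneg abs_mult order_le_less_trans)
  show "(\<lambda>p. (norm (Fg t x (fst p) (snd p)))\<^sup>2 * wt (fst p) (snd p)) \<in> borel_measurable lborel"
    unfolding measurable_lborel2
    by (intro borel_measurable_times borel_measurable_power measurable_compose[OF _ borel_measurable_norm] Fg_borel_measurable wt_borel_measurable)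
qed

lemma integrable_Fg_product:
  assumes "0 \<le> t" "0 \<le> s"
  shows "integrable lborel (\<lambda>p. Fg t (x::real^'n) (fst p) (snd p) * cnj (Fg s y (fst p) (snd p)) * complex_of_real (wt (fst p) (snd p)))"
proof (rule Bochner_Integration.integrable_bound)
  show "integrable lborel (\<lambda>p. (norm (Fg t x (fst p) (snd p)))\<^sup>2 * wt (fst p) (snd p)
      + (norm (Fg s y (fst p) (snd p)))\<^sup>2 * wt (fst p) (snd p))"
    using assms by (intro Bochner_Integration.integrable_add integrable_Fg_square)
  show "AE p in lborel. norm (Fg t x (fst p) (snd p) * cnj (Fg s y (fst p) (snd p)) * complex_of_real (wt (fst p) (snd p)))
     \<le> norm ((norm (Fg t x (fst p) (snd p)))\<^sup>2 * wt (fst p) (snd p)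
      + (norm (Fg s y (fst p) (snd p)))\<^sup>2 * wt (fst p) (snd p))"
  proof (rule AE_I2)
    fix p :: "real \<times> (real^'n)"
    let ?a = "norm (Fg t x (fst p) (snd p))" and ?b = "norm (Fg s y (fst p) (snd p))" and ?w = "wt (fst p) (snd p)"
    have "?a * ?b \<le> ?a\<^sup>2 + ?b\<^sup>2"
      using sum_squares_bound[of ?a ?b] zero_le_power2[of ?a] zero_le_power2[of ?b] by linarith
    then have "?a * ?b * ?w \<le> (?a\<^sup>2 + ?b\<^sup>2) * ?w" by (intro mult_right_mono wt_nonneg)
    moreover have "norm (Fg t x (fst p) (snd p) * cnj (Fg s y (fst p) (snd p)) * complex_of_real ?w) = ?a * ?b * ?w"
      by (simp add: norm_mult wt_nonneg h_nonneg abs_mult)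
    ultimately show "norm (Fg t x (fst p) (snd p) * cnj (Fg s y (fst p) (snd p)) * complex_of_real ?w)
      \<le> norm (?a\<^sup>2 * ?w + ?b\<^sup>2 * ?w)" by (simp add: distrib_right abs_of_nonneg wt_nonneg)
  qed
  have of_real_borel: "complex_of_real \<in> borel_measurable borel"
    by (intro borel_measurable_continuous_onI continuous_intros)
  have "cnj \<in> borel_measurable borel"
    by (intro borel_measurable_continuous_onI continuous_intros)
  from measurable_compose[OF Fg_borel_measurable[of s y] this]
  show "(\<lambda>p. Fg t x (fst p) (snd p) * cnj (Fg s y (fst p) (snd p)) * complex_of_real (wt (fst p) (snd p))) \<in> borel_measurable lborel"
    unfolding measurable_lborel2
    by (intro borel_measurable_times Fg_borel_measurable measurable_compose[OF wt_borel_measurable of_real_borel])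
qed

text \<open>Only frequencies in the box and \<open>\<tau>\<close> within \<open>1 / t\<close> of the
  cone \<open>\<tau> = norm \<xi>\<close> are kept. There the integrand is a squared trigonometric
  sum, whose integral over the box is exact, times factors bounded below.\<close>

lemma energy_spaced_diff_lower:
  fixes e x0 :: "real^'n"
  assumes t: "0 < t" and e: "e \<in> Basis"
  obtains c \<delta>0 where "0 < c" "0 < \<delta>0"
    "\<And>\<delta> F b. 0 < \<delta> \<Longrightarrow> \<delta> \<le> \<delta>0 \<Longrightarrow> finite F \<Longrightarrow>
      ennreal (c * \<delta> powr (2 * \<alpha>) * (\<Sum>k\<in>F. (b k)\<^sup>2)) \<le>
      energy (\<lambda>\<tau> \<xi>. \<Sum>k\<in>F. complex_of_real (b k) * spaced_diff (\<lambda>x. Fg t x \<tau> \<xi>) x0 e \<delta> k)"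
proof -
  let ?N = "real CARD('n)"
  define L where "L = 4 + ?N"
  \<comment> \<open>\<open>t\<^sup>2 / 32\<close> is \<open>2 * (t / 8)\<^sup>2\<close>, from the
    increment factor and the wave symbol; \<open>2 powr (1 - 2 * H)\<close> comes from
    \<open>\<tau> \<le> 2 * norm \<xi>\<close>; the power of \<open>L\<close> comes from
    \<open>norm \<xi> \<le> L / \<delta>\<close>, as the exponent of \<open>norm \<xi>\<close> is
    negative.\<close>
  define q where "q = t\<^sup>2 / 32 * 2 powr (1 - 2 * H) * c1 * L powr (- (1 + 2 * H + \<beta>))"
  \<comment> \<open>\<open>pi / 2\<close> is the constant of the box integral and
    \<open>2 / t\<close> the length of the interval in \<open>\<tau>\<close>.\<close>
  define c where "c = q * (pi / 2) * (2 / t)"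
  \<comment> \<open>Makes \<open>3 * pi / (4 * \<delta>0)\<close> equal to \<open>8 / t\<close>, so
    that all frequencies of the box are high enough for \<open>wave_symbol_lower\<close>.\<close>
  define \<delta>0 where "\<delta>0 = 3 * pi * t / 32"
  have L: "L > 0" by (simp add: L_def)
  have q: "q > 0" unfolding q_def using t c L by auto
  have "ennreal (c * \<delta> powr (2 * \<alpha>) * (\<Sum>k\<in>F. (b k)\<^sup>2)) \<le>
      energy (\<lambda>\<tau> \<xi>. \<Sum>k\<in>F. complex_of_real (b k) * spaced_diff (\<lambda>x. Fg t x \<tau> \<xi>) x0 e \<delta> k)"
    if d: "0 < \<delta>" "\<delta> \<le> \<delta>0" and F: "finite F" for \<delta> F b
  proof -
    let ?P = "\<lambda>\<xi>::real^'n. norm (\<Sum>k\<in>F. complex_of_real (b k) * iexp (- (4 * real k * \<delta> * (\<xi> \<bullet> e))))"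
    let ?S = "\<lambda>\<tau> \<xi>. \<Sum>k\<in>F. complex_of_real (b k) *
          spaced_diff (\<lambda>x. Fg t x \<tau> \<xi>) x0 e \<delta> k"
    let ?F = "\<lambda>\<tau> \<xi>. ennreal ((norm (?S \<tau> \<xi>))\<^sup>2 * wt \<tau> \<xi>)"
    let ?D = "q * \<delta> powr (1 + 2 * H + \<beta>)"
    have Dpos: "?D > 0" using q d by simp
    \<comment> \<open>The position of the k-th increment enters only through a phase; the factor of
      an increment of length \<open>\<delta>\<close> and the wave symbol are common to all
      terms.\<close>
    have S: "norm (?S \<tau> \<xi>) = ?P \<xi> * norm (iexp (- (\<delta> * (\<xi> \<bullet> e))) - 1) * norm (wave_symbol t \<tau> (norm \<xi>))" for \<tau> \<xi>
    proof -
      have "?S \<tau> \<xi> = (\<Sum>k\<in>F. complex_of_real (b k) * iexp (- (4 * real k * \<delta> * (\<xi> \<bullet> e))))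
          * (iexp (- (\<delta> * (\<xi> \<bullet> e))) - 1) * (iexp (- (x0 \<bullet> \<xi>)) * wave_symbol t \<tau> (norm \<xi>))"
      proof -
        have "complex_of_real (b k) *
          spaced_diff (\<lambda>x. Fg t x \<tau> \<xi>) x0 e \<delta> k
          = complex_of_real (b k) * iexp (- (4 * real k * \<delta> * (\<xi> \<bullet> e)))
          * (iexp (- (\<delta> * (\<xi> \<bullet> e))) - 1) * (iexp (- (x0 \<bullet> \<xi>)) * wave_symbol t \<tau> (norm \<xi>))" for k
        proof -
          have "- ((x0 + (4 * real k * \<delta> + \<delta>) *\<^sub>R e) \<bullet> \<xi>) = - (4 * real k * \<delta> * (\<xi> \<bullet> e)) + - (\<delta> * (\<xi> \<bullet> e)) + - (x0 \<bullet> \<xi>)"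
            "- ((x0 + (4 * real k * \<delta>) *\<^sub>R e) \<bullet> \<xi>) = - (4 * real k * \<delta> * (\<xi> \<bullet> e)) + - (x0 \<bullet> \<xi>)"
            by (simp_all add: inner_add_left inner_commute algebra_simps)
          then have "iexp (- ((x0 + (4 * real k * \<delta> + \<delta>) *\<^sub>R e) \<bullet> \<xi>)) = iexp (- (4 * real k * \<delta> * (\<xi> \<bullet> e))) * iexp (- (\<delta> * (\<xi> \<bullet> e))) * iexp (- (x0 \<bullet> \<xi>))"
            "iexp (- ((x0 + (4 * real k * \<delta>) *\<^sub>R e) \<bullet> \<xi>)) = iexp (- (4 * real k * \<delta> * (\<xi> \<bullet> e))) * iexp (- (x0 \<bullet> \<xi>))"
            by (simp_all only: of_real_add distrib_left exp_add)
          note ex = this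
          have "B * (p * q * r * w - p * r * w) = B * p * (q - 1) * (r * w)" for B p q r w :: complex
            by (simp add: algebra_simps)
          then show ?thesis unfolding Fg_eq ex .
        qed
        then show ?thesis by (simp only: sum_distrib_right)
      qed
      then show ?thesis by (simp only: norm_mult norm_exp_i_times mult_1)
    qed
    have lower: "?D * ((?P \<xi>)\<^sup>2 * indicator (freq_box e \<delta>) \<xi>) * indicator {norm \<xi> - 1 / t..norm \<xi> + 1 / t} \<tau> \<le> (norm (?S \<tau> \<xi>))\<^sup>2 * wt \<tau> \<xi>"
      if \<tau>: "\<tau> \<noteq> norm \<xi>" for \<tau> \<xi>
    proof (cases "\<xi> \<in> freq_box e \<delta> \<and> \<tau> \<in> {norm \<xi> - 1 / t..norm \<xi> + 1 / t}")
      case False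
      then show ?thesis using wt_nonneg[of \<tau> \<xi>] by (auto simp: indicator_def intro: mult_nonneg_nonneg)
    next
      case True
      let ?r = "norm \<xi>"
      have box: "\<xi> \<in> freq_box e \<delta>" and \<tau>r: "\<bar>\<tau> - ?r\<bar> \<le> 1 / t" using True by auto
      note nb = freq_box_norm[OF d(1) e box]
      have "8 / t = 3 * pi / (4 * \<delta>0)" using t by (simp add: \<delta>0_def)
      also have "\<dots> \<le> 3 * pi / (4 * \<delta>)" using d by (intro divide_left_mono) auto
      also have "\<dots> \<le> ?r" by (rule nb)
      finally have r: "8 / t \<le> ?r" .
      then have r0: "0 < ?r" using t less_le_trans[of 0 "8 / t" ?r] by simp
      have "1 / t \<le> 8 / t" "0 < 1 / t" using t by (auto intro: divide_right_mono)
      then have \<tau>0: "0 < \<tau>" "\<tau> \<le> 2 * ?r" using \<tau>r r t by linarith+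
      have "3 * pi / 4 \<le> \<delta> * (\<xi> \<bullet> e)" "\<delta> * (\<xi> \<bullet> e) \<le> 5 * pi / 4"
        using box d by (auto simp: freq_box_def pos_divide_le_eq pos_le_divide_eq algebra_simps)
      then have i: "2 \<le> (norm (iexp (- (\<delta> * (\<xi> \<bullet> e))) - 1))\<^sup>2"
        by (rule norm_iexp_minus_1_lower)
      have w: "(t / (8 * ?r))\<^sup>2 \<le> (norm (wave_symbol t \<tau> ?r))\<^sup>2"
        using wave_symbol_lower[OF t r \<tau> \<tau>r] t r0 by (intro power_mono) auto
      have "(2 * ?r) powr (1 - 2 * H) \<le> \<tau> powr (1 - 2 * H)" using \<tau>0 H by (intro powr_mono2') auto
      then have wl: "(2 * ?r) powr (1 - 2 * H) * (c1 * ?r powr (- \<beta>)) \<le> wt \<tau> \<xi>"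
        using h_bounds[of \<xi>] r0 \<tau>0 c by (intro mult_mono) auto
      have "?D \<le> 2 * (t / (8 * ?r))\<^sup>2 * ((2 * ?r) powr (1 - 2 * H) * (c1 * ?r powr (- \<beta>)))"
      proof -
        have "(t / (8 * ?r))\<^sup>2 = t\<^sup>2 / 64 * ?r powr (- 2)"
          using r0 by (simp add: powr_minus_divide power_divide power_mult_distrib)
        then have "2 * (t / (8 * ?r))\<^sup>2 * ((2 * ?r) powr (1 - 2 * H) * (c1 * ?r powr (- \<beta>)))
           = t\<^sup>2 / 32 * 2 powr (1 - 2 * H) * c1 * (?r powr (- 2) * ?r powr (1 - 2 * H) * ?r powr (- \<beta>))"
          using r0 by (simp add: powr_mult)
        also have "?r powr (- 2) * ?r powr (1 - 2 * H) * ?r powr (- \<beta>) = ?r powr (- (1 + 2 * H + \<beta>))"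
          by (simp add: powr_add[symmetric])
        finally have eq: "2 * (t / (8 * ?r))\<^sup>2 * ((2 * ?r) powr (1 - 2 * H) * (c1 * ?r powr (- \<beta>)))
           = t\<^sup>2 / 32 * 2 powr (1 - 2 * H) * c1 * ?r powr (- (1 + 2 * H + \<beta>))" .
        have "(L / \<delta>) powr (- (1 + 2 * H + \<beta>)) \<le> ?r powr (- (1 + 2 * H + \<beta>))"
          using nb(2) r0 H \<beta> by (intro powr_mono2') (auto simp: L_def)
        moreover have "(L / \<delta>) powr (- (1 + 2 * H + \<beta>)) = L powr (- (1 + 2 * H + \<beta>)) * \<delta> powr (1 + 2 * H + \<beta>)"
          using L d powr_minus_divide[of \<delta> "1 + 2 * H + \<beta>"] by (simp only: powr_divide) (simp add: powr_minus_divide)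
        ultimately show ?thesis
          unfolding eq q_def using t c by (simp add: mult.assoc mult_left_mono)
      qed
      also have "\<dots> \<le> (norm (iexp (- (\<delta> * (\<xi> \<bullet> e))) - 1))\<^sup>2 * (norm (wave_symbol t \<tau> ?r))\<^sup>2 * wt \<tau> \<xi>"
        using c by (intro mult_mono i w wl) auto
      finally have "?D * (?P \<xi>)\<^sup>2 \<le> ((norm (iexp (- (\<delta> * (\<xi> \<bullet> e))) - 1))\<^sup>2 * (norm (wave_symbol t \<tau> ?r))\<^sup>2 * wt \<tau> \<xi>) * (?P \<xi>)\<^sup>2"
        by (intro mult_right_mono) auto
      moreover have "((norm (iexp (- (\<delta> * (\<xi> \<bullet> e))) - 1))\<^sup>2 * (norm (wave_symbol t \<tau> ?r))\<^sup>2 * wt \<tau> \<xi>) * (?P \<xi>)\<^sup>2 = (norm (?S \<tau> \<xi>))\<^sup>2 * wt \<tau> \<xi>"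
        unfolding S power_mult_distrib by (simp only: mult_ac)
      ultimately have "?D * (?P \<xi>)\<^sup>2 \<le> (norm (?S \<tau> \<xi>))\<^sup>2 * wt \<tau> \<xi>" by (simp only:)
      moreover have "indicator (freq_box e \<delta>) \<xi> = (1::real)" "indicator {norm \<xi> - 1 / t..norm \<xi> + 1 / t} \<tau> = (1::real)"
        using True by auto
      ultimately show ?thesis by (simp only: mult_1_right)
    qed
    have [measurable]: "(\<lambda>p. ?F (fst p) (snd p)) \<in> borel_measurable (borel :: (real \<times> (real^'n)) measure)"
    proof (rule measurable_compose[OF _ measurable_ennreal], rule borel_measurable_times[OF _ wt_borel_measurable])
      show "(\<lambda>p. (norm (?S (fst p) (snd p)))\<^sup>2) \<in> borel_measurable borel"
        by (intro borel_measurable_power measurable_compose[OF _ borel_measurable_norm] borel_measurable_sum borel_measurable_times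
          borel_measurable_const borel_measurable_diff Fg_borel_measurable)
    qed
    have box[measurable]: "freq_box e \<delta> \<in> sets borel" unfolding freq_box_def by measurable
    have "ennreal (c * \<delta> powr (2 * \<alpha>) * (\<Sum>k\<in>F. (b k)\<^sup>2)) = ennreal (?D * (2 / t)) * ennreal (pi / 2 * (\<Sum>k\<in>F. (b k)\<^sup>2) * (1 / \<delta>) ^ DIM(real^'n))"
    proof -
      have "2 * \<alpha> = (1 + 2 * H + \<beta>) + (- ?N)" by (simp add: alpha_eq field_simps)
      then have "\<delta> powr (2 * \<alpha>) = \<delta> powr (1 + 2 * H + \<beta>) * \<delta> powr (- ?N)" by (simp only: powr_add)
      moreover have "\<delta> powr (- ?N) = (1 / \<delta>) ^ DIM(real^'n)"
        using d by (simp add: powr_minus powr_realpow inverse_eq_divide power_one_over)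
      ultimately have "c * \<delta> powr (2 * \<alpha>) * (\<Sum>k\<in>F. (b k)\<^sup>2) = (?D * (2 / t)) * (pi / 2 * (\<Sum>k\<in>F. (b k)\<^sup>2) * (1 / \<delta>) ^ DIM(real^'n))"
        by (simp add: c_def)
      moreover have "0 \<le> ?D * (2 / t)" using Dpos t by simp
      ultimately show ?thesis by (simp only: ennreal_mult')
    qed
    also have "\<dots> = (\<integral>\<^sup>+\<xi>. ennreal (?D * (2 / t)) * ennreal ((?P \<xi>)\<^sup>2 * indicator (freq_box e \<delta>) \<xi>) \<partial>lborel)"
      unfolding nn_integral_trig_sum_box[OF F d(1) e, symmetric] by (rule nn_integral_cmult[symmetric]) measurable
    also have "\<dots> \<le> (\<integral>\<^sup>+\<xi>. (\<integral>\<^sup>+\<tau>. ?F \<tau> \<xi> \<partial>lborel) \<partial>lborel)"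
    proof (rule nn_integral_mono)
      fix \<xi> :: "real^'n"
      let ?Q = "(?P \<xi>)\<^sup>2 * indicator (freq_box e \<delta>) \<xi>" and ?I = "{norm \<xi> - 1 / t..norm \<xi> + 1 / t}"
      have Q: "0 \<le> ?D * ?Q" using Dpos by simp
      have "ennreal (?D * (2 / t)) * ennreal ?Q = ennreal (?D * ?Q) * ennreal (2 / t)"
        using t Dpos by (simp add: ennreal_mult'[symmetric] ennreal_mult''[symmetric] mult_ac)
      also have "\<dots> = (\<integral>\<^sup>+\<tau>. ennreal (?D * ?Q) * indicator ?I \<tau> \<partial>lborel)"
        using t by (subst nn_integral_cmult_indicator) auto
      also have "\<dots> \<le> (\<integral>\<^sup>+\<tau>. ?F \<tau> \<xi> \<partial>lborel)"
      proof (rule nn_integral_mono_AE)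
        show "AE \<tau> in lborel. ennreal (?D * ?Q) * indicator ?I \<tau> \<le> ?F \<tau> \<xi>"
          using AE_lborel_singleton[of "norm \<xi>"]
        proof eventually_elim
          case (elim \<tau>)
          have "ennreal (?D * ?Q) * indicator ?I \<tau> = ennreal (?D * ?Q * indicator ?I \<tau>)" by (auto simp: indicator_def)
          also have "\<dots> \<le> ?F \<tau> \<xi>" by (intro ennreal_leI lower elim)
          finally show ?case .
        qed
      qed
      finally show "ennreal (?D * (2 / t)) * ennreal ?Q \<le> (\<integral>\<^sup>+\<tau>. ?F \<tau> \<xi> \<partial>lborel)" .
    qed
    also have "\<dots> = (\<integral>\<^sup>+p. ?F (fst p) (snd p) \<partial>(lborel \<Otimes>\<^sub>M lborel))"
      by (subst lborel_pair.nn_integral_snd[symmetric]) (simp_all add: lborel_prod)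
    also have "\<dots> = (\<integral>\<^sup>+p. ?F (fst p) (snd p) \<partial>lborel)" by (simp add: lborel_prod)
    finally show ?thesis .
  qed
  then show thesis using that[of c \<delta>0] q t by (simp add: c_def \<delta>0_def)
qed

end

locale wave_field = prob_space M + spectral H \<beta> c1 c2 \<alpha> h
  for M :: "'a measure" and H \<beta> c1 c2 \<alpha> and h :: "real^'n \<Rightarrow> real" +
  fixes cH :: real and X :: "real \<Rightarrow> real^'n \<Rightarrow> 'a \<Rightarrow> real"
  assumes cH: "0 < cH"
    and X_gaussian: "centered_gaussian_field M ({0..} \<times> UNIV) (\<lambda>p \<omega>. X (fst p) (snd p) \<omega>)"
    and X_cov: "\<And>t x s y. 0 \<le> t \<Longrightarrow> 0 \<le> s \<Longrightarrow>
       complex_of_real (expectation (\<lambda>\<omega>. X t x \<omega> * X s y \<omega>)) = cov_kernel cH H h t x s y"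
begin

lemma X_normal: "0 \<le> t \<Longrightarrow> centered_normal_rv M (X t x)"
  using X_gaussian[unfolded centered_gaussian_field_def, rule_format, of "{(t, x)}" "\<lambda>_. 1"] by simp

lemma X_measurable: "0 \<le> t \<Longrightarrow> X t x \<in> borel_measurable M"
  by (intro centered_normal_rv_measurable X_normal)

lemma X_integrable_mult: "0 \<le> t \<Longrightarrow> 0 \<le> s \<Longrightarrow> integrable M (\<lambda>\<omega>. X t x \<omega> * X s y \<omega>)"
  by (intro integrable_mult_of_squares X_measurable centered_normal_rv_square_integrable X_normal)

text \<open>The double sum of covariances is the integral of the expanded square. The points need
  not be distinct, and the form in \<open>ennreal\<close> lets upper and lower energy bounds be
  inserted directly.\<close>

lemma variance_spectral:
  fixes I :: "'i set" and T :: "'i \<Rightarrow> real" and P :: "'i \<Rightarrow> real^'n" and b :: "'i \<Rightarrow> real"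
  assumes T: "\<And>i. i \<in> I \<Longrightarrow> 0 \<le> T i"
  shows "ennreal (expectation (\<lambda>\<omega>. (\<Sum>i\<in>I. b i * X (T i) (P i) \<omega>)\<^sup>2))
    = ennreal cH * energy (\<lambda>\<tau> \<xi>. \<Sum>i\<in>I. complex_of_real (b i) * Fg (T i) (P i) \<tau> \<xi>)"
proof -
  let ?f = "\<lambda>i p. Fg (T i) (P i) (fst p) (snd p)" and ?w = "\<lambda>p. wt (fst p) (snd p)"
  let ?n = "\<lambda>p. (norm (\<Sum>i\<in>I. complex_of_real (b i) * ?f i p))\<^sup>2 * ?w p"
  have int: "integrable lborel (\<lambda>p. ?f i p * cnj (?f j p) * complex_of_real (?w p))" if "i \<in> I" "j \<in> I" for i j
    using that T by (intro integrable_Fg_product) auto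
  have n: "complex_of_real (?n p) = (\<Sum>i\<in>I. \<Sum>j\<in>I. complex_of_real (b i * b j) * (?f i p * cnj (?f j p) * complex_of_real (?w p)))" for p
    unfolding of_real_mult complex_norm_square cnj_sum sum_product
    unfolding sum_distrib_right by (intro sum.cong refl) (simp add: mult_ac)
  have "integrable lborel (\<lambda>p. complex_of_real (?n p))"
    unfolding n using int by (intro Bochner_Integration.integrable_sum integrable_mult_right) auto
  from integrable_Re[OF this] have intn': "integrable lborel ?n" by (simp only: Re_complex_of_real)
  have "complex_of_real (expectation (\<lambda>\<omega>. (\<Sum>i\<in>I. b i * X (T i) (P i) \<omega>)\<^sup>2))
     = complex_of_real (\<Sum>i\<in>I. \<Sum>j\<in>I. b i * b j * expectation (\<lambda>\<omega>. X (T i) (P i) \<omega> * X (T j) (P j) \<omega>))"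
  proof -
    have "expectation (\<lambda>\<omega>. (\<Sum>i\<in>I. b i * X (T i) (P i) \<omega>)\<^sup>2)
      = expectation (\<lambda>\<omega>. \<Sum>i\<in>I. \<Sum>j\<in>I. b i * b j * (X (T i) (P i) \<omega> * X (T j) (P j) \<omega>))"
      unfolding power2_eq_square sum_product by (intro Bochner_Integration.integral_cong sum.cong refl) (simp add: mult_ac)
    also have "\<dots> = (\<Sum>i\<in>I. \<Sum>j\<in>I. b i * b j * expectation (\<lambda>\<omega>. X (T i) (P i) \<omega> * X (T j) (P j) \<omega>))"
      using T by (simp add: Bochner_Integration.integral_sum X_integrable_mult)
    finally show ?thesis by simp
  qed
  also have "\<dots> = (\<Sum>i\<in>I. \<Sum>j\<in>I. complex_of_real (b i * b j) * cov_kernel cH H h (T i) (P i) (T j) (P j))"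
    using T by (simp add: X_cov[symmetric])
  also have "\<dots> = complex_of_real cH * (\<Sum>i\<in>I. \<Sum>j\<in>I. complex_of_real (b i * b j) *
      (\<integral>p. ?f i p * cnj (?f j p) * complex_of_real (?w p) \<partial>lborel))"
    by (simp add: cov_kernel_def case_prod_beta' sum_distrib_left mult_ac)
  also have "\<dots> = complex_of_real cH * (\<integral>p. complex_of_real (?n p) \<partial>lborel)"
    unfolding n using int by (simp add: Bochner_Integration.integral_sum)
  also have "\<dots> = complex_of_real (cH * (\<integral>p. ?n p \<partial>lborel))"
    unfolding integral_complex_of_real of_real_mult[of cH] ..
  finally have "expectation (\<lambda>\<omega>. (\<Sum>i\<in>I. b i * X (T i) (P i) \<omega>)\<^sup>2) = cH * (\<integral>p. ?n p \<partial>lborel)"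
    by (simp only: of_real_eq_iff)
  also have "ennreal \<dots> = ennreal cH * (\<integral>\<^sup>+p. ennreal (?n p) \<partial>lborel)"
    using cH intn' by (subst nn_integral_eq_integral) (auto simp: ennreal_mult' wt_nonneg)
  finally show ?thesis .
qed

end

section \<open>Dyadic chaining\<close>

text \<open>Rounding is downward in every coordinate, so a nonnegative time stays nonnegative and
  does not increase. A point of a given set may still be moved out of it.\<close>

definition dyadic :: "nat \<Rightarrow> 'a::euclidean_space \<Rightarrow> 'a" where
  "dyadic n x = (\<Sum>b\<in>Basis. (of_int \<lfloor>2 ^ n * (x \<bullet> b)\<rfloor> / 2 ^ n) *\<^sub>R b)"

lemma dyadic_inner: "b \<in> Basis \<Longrightarrow> dyadic n x \<bullet> b = of_int \<lfloor>2 ^ n * (x \<bullet> b)\<rfloor> / 2 ^ n"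
  by (simp add: dyadic_def)

lemma norm_dyadic_diff: "norm (x - dyadic n (x::'a::euclidean_space)) \<le> real DIM('a) / 2 ^ n"
proof -
  have "norm (x - dyadic n x) \<le> (\<Sum>b\<in>Basis. \<bar>(x - dyadic n x) \<bullet> b\<bar>)" by (rule norm_le_l1)
  also have "\<dots> \<le> (\<Sum>b\<in>(Basis::'a set). 1 / 2 ^ n)"
  proof (rule sum_mono)
    fix b :: 'a assume b: "b \<in> Basis"
    have "\<bar>2 ^ n * (x \<bullet> b) - of_int \<lfloor>2 ^ n * (x \<bullet> b)\<rfloor>\<bar> \<le> 1" by linarith
    then have "\<bar>2 ^ n * (x \<bullet> b) - of_int \<lfloor>2 ^ n * (x \<bullet> b)\<rfloor>\<bar> / 2 ^ n \<le> 1 / 2 ^ n" by (intro divide_right_mono) auto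
    moreover have "(x - dyadic n x) \<bullet> b = (2 ^ n * (x \<bullet> b) - of_int \<lfloor>2 ^ n * (x \<bullet> b)\<rfloor>) / 2 ^ n"
      by (simp add: inner_diff_left dyadic_inner b diff_divide_distrib)
    ultimately show "\<bar>(x - dyadic n x) \<bullet> b\<bar> \<le> 1 / 2 ^ n" by simp
  qed
  finally show ?thesis by simp
qed

lemma dyadic_tendsto: "(\<lambda>n. dyadic n x) \<longlonglongrightarrow> x"
proof (rule LIMSEQ_I)
  fix r :: real assume r: "r > 0"
  have "(\<lambda>n. real DIM('a) * (1 / 2) ^ n) \<longlonglongrightarrow> real DIM('a) * 0"
    by (intro tendsto_mult tendsto_const LIMSEQ_power_zero) auto
  then have "\<forall>\<^sub>F n in sequentially. real DIM('a) * (1 / 2) ^ n < r"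
    using r by (intro order_tendstoD) auto
  then obtain N where N: "\<And>n. n \<ge> N \<Longrightarrow> real DIM('a) * (1 / 2) ^ n < r" by (auto simp: eventually_sequentially)
  have "norm (dyadic n x - x) < r" if "n \<ge> N" for n
    using norm_dyadic_diff[of x n] N[OF that] by (simp add: norm_minus_commute power_one_over)
  then show "\<exists>N. \<forall>n\<ge>N. norm (dyadic n x - x) < r" by blast
qed

lemma dyadic_image_card:
  assumes R: "\<And>x. x \<in> S \<Longrightarrow> norm (x::'a::euclidean_space) \<le> real R"
  shows "finite (dyadic n ` S)" "card (dyadic n ` S) \<le> ((2 * R + 1) * 2 ^ n) ^ DIM('a)"
proof -
  let ?I = "{- int (R * 2 ^ n)..int (R * 2 ^ n)}"
  let ?g = "\<lambda>f. \<Sum>b\<in>(Basis::'a set). (of_int (f b) / 2 ^ n :: real) *\<^sub>R b"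
  let ?P = "PiE (Basis :: 'a set) (\<lambda>_. ?I)"
  have sub: "dyadic n ` S \<subseteq> ?g ` ?P"
  proof
    fix p assume "p \<in> dyadic n ` S"
    then obtain x where x: "x \<in> S" "p = dyadic n x" by auto
    let ?f = "restrict (\<lambda>b. \<lfloor>2 ^ n * (x \<bullet> b)\<rfloor>) Basis"
    have "?f \<in> ?P"
    proof (rule PiE_I)
      fix b :: 'a assume b: "b \<in> Basis"
      have "\<bar>x \<bullet> b\<bar> \<le> real R" using Basis_le_norm[OF b, of x] R[OF x(1)] by simp
      then have "\<bar>2 ^ n * (x \<bullet> b)\<bar> \<le> 2 ^ n * real R" by (simp add: abs_mult)
      then have "of_int (- int (R * 2 ^ n)) \<le> 2 ^ n * (x \<bullet> b)" "2 ^ n * (x \<bullet> b) \<le> of_int (int (R * 2 ^ n))"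
        by (auto simp: abs_le_iff mult.commute)
      from floor_mono[OF this(1)] floor_mono[OF this(2)] show "?f b \<in> ?I"
        using b unfolding floor_of_int by simp
    qed auto
    moreover have "p = ?g ?f" unfolding x dyadic_def by (intro sum.cong) auto
    ultimately show "p \<in> ?g ` ?P" by (rule image_eqI[where x="?f", rotated])
  qed
  have fin: "finite ?P" by (intro finite_PiE) auto
  then show "finite (dyadic n ` S)" using sub finite_surj by blast
  have "card (dyadic n ` S) \<le> card (?g ` ?P)" using sub fin by (intro card_mono) auto
  also have "\<dots> \<le> card ?P" using fin by (rule card_image_le)
  also have "\<dots> = (2 * (R * 2 ^ n) + 1) ^ DIM('a)"
  proof -
    have "card {- int m..int m} = 2 * m + 1" for m by simp
    then show ?thesis by (simp only: card_PiE[OF finite_Basis] prod_constant)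
  qed
  also have "\<dots> \<le> ((2 * R + 1) * 2 ^ n) ^ DIM('a)"
    by (intro power_mono) (auto simp: algebra_simps)
  finally show "card (dyadic n ` S) \<le> ((2 * R + 1) * 2 ^ n) ^ DIM('a)" .
qed

text \<open>Two consecutive levels together cover both kinds of links in the chaining: two points of
  one level, and a point with its refinement.\<close>

abbreviation dyadic2 :: "nat \<Rightarrow> 'a::euclidean_space set \<Rightarrow> 'a set" where
  "dyadic2 n S \<equiv> dyadic n ` S \<union> dyadic (Suc n) ` S"

text \<open>Union bound over all pairs: there are at most \<open>(C * B ^ n)\<^sup>2\<close> of
  them, and \<open>K\<close> makes each tail a multiple of \<open>(1 / (2 * B\<^sup>2)) ^ n\<close>.
  The failure probabilities are then summable and Borel-Cantelli applies.\<close>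

lemma (in prob_space) AE_dyadic_increments_bounded:
  fixes X :: "'e::euclidean_space \<Rightarrow> 'a \<Rightarrow> real"
  assumes S: "bounded S" and \<sigma>: "0 < \<sigma>"
    and X: "\<And>n p q. p \<in> dyadic2 n S \<Longrightarrow> q \<in> dyadic2 n S \<Longrightarrow> centered_normal_rv M (\<lambda>\<omega>. X p \<omega> - X q \<omega>)"
    and var: "\<And>n p q. p \<in> dyadic2 n S \<Longrightarrow> q \<in> dyadic2 n S \<Longrightarrow>
       expectation (\<lambda>\<omega>. (X p \<omega> - X q \<omega>)\<^sup>2) \<le> (\<sigma> * norm (p - q) powr a)\<^sup>2"
  obtains K where "0 \<le> K" "AE \<omega> in M. \<forall>\<^sub>F n in sequentially. \<forall>p\<in>dyadic2 n S. \<forall>q\<in>dyadic2 n S.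
      \<bar>X p \<omega> - X q \<omega>\<bar> \<le> K * sqrt (real n) * norm (p - q) powr a"
proof -
  let ?d = "DIM('e)"
  obtain R :: nat where R: "\<And>x. x \<in> S \<Longrightarrow> norm x \<le> real R"
    using S unfolding bounded_iff by (meson order_trans real_arch_simple)
  define B where "B = (2::real) ^ ?d"
  define C where "C = 2 * (real (2 * R + 1) * 2) ^ ?d"
  \<comment> \<open>Solves \<open>K\<^sup>2 / (4 * \<sigma>\<^sup>2) = ln (2 * B\<^sup>2)\<close>,
    the 4 being that of the upper tail bound.\<close>
  define K where "K = 2 * \<sigma> * sqrt (ln (2 * B\<^sup>2))"
  have B1: "1 \<le> B" unfolding B_def by simp
  have B2: "1 < 2 * B\<^sup>2" using one_le_power[OF B1, of 2] by simp
  have lnB: "0 < ln (2 * B\<^sup>2)" using B2 by (rule ln_gt_zero)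
  have K0: "0 < K" using \<sigma> lnB by (simp add: K_def)
  define E where "E n = (\<lambda>(p, q). {\<omega>\<in>space M. K * sqrt (real n) * norm (p - q) powr a \<le> \<bar>X p \<omega> - X q \<omega>\<bar>})" for n :: nat
  \<comment> \<open>Equal points are left out: the tail bound needs a positive threshold, and for
    them the claim is trivial.\<close>
  define I where "I n = {(p, q) \<in> dyadic2 n S \<times> dyadic2 n S. p \<noteq> q}" for n
  define A where "A n = (\<Union>pq\<in>I n. E n pq)" for n
  have fin2: "finite (dyadic2 n S)" for n using dyadic_image_card(1)[OF R] by auto
  have finI: "finite (I n)" for n
    unfolding I_def by (rule finite_subset[of _ "dyadic2 n S \<times> dyadic2 n S"]) (use fin2 in auto)
  have card2: "real (card (dyadic2 n S)) \<le> C * B ^ n" for n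
  proof -
    have "real (card (dyadic2 n S)) \<le> real (card (dyadic n ` S)) + real (card (dyadic (Suc n) ` S))"
      by (simp only: of_nat_add[symmetric] of_nat_le_iff card_Un_le)
    also have "real (card (dyadic n ` S)) \<le> real (((2 * R + 1) * 2 ^ n) ^ ?d)"
      using dyadic_image_card(2)[OF R] by (simp only: of_nat_le_iff)
    also have "\<dots> \<le> real (((2 * R + 1) * 2 ^ Suc n) ^ ?d)"
      by (simp only: of_nat_le_iff) (intro power_mono mult_left_mono, auto)
    also have "real (card (dyadic (Suc n) ` S)) \<le> real (((2 * R + 1) * 2 ^ Suc n) ^ ?d)"
      using dyadic_image_card(2)[OF R, of S "Suc n"] by (simp only: of_nat_le_iff)
    also have "real (((2 * R + 1) * 2 ^ Suc n) ^ ?d) + real (((2 * R + 1) * 2 ^ Suc n) ^ ?d) = C * B ^ n"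
    proof -
      have "real (((2 * R + 1) * 2 ^ Suc n) ^ ?d) = (real (2 * R + 1) * 2 * 2 ^ n) ^ ?d"
        by (simp only: of_nat_power of_nat_mult of_nat_numeral power_Suc mult_ac)
      also have "\<dots> = (real (2 * R + 1) * 2) ^ ?d * (2 ^ n) ^ ?d" by (rule power_mult_distrib)
      also have "((2::real) ^ n) ^ ?d = B ^ n" by (simp add: B_def power_mult[symmetric] mult.commute)
      finally show ?thesis by (simp add: C_def)
    qed
    finally show ?thesis by simp
  qed
  have cardI: "real (card (I n)) \<le> (C * B ^ n)\<^sup>2" for n
  proof -
    have "card (I n) \<le> card (dyadic2 n S \<times> dyadic2 n S)"
      unfolding I_def using fin2 by (intro card_mono) auto
    then have "real (card (I n)) \<le> real (card (dyadic2 n S)) * real (card (dyadic2 n S))"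
      by (simp add: card_cartesian_product flip: of_nat_mult)
    also have "\<dots> \<le> (C * B ^ n) * (C * B ^ n)"
      using card2[of n] by (intro mult_mono) (auto intro: order_trans[OF _ card2])
    finally show ?thesis by (simp add: power2_eq_square)
  qed
  have Em: "E n pq \<in> events" if "pq \<in> I n" for n pq
  proof -
    obtain p q where pq: "pq = (p, q)" "p \<in> dyadic2 n S" "q \<in> dyadic2 n S" using \<open>pq \<in> I n\<close> by (auto simp: I_def)
    have [measurable]: "(\<lambda>\<omega>. X p \<omega> - X q \<omega>) \<in> borel_measurable M"
      by (rule centered_normal_rv_measurable[OF X[OF pq(2,3)]])
    show ?thesis unfolding E_def pq case_prod_conv by measurable
  qed
  have PE: "prob (E n pq) \<le> 2 * (1 / (2 * B\<^sup>2)) ^ n" if pqI: "pq \<in> I n" and n: "n > 0" for n pq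
  proof -
    obtain p q where pq: "pq = (p, q)" "p \<in> dyadic2 n S" "q \<in> dyadic2 n S" "p \<noteq> q" using pqI by (auto simp: I_def)
    let ?N = "norm (p - q) powr a"
    have N: "0 < ?N" using pq by simp
    have "prob (E n pq) \<le> 2 * exp (- ((K * sqrt (real n) * ?N)\<^sup>2 / (4 * (\<sigma> * ?N)\<^sup>2)))"
      unfolding E_def pq case_prod_conv
      by (rule centered_normal_upper_tail[OF X[OF pq(2,3)] _ var[OF pq(2,3)]]) (use \<sigma> N K0 n in auto)
    also have "(K * sqrt (real n) * ?N)\<^sup>2 / (4 * (\<sigma> * ?N)\<^sup>2) = real n * ln (2 * B\<^sup>2)"
      using \<sigma> N lnB by (simp add: K_def power_mult_distrib)
    also have "exp (- (real n * ln (2 * B\<^sup>2))) = (1 / (2 * B\<^sup>2)) ^ n"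
    proof -
      have "exp (- (real n * ln (2 * B\<^sup>2))) = exp (- ln (2 * B\<^sup>2)) ^ n" by (simp add: exp_of_nat_mult[symmetric])
      also have "exp (- ln (2 * B\<^sup>2)) = 1 / (2 * B\<^sup>2)" using B1 by (simp add: exp_minus inverse_eq_divide)
      finally show ?thesis .
    qed
    finally show ?thesis .
  qed
  have Am: "A n \<in> events" for n unfolding A_def using finI Em by auto
  have PA: "prob (A n) \<le> 2 * C\<^sup>2 * (1/2) ^ n" if n: "n > 0" for n
  proof -
    have "prob (A n) \<le> (\<Sum>pq\<in>I n. prob (E n pq))"
      unfolding A_def using finI Em by (intro finite_measure_subadditive_finite) auto
    also have "\<dots> \<le> real (card (I n)) * (2 * (1 / (2 * B\<^sup>2)) ^ n)"
      using PE n by (intro sum_bounded_above) auto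
    also have "\<dots> \<le> (C * B ^ n)\<^sup>2 * (2 * (1 / (2 * B\<^sup>2)) ^ n)"
      using cardI by (intro mult_right_mono) auto
    also have "\<dots> = 2 * C\<^sup>2 * (1/2) ^ n"
      using B1 by (simp add: power_mult_distrib power_divide power_mult[symmetric] mult.commute)
    finally show ?thesis .
  qed
  have "summable (\<lambda>n. prob (A n))"
  proof (rule summable_comparison_test_ev)
    show "\<forall>\<^sub>F n in sequentially. norm (prob (A n)) \<le> 2 * C\<^sup>2 * (1/2) ^ n"
      using eventually_gt_at_top[of 0] by eventually_elim (auto simp: PA)
    show "summable (\<lambda>n. 2 * C\<^sup>2 * (1/2) ^ n)" by (intro summable_mult summable_geometric) auto
  qed
  then have "AE \<omega> in M. \<forall>\<^sub>F n in sequentially. \<omega> \<in> space M - A n"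
    using Am by (intro borel_cantelli_AE1) (auto simp: emeasure_eq_measure)
  then have "AE \<omega> in M. \<forall>\<^sub>F n in sequentially. \<forall>p\<in>dyadic2 n S. \<forall>q\<in>dyadic2 n S.
      \<bar>X p \<omega> - X q \<omega>\<bar> \<le> K * sqrt (real n) * norm (p - q) powr a"
  proof eventually_elim
    case (elim \<omega>)
    then show ?case
    proof eventually_elim
      case (elim n)
      show ?case
      proof (intro ballI)
        fix p q assume pq: "p \<in> dyadic2 n S" "q \<in> dyadic2 n S"
        show "\<bar>X p \<omega> - X q \<omega>\<bar> \<le> K * sqrt (real n) * norm (p - q) powr a"
        proof (cases "p = q")
          case False
          then have "(p, q) \<in> I n" using pq by (auto simp: I_def)
          then have "\<omega> \<notin> E n (p, q)" using elim by (auto simp: A_def)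
          then show ?thesis using elim by (auto simp: E_def)
        qed simp
      qed
    qed
  qed
  then show thesis using that[of K] K0 by simp
qed

lemma summable_Suc_times_geometric:
  fixes r :: real assumes "0 \<le> r" "r < 1"
  shows "summable (\<lambda>i. (1 + real i) * r ^ i)"
proof -
  have "summable (\<lambda>n. diffs (\<lambda>_. 1) n * r ^ n)"
    using assms by (intro termdiff_converges[of _ 1]) (auto simp: summable_geometric)
  then show ?thesis by (simp add: diffs_def add.commute)
qed

text \<open>Both values are compared with those at the roundings of a level \<open>n\<close> whose
  mesh \<open>1 / 2 ^ n\<close> is comparable to \<open>norm (x - y)\<close>. The telescoped
  remainders decay geometrically and stay of the order of the first link, whose factor
  \<open>sqrt n\<close> becomes the root of the logarithm.\<close>

lemma dyadic_chaining:
  fixes f :: "'e::euclidean_space \<Rightarrow> real"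
  assumes a: "0 < a" and K: "0 \<le> K"
    and inc: "\<And>n p q. n0 \<le> n \<Longrightarrow> p \<in> dyadic2 n S \<Longrightarrow> q \<in> dyadic2 n S \<Longrightarrow> \<bar>f p - f q\<bar> \<le> K * sqrt (real n) * norm (p - q) powr a"
    and cont: "\<And>x. x \<in> S \<Longrightarrow> (\<lambda>n. f (dyadic n x)) \<longlonglongrightarrow> f x"
  obtains C \<delta> where "0 \<le> C" "0 < \<delta>" "\<And>x y. x \<in> S \<Longrightarrow> y \<in> S \<Longrightarrow> 0 < norm (x - y) \<Longrightarrow> norm (x - y) \<le> \<delta> \<Longrightarrow>
      \<bar>f x - f y\<bar> \<le> C * (norm (x - y) powr a * sqrt (ln (1 + 1 / norm (x - y))))"
proof -
  let ?d = "real DIM('e)"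
  define r where "r = (2::real) powr (- a)"
  have r: "0 < r" "r < 1" using a by (auto simp: r_def powr_less_one)
  define Z where "Z = (\<Sum>i. (1 + real i) * r ^ i)"
  have sum: "summable (\<lambda>i. (1 + real i) * r ^ i)" using r by (intro summable_Suc_times_geometric) auto
  have Z0: "0 \<le> Z" unfolding Z_def using r by (intro suminf_nonneg sum) auto
  \<comment> \<open>At least 1, since \<open>sqrt (n + i) \<le> sqrt n * (1 + i)\<close> is used
    below and fails for \<open>n = 0\<close>.\<close>
  define n1 where "n1 = max 1 n0"
  have rn: "r ^ n = (1 / 2 ^ n) powr a" for n
    by (simp add: r_def powr_minus powr_divide powr_power powr_realpow[symmetric] powr_powr inverse_eq_divide power_one_over mult.commute)
  have pt: "\<bar>f x - f (dyadic n x)\<bar> \<le> K * (2 * ?d) powr a * Z * (sqrt (real n) * r ^ n)" if x: "x \<in> S" and n: "n1 \<le> n" for x n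
  proof -
    have step: "\<bar>f (dyadic (Suc m) x) - f (dyadic m x)\<bar> \<le> K * (2 * ?d) powr a * (sqrt (real m) * r ^ m)" if m: "n1 \<le> m" for m
    proof -
      have "norm (dyadic (Suc m) x - dyadic m x) \<le> norm (x - dyadic (Suc m) x) + norm (x - dyadic m x)"
        using norm_triangle_ineq4[of "x - dyadic m x" "x - dyadic (Suc m) x"] by simp
      also have "\<dots> \<le> ?d / 2 ^ Suc m + ?d / 2 ^ m" by (intro add_mono norm_dyadic_diff)
      also have "\<dots> \<le> 2 * ?d * (1 / 2 ^ m)" by (simp add: field_simps)
      finally have "norm (dyadic (Suc m) x - dyadic m x) powr a \<le> (2 * ?d * (1 / 2 ^ m)) powr a"
        using a by (intro powr_mono2) auto
      also have "\<dots> = (2 * ?d) powr a * r ^ m" unfolding rn by (rule powr_mult)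
      finally have "K * sqrt (real m) * norm (dyadic (Suc m) x - dyadic m x) powr a \<le> K * sqrt (real m) * ((2 * ?d) powr a * r ^ m)"
        using K by (intro mult_left_mono) auto
      moreover have "\<bar>f (dyadic (Suc m) x) - f (dyadic m x)\<bar> \<le> K * sqrt (real m) * norm (dyadic (Suc m) x - dyadic m x) powr a"
        using m x by (intro inc) (auto simp: n1_def)
      ultimately show ?thesis by (simp add: mult_ac)
    qed
    have part: "\<bar>f (dyadic (n + j) x) - f (dyadic n x)\<bar> \<le> K * (2 * ?d) powr a * Z * (sqrt (real n) * r ^ n)" for j
    proof -
      have "f (dyadic (n + j) x) - f (dyadic n x) = (\<Sum>i<j. f (dyadic (Suc (n + i)) x) - f (dyadic (n + i) x))"
        using sum_lessThan_telescope[of "\<lambda>i. f (dyadic (n + i) x)" j] by simp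
      then have "\<bar>f (dyadic (n + j) x) - f (dyadic n x)\<bar> \<le> (\<Sum>i<j. \<bar>f (dyadic (Suc (n + i)) x) - f (dyadic (n + i) x)\<bar>)"
        by (simp only: sum_abs)
      also have "\<dots> \<le> (\<Sum>i<j. K * (2 * ?d) powr a * (sqrt (real n) * r ^ n) * ((1 + real i) * r ^ i))"
      proof (rule sum_mono)
        fix i assume "i \<in> {..<j}"
        have n1: "1 \<le> n" using n by (simp add: n1_def)
        have "real (n + i) \<le> real n * (1 + real i) ^ 2"
        proof -
          have "n + i \<le> n * (1 + i) ^ 2"
          proof -
            have "n + i \<le> n * (1 + i)" using n1 by (simp add: algebra_simps)
            also have "\<dots> \<le> n * (1 + i) ^ 2" by (intro mult_left_mono) (auto simp: power2_eq_square)
            finally show ?thesis .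
          qed
          then have "real (n + i) \<le> real (n * (1 + i) ^ 2)" by (simp only: of_nat_le_iff)
          then show ?thesis by simp
        qed
        then have "sqrt (real (n + i)) \<le> sqrt (real n * (1 + real i) ^ 2)" by (rule real_sqrt_le_mono)
        also have "\<dots> = sqrt (real n) * (1 + real i)" by (simp add: real_sqrt_mult)
        finally have "sqrt (real (n + i)) * r ^ (n + i) \<le> sqrt (real n) * (1 + real i) * r ^ (n + i)"
          using r by (intro mult_right_mono) auto
        then have "K * (2 * ?d) powr a * (sqrt (real (n + i)) * r ^ (n + i)) \<le> K * (2 * ?d) powr a * (sqrt (real n) * (1 + real i) * r ^ (n + i))"
          using K by (intro mult_left_mono) auto
        moreover have "\<bar>f (dyadic (Suc (n + i)) x) - f (dyadic (n + i) x)\<bar> \<le> K * (2 * ?d) powr a * (sqrt (real (n + i)) * r ^ (n + i))"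
          using n by (intro step) auto
        ultimately show "\<bar>f (dyadic (Suc (n + i)) x) - f (dyadic (n + i) x)\<bar> \<le> K * (2 * ?d) powr a * (sqrt (real n) * r ^ n) * ((1 + real i) * r ^ i)"
          by (simp add: power_add mult_ac)
      qed
      also have "\<dots> = K * (2 * ?d) powr a * (sqrt (real n) * r ^ n) * (\<Sum>i<j. (1 + real i) * r ^ i)"
        by (simp add: sum_distrib_left)
      also have "\<dots> \<le> K * (2 * ?d) powr a * (sqrt (real n) * r ^ n) * Z"
        unfolding Z_def using K r by (intro mult_left_mono sum_le_suminf sum) auto
      finally show ?thesis by (simp add: mult_ac)
    qed
    have "(\<lambda>j. f (dyadic (j + n) x)) \<longlonglongrightarrow> f x" using cont[OF x] by (rule LIMSEQ_ignore_initial_segment)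
    then have "(\<lambda>j. \<bar>f (dyadic (n + j) x) - f (dyadic n x)\<bar>) \<longlonglongrightarrow> \<bar>f x - f (dyadic n x)\<bar>"
      by (intro tendsto_intros) (simp add: add.commute)
    then show ?thesis by (rule LIMSEQ_le_const2) (use part in auto)
  qed
  define C0 where "C0 = K * (1 + 2 * ?d) powr a + 2 * (K * (2 * ?d) powr a * Z)"
  define C where "C = C0 * (2 powr a / sqrt (ln 2))"
  have C0: "0 \<le> C0" unfolding C0_def using K Z0 by auto
  have "\<bar>f x - f y\<bar> \<le> C * (norm (x - y) powr a * sqrt (ln (1 + 1 / norm (x - y))))"
    if xy: "x \<in> S" "y \<in> S" "0 < norm (x - y)" "norm (x - y) \<le> 1 / 2 ^ n1" for x y
  proof -
    let ?D = "norm (x - y)"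
    \<comment> \<open>The finest level whose mesh is not below the distance, so
      \<open>?D \<le> 1 / 2 ^ n \<le> 2 * ?D\<close>.\<close>
    define n where "n = nat \<lfloor>- log 2 ?D\<rfloor>"
    have "log 2 ?D \<le> log 2 (1 / 2 ^ n1)" using xy by (subst log_le_cancel_iff) auto
    also have "\<dots> = - real n1" by (simp add: log_divide log_nat_power)
    finally have l: "real n1 \<le> - log 2 ?D" by simp
    have n_le: "real n \<le> - log 2 ?D" and n_gt: "- log 2 ?D < real n + 1" unfolding n_def using l by linarith+
    have n: "n1 \<le> n" unfolding n_def using l by linarith
    have D: "?D = 2 powr (log 2 ?D)" using xy by simp
    have D1: "?D \<le> 1 / 2 ^ n"
    proof -
      have "?D \<le> 2 powr (- real n)" by (subst D, rule powr_mono) (use n_le in auto)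
      then show ?thesis by (simp add: powr_minus powr_realpow inverse_eq_divide)
    qed
    have D2: "1 / 2 ^ n \<le> 2 * ?D"
    proof -
      have "2 powr (- real n) \<le> 2 powr (1 + log 2 ?D)" by (rule powr_mono) (use n_gt in auto)
      also have "\<dots> = 2 * ?D" using xy by (simp add: powr_add)
      finally show ?thesis by (simp add: powr_minus powr_realpow inverse_eq_divide)
    qed
    have "norm (dyadic n x - dyadic n y) \<le> ?D + (norm (x - dyadic n x) + norm (y - dyadic n y))"
    proof -
      have "dyadic n x - dyadic n y = (x - y) + ((y - dyadic n y) - (x - dyadic n x))" by simp
      also have "norm \<dots> \<le> ?D + norm ((y - dyadic n y) - (x - dyadic n x))" by (rule norm_triangle_ineq)
      also have "norm ((y - dyadic n y) - (x - dyadic n x)) \<le> norm (y - dyadic n y) + norm (x - dyadic n x)" by (rule norm_triangle_ineq4)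
      finally show ?thesis by simp
    qed
    also have "\<dots> \<le> 1 / 2 ^ n + (?d / 2 ^ n + ?d / 2 ^ n)" by (intro add_mono D1 norm_dyadic_diff)
    also have "\<dots> = (1 + 2 * ?d) * (1 / 2 ^ n)" by (simp add: field_simps)
    finally have "norm (dyadic n x - dyadic n y) powr a \<le> ((1 + 2 * ?d) * (1 / 2 ^ n)) powr a"
      using a by (intro powr_mono2) auto
    also have "\<dots> = (1 + 2 * ?d) powr a * r ^ n" unfolding rn by (rule powr_mult)
    finally have "K * sqrt (real n) * norm (dyadic n x - dyadic n y) powr a \<le> K * sqrt (real n) * ((1 + 2 * ?d) powr a * r ^ n)"
      using K by (intro mult_left_mono) auto
    moreover have "\<bar>f (dyadic n x) - f (dyadic n y)\<bar> \<le> K * sqrt (real n) * norm (dyadic n x - dyadic n y) powr a"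
      using n xy by (intro inc) (auto simp: n1_def)
    ultimately have mid: "\<bar>f (dyadic n x) - f (dyadic n y)\<bar> \<le> K * (1 + 2 * ?d) powr a * (sqrt (real n) * r ^ n)" by (simp add: mult_ac)
    have "\<bar>f x - f y\<bar> \<le> C0 * (sqrt (real n) * r ^ n)"
      using pt[OF xy(1) n] pt[OF xy(2) n] mid by (simp add: C0_def distrib_right)
    also have "\<dots> \<le> C0 * ((sqrt (ln (1 + 1 / ?D)) / sqrt (ln 2)) * (2 powr a * ?D powr a))"
    proof (intro mult_left_mono mult_mono C0)
      have "r ^ n \<le> (2 * ?D) powr a" unfolding rn using D2 a by (intro powr_mono2) auto
      then show "r ^ n \<le> 2 powr a * ?D powr a" by (simp add: powr_mult)
      have "real n * ln 2 \<le> - log 2 ?D * ln 2" using n_le by (intro mult_right_mono) auto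
      also have "\<dots> = ln (1 / ?D)" using xy by (simp add: log_def ln_div)
      also have "\<dots> \<le> ln (1 + 1 / ?D)" using xy by (subst ln_le_cancel_iff) (auto intro: add_pos_pos)
      finally have "sqrt (real n * ln 2) \<le> sqrt (ln (1 + 1 / ?D))" by (rule real_sqrt_le_mono)
      then show "sqrt (real n) \<le> sqrt (ln (1 + 1 / ?D)) / sqrt (ln 2)" by (simp add: real_sqrt_mult field_simps)
    qed (use r in auto)
    also have "\<dots> = C * (?D powr a * sqrt (ln (1 + 1 / ?D)))" by (simp add: C_def)
    finally show ?thesis .
  qed
  then show thesis using that[of C "1 / 2 ^ n1"] C0 by (simp add: C_def)
qed

section \<open>Almost sure lower bound\<close>

text \<open>The points \<open>P i\<close> may coincide, whereas a Gaussian field is defined through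
  sets of points; coefficients are therefore summed over the fibres of \<open>P\<close>.\<close>

lemma centered_gaussian_field_combination:
  assumes X: "centered_gaussian_field M S X" and I: "finite I" "\<And>i. i \<in> I \<Longrightarrow> P i \<in> S"
  shows "centered_normal_rv M (\<lambda>\<omega>. \<Sum>i\<in>I. b i * X (P i) \<omega>)"
proof -
  define c where "c p = (\<Sum>i\<in>{i\<in>I. P i = p}. b i)" for p
  have "(\<Sum>i\<in>I. b i * X (P i) \<omega>) = (\<Sum>p\<in>P ` I. c p * X p \<omega>)" for \<omega>
    by (subst sum.image_gen[OF I(1), of _ P]) (auto simp: c_def sum_distrib_right intro!: sum.cong)
  moreover have "centered_normal_rv M (\<lambda>\<omega>. \<Sum>p\<in>P ` I. c p * X p \<omega>)"
    using X I unfolding centered_gaussian_field_def by blast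
  ultimately show ?thesis by simp
qed

text \<open>The Gram bound controls all innovation variances from below, so
  \<open>small_ball\<close> applies. The threshold lies below the order
  \<open>sqrt (2 * n * ln 2)\<close> of an independent maximum: one variable passes it with chance
  at least of order \<open>2 powr (- n / 2)\<close>, hence \<open>2 ^ n\<close> of them all fail
  with a summable, doubly exponentially small probability.\<close>

lemma (in prob_space) AE_dyadic_max_lower:
  fixes Y :: "nat \<Rightarrow> nat \<Rightarrow> 'a \<Rightarrow> real" and s :: "nat \<Rightarrow> real"
  assumes Y: "\<And>n. centered_gaussian_field M UNIV (Y n)"
    and s: "\<forall>\<^sub>F n in sequentially. 0 < s n \<and> (\<forall>F b. finite F \<longrightarrow>
        (s n)\<^sup>2 * (\<Sum>k\<in>F. (b k)\<^sup>2) \<le> expectation (\<lambda>\<omega>. (\<Sum>k\<in>F. b k * Y n k \<omega>)\<^sup>2))"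
  shows "AE \<omega> in M. \<forall>\<^sub>F n in sequentially. \<exists>k<2 ^ n. s n * (sqrt (real n * ln 2) - 1) < \<bar>Y n k \<omega>\<bar>"
proof -
  define A where "A n = {\<omega>\<in>space M. \<forall>k<2 ^ n. \<bar>Y n k \<omega>\<bar> \<le> s n * (sqrt (real n * ln 2) - 1)}" for n
  have Ym[measurable]: "Y n k \<in> borel_measurable M" for n k
    using lincomb_centered_normal[OF Y lincomb_base] by (rule centered_normal_rv_measurable)
  have [measurable]: "A n \<in> sets M" for n unfolding A_def by measurable
  have bound: "\<forall>\<^sub>F n in sequentially. prob (A n) \<le> exp (- (2 powr (real n / 2) / sqrt (2 * pi)))"
    using s eventually_ge_at_top[of 2]
  proof eventually_elim
    case (elim n)
    interpret gaussian_sequence M "Y n" by unfold_locales (rule Y)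
    let ?x = "sqrt (real n * ln 2) - 1"
    \<comment> \<open>For \<open>n \<ge> 2\<close> the threshold is nonnegative, as
      \<open>small_ball\<close> requires.\<close>
    have "exp 1 \<le> (2::real) ^ 2" using exp_le by simp
    then have "1 \<le> ln ((2::real) ^ 2)" by (subst ln_ge_iff) auto
    then have "1 \<le> 2 * ln (2::real)" by (subst (asm) ln_realpow) auto
    also have "\<dots> \<le> real n * ln 2" using elim by (intro mult_right_mono) auto
    finally have x: "0 \<le> ?x" by simp
    have "(s n)\<^sup>2 \<le> v k" for k
    proof (rule v_lower)
      fix W assume "W \<in> lincomb (\<lambda>i \<omega>. if i < k then Y n i \<omega> else 0)"
      then obtain F c where F: "finite F" and W: "W = (\<lambda>\<omega>. \<Sum>i\<in>F. c i * (if i < k then Y n i \<omega> else 0))"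
        unfolding lincomb_def by auto
      define G where "G = F \<inter> {..<k}"
      \<comment> \<open>A prediction error has coefficient 1 at \<open>k\<close>, so its squared
        coefficients sum to at least 1 and the Gram bound yields
        \<open>(s n)\<^sup>2\<close>.\<close>
      define b where "b i = (if i = k then 1 else - c i)" for i
      have G: "finite G" "k \<notin> G" using F by (auto simp: G_def)
      have "Y n k \<omega> - W \<omega> = (\<Sum>i\<in>insert k G. b i * Y n i \<omega>)" for \<omega>
      proof -
        have "W \<omega> = (\<Sum>i\<in>G. c i * Y n i \<omega>)"
          unfolding W G_def using F by (intro sum.mono_neutral_cong_right) auto
        moreover have "(\<Sum>i\<in>G. b i * Y n i \<omega>) = - (\<Sum>i\<in>G. c i * Y n i \<omega>)"
          unfolding sum_negf[symmetric] using G by (intro sum.cong) (auto simp: b_def)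
        ultimately show ?thesis using G by (simp add: b_def)
      qed
      then have "expectation (\<lambda>\<omega>. (Y n k \<omega> - W \<omega>)\<^sup>2) = expectation (\<lambda>\<omega>. (\<Sum>i\<in>insert k G. b i * Y n i \<omega>)\<^sup>2)"
        by simp
      also have "\<dots> \<ge> (s n)\<^sup>2 * (\<Sum>i\<in>insert k G. (b i)\<^sup>2)" using elim G by blast
      finally have "(s n)\<^sup>2 * (\<Sum>i\<in>insert k G. (b i)\<^sup>2) \<le> expectation (\<lambda>\<omega>. (Y n k \<omega> - W \<omega>)\<^sup>2)" .
      moreover have "(s n)\<^sup>2 * 1 \<le> (s n)\<^sup>2 * (\<Sum>i\<in>insert k G. (b i)\<^sup>2)"
        using G by (intro mult_left_mono) (auto simp: b_def sum_nonneg)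
      ultimately show "(s n)\<^sup>2 \<le> expectation (\<lambda>\<omega>. (Y n k \<omega> - W \<omega>)\<^sup>2)" by simp
    qed
    then have "prob (A n) \<le> (1 - std_normal_density (s n * ?x / s n + 1)) ^ (2 ^ n)"
      unfolding A_def using elim x by (intro small_ball) auto
    \<comment> \<open>The 1 subtracted in the threshold is there to cancel the \<open>+ 1\<close> of
      the lower tail bound.\<close>
    also have "s n * ?x / s n + 1 = sqrt (real n * ln 2)" using elim by simp
    also have "std_normal_density (sqrt (real n * ln 2)) = 2 powr (- (real n / 2)) / sqrt (2 * pi)"
      by (simp add: std_normal_density_def powr_def)
    also have "(1 - \<dots>) ^ (2 ^ n) \<le> exp (- (2 powr (- (real n / 2)) / sqrt (2 * pi))) ^ (2 ^ n)"
    proof (rule power_mono)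
      show "1 - 2 powr (- (real n / 2)) / sqrt (2 * pi) \<le> exp (- (2 powr (- (real n / 2)) / sqrt (2 * pi)))"
        using exp_ge_add_one_self[of "- (2 powr (- (real n / 2)) / sqrt (2 * pi))"] by simp
      have "2 powr (- (real n / 2)) \<le> 1" using powr_mono[of "- (real n / 2)" 0 2] by simp
      moreover have "1 \<le> sqrt (2 * pi)" using pi_gt3 by simp
      ultimately have "2 powr (- (real n / 2)) \<le> sqrt (2 * pi)" by linarith
      then show "0 \<le> 1 - 2 powr (- (real n / 2)) / sqrt (2 * pi)"
        using divide_le_eq_1_pos[of "sqrt (2 * pi)" "2 powr (- (real n / 2))"] by simp
    qed
    also have "\<dots> = exp (- (2 powr (real n / 2) / sqrt (2 * pi)))"
    proof -
      have "(2::real) ^ n = 2 powr (real n / 2) * 2 powr (real n / 2)"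
        by (simp add: powr_add[symmetric] powr_realpow)
      then have "real (2 ^ n) * - (2 powr (- (real n / 2)) / sqrt (2 * pi)) = - (2 powr (real n / 2) / sqrt (2 * pi))"
        by (simp add: powr_minus field_simps)
      then show ?thesis by (simp only: exp_of_nat_mult[symmetric])
    qed
    finally show ?case .
  qed
  have "summable (\<lambda>n. exp (- (2 powr (real n / 2) / sqrt (2 * pi))))"
  proof (rule summable_comparison_test_bigo)
    show "summable (\<lambda>n. norm ((1/2) ^ n :: real))" by (simp add: summable_geometric)
    have "sqrt (2 * pi) > 0" by simp
    then show "(\<lambda>n. exp (- (2 powr (real n / 2) / sqrt (2 * pi)))) \<in> O(\<lambda>n. (1/2) ^ n)" by real_asymp
  qed
  then have "summable (\<lambda>n. prob (A n))"
    by (rule summable_comparison_test_ev[rotated]) (use bound in \<open>auto elim: eventually_mono\<close>)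
  then have "AE \<omega> in M. \<forall>\<^sub>F n in sequentially. \<omega> \<in> space M - A n"
    by (intro borel_cantelli_AE1) (auto simp: emeasure_eq_measure)
  then show ?thesis
  proof eventually_elim
    case (elim \<omega>)
    then show ?case by eventually_elim (auto simp: A_def not_le)
  qed
qed

context wave_field begin

lemma increment_variance_upper:
  assumes "0 < T"
  obtains K where "K > 0"
    "\<And>t x s y. 0 \<le> t \<Longrightarrow> t \<le> T \<Longrightarrow> 0 \<le> s \<Longrightarrow> s \<le> T \<Longrightarrow>
      expectation (\<lambda>\<omega>. (X t x \<omega> - X s y \<omega>)\<^sup>2) \<le> K * pdist t x s y powr (2 * \<alpha>)"
proof -
  obtain K where "K > 0" and K: "\<And>t x s y. 0 \<le> t \<Longrightarrow> t \<le> T \<Longrightarrow> 0 \<le> s \<Longrightarrow> s \<le> T \<Longrightarrow>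
      energy (\<lambda>\<tau> \<xi>. Fg t x \<tau> \<xi> - Fg s y \<tau> \<xi>)
        \<le> ennreal (K * pdist t x s y powr (2 * \<alpha>))"
    by (rule energy_Fg_diff[OF assms]) (rule that)
  have "expectation (\<lambda>\<omega>. (X t x \<omega> - X s y \<omega>)\<^sup>2) \<le> cH * K * pdist t x s y powr (2 * \<alpha>)"
    if "0 \<le> t" "t \<le> T" "0 \<le> s" "s \<le> T" for t x s y
  proof -
    have "ennreal (expectation (\<lambda>\<omega>. (X t x \<omega> - X s y \<omega>)\<^sup>2))
      = ennreal cH * energy (\<lambda>\<tau> \<xi>. Fg t x \<tau> \<xi> - Fg s y \<tau> \<xi>)"
      using variance_spectral[of "UNIV :: bool set" "\<lambda>i. if i then t else s" "\<lambda>i. if i then 1 else -1" "\<lambda>i. if i then x else y"] that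
      by (simp add: UNIV_bool)
    also have "\<dots> \<le> ennreal cH * ennreal (K * pdist t x s y powr (2 * \<alpha>))"
      by (intro mult_left_mono K that) auto
    also have "\<dots> = ennreal (cH * K * pdist t x s y powr (2 * \<alpha>))"
      using cH by (simp add: ennreal_mult'[symmetric] mult.assoc)
    finally show ?thesis using cH \<open>K > 0\<close> by (subst (asm) ennreal_le_iff) auto
  qed
  then show thesis using that[of "cH * K"] cH \<open>K > 0\<close> by simp
qed

lemma gram_lower:
  assumes t: "0 < t" and e: "e \<in> Basis"
  obtains c \<delta>0 where "0 < c" "0 < \<delta>0"
    "\<And>\<delta> F b. 0 < \<delta> \<Longrightarrow> \<delta> \<le> \<delta>0 \<Longrightarrow> finite F \<Longrightarrow>
      c * \<delta> powr (2 * \<alpha>) * (\<Sum>k\<in>F. (b k)\<^sup>2) \<le>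
      expectation (\<lambda>\<omega>. (\<Sum>k\<in>F. b k * spaced_diff (\<lambda>x. X t x \<omega>) x0 e \<delta> k)\<^sup>2)"
proof -
  let ?z = "\<lambda>\<delta> i. if snd i then x0 + (4 * real (fst i) * \<delta> + \<delta>) *\<^sub>R e else x0 + (4 * real (fst i) * \<delta>) *\<^sub>R e"
  obtain c \<delta>0 where c: "0 < c" "0 < \<delta>0" and low: "\<And>\<delta> F b. 0 < \<delta> \<Longrightarrow> \<delta> \<le> \<delta>0 \<Longrightarrow> finite F \<Longrightarrow>
      ennreal (c * \<delta> powr (2 * \<alpha>) * (\<Sum>k\<in>F. (b k)\<^sup>2)) \<le>
      energy (\<lambda>\<tau> \<xi>. \<Sum>k\<in>F. complex_of_real (b k) * spaced_diff (\<lambda>x. Fg t x \<tau> \<xi>) x0 e \<delta> k)"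
    by (rule energy_spaced_diff_lower[OF t e, of x0]) (rule that)
  have "cH * c * \<delta> powr (2 * \<alpha>) * (\<Sum>k\<in>F. (b k)\<^sup>2) \<le>
      expectation (\<lambda>\<omega>. (\<Sum>k\<in>F. b k * spaced_diff (\<lambda>x. X t x \<omega>) x0 e \<delta> k)\<^sup>2)"
    if d: "0 < \<delta>" "\<delta> \<le> \<delta>0" and F: "finite F" for \<delta> F b
  proof -
    have split: "(\<Sum>i\<in>F \<times> UNIV. g i) = (\<Sum>k\<in>F. g (k, True) + g (k, False))" for g :: "nat \<times> bool \<Rightarrow> 'z::comm_monoid_add"
      by (simp add: sum.cartesian_product[symmetric, of "\<lambda>x y. g (x, y)", simplified] UNIV_bool add.commute)
    have "ennreal (cH * c * \<delta> powr (2 * \<alpha>) * (\<Sum>k\<in>F. (b k)\<^sup>2)) = ennreal cH * ennreal (c * \<delta> powr (2 * \<alpha>) * (\<Sum>k\<in>F. (b k)\<^sup>2))"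
      using cH by (simp add: ennreal_mult'[symmetric] mult.assoc)
    also have "\<dots> \<le> ennreal cH * energy (\<lambda>\<tau> \<xi>. \<Sum>k\<in>F. complex_of_real (b k) * spaced_diff (\<lambda>x. Fg t x \<tau> \<xi>) x0 e \<delta> k)"
      by (intro mult_left_mono low d F) auto
    also have "\<dots> = ennreal (expectation (\<lambda>\<omega>. (\<Sum>k\<in>F. b k * spaced_diff (\<lambda>x. X t x \<omega>) x0 e \<delta> k)\<^sup>2))"
      using variance_spectral[of "F \<times> UNIV" "\<lambda>_. t" "\<lambda>i. if snd i then b (fst i) else - b (fst i)" "?z \<delta>"] t
      by (simp add: split right_diff_distrib)
    finally show ?thesis by (subst (asm) ennreal_le_iff) auto
  qed
  then show thesis using that[of "cH * c" \<delta>0] cH c by simp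
qed

text \<open>Increments over the segments \<open>x0 + [4 k \<delta>, 4 k \<delta> + \<delta>] e\<close> have a Gram matrix bounded below,
  so the maximum of \<open>2 ^ n\<close> of them exceeds the standard deviation by a factor of order \<open>sqrt n\<close>.\<close>
lemma AE_modulus_lower:
  assumes t: "0 < t" and e: "e \<in> Basis" and l: "0 < l"
  obtains c where "0 < c"
    "AE \<omega> in M. \<forall>\<eta>>0. \<exists>a \<delta>. 0 \<le> a \<and> a + \<delta> \<le> l \<and> 0 < \<delta> \<and> \<delta> \<le> \<eta> \<and>
       c * (\<delta> powr \<alpha> * sqrt (ln (1 + 1 / \<delta>))) \<le> \<bar>X t (x0 + (a + \<delta>) *\<^sub>R e) \<omega> - X t (x0 + a *\<^sub>R e) \<omega>\<bar>"
proof -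
  obtain c \<delta>0 where c: "0 < c" "0 < \<delta>0" and low: "\<And>\<delta> F b. 0 < \<delta> \<Longrightarrow> \<delta> \<le> \<delta>0 \<Longrightarrow> finite F \<Longrightarrow>
      c * \<delta> powr (2 * \<alpha>) * (\<Sum>k\<in>F. (b k)\<^sup>2) \<le>
      expectation (\<lambda>\<omega>. (\<Sum>k\<in>F. b k * spaced_diff (\<lambda>x. X t x \<omega>) x0 e \<delta> k)\<^sup>2)"
    by (rule gram_lower[OF t e, of x0]) (rule that)
  \<comment> \<open>Chosen so that the \<open>2 ^ n\<close> segments starting at
    \<open>4 * k * \<delta> n\<close> fit into \<open>[0, l]\<close>: the last one ends before
    \<open>5 * 2 ^ n * \<delta> n = l\<close>.\<close>
  define \<delta> where "\<delta> n = l / (5 * 2 ^ n)" for n :: nat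
  define Y where "Y n k \<omega> = X t (x0 + (4 * real k * \<delta> n + \<delta> n) *\<^sub>R e) \<omega> - X t (x0 + (4 * real k * \<delta> n) *\<^sub>R e) \<omega>" for n k \<omega>
  define s where "s n = sqrt c * \<delta> n powr \<alpha>" for n
  have dpos: "0 < \<delta> n" for n using l by (simp add: \<delta>_def)
  have dlim: "\<delta> \<longlonglongrightarrow> 0" unfolding \<delta>_def using l by real_asymp
  have spos: "0 < s n" for n unfolding s_def using c dpos[of n] by simp
  have s2: "(s n)\<^sup>2 = c * \<delta> n powr (2 * \<alpha>)" for n
    unfolding s_def power_mult_distrib using c dpos[of n] by (simp add: powr_power mult.commute)
  have gauss: "centered_gaussian_field M UNIV (Y n)" for n
    unfolding centered_gaussian_field_def
  proof (intro allI impI)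
    fix F :: "nat set" and b :: "nat \<Rightarrow> real" assume "finite F \<and> F \<subseteq> UNIV"
    then have F: "finite F" by simp
    have split: "(\<Sum>i\<in>F \<times> UNIV. g i) = (\<Sum>k\<in>F. g (k, True) + g (k, False))" for g :: "nat \<times> bool \<Rightarrow> real"
      by (simp add: sum.cartesian_product[symmetric, of "\<lambda>x y. g (x, y)", simplified] UNIV_bool add.commute)
    have "centered_normal_rv M (\<lambda>\<omega>. \<Sum>i\<in>F \<times> UNIV. (if snd i then b (fst i) else - b (fst i)) *
        (\<lambda>p. X (fst p) (snd p)) (t, if snd i then x0 + (4 * real (fst i) * \<delta> n + \<delta> n) *\<^sub>R e else x0 + (4 * real (fst i) * \<delta> n) *\<^sub>R e) \<omega>)"
      by (rule centered_gaussian_field_combination[OF X_gaussian]) (use F t in auto)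
    then show "centered_normal_rv M (\<lambda>\<omega>. \<Sum>k\<in>F. b k * Y n k \<omega>)"
      by (simp add: split Y_def right_diff_distrib)
  qed
  have "\<forall>\<^sub>F n in sequentially. \<delta> n < \<delta>0"
    using order_tendstoD(2)[OF dlim c(2)] .
  then have "\<forall>\<^sub>F n in sequentially. 0 < s n \<and> (\<forall>F b. finite F \<longrightarrow>
        (s n)\<^sup>2 * (\<Sum>k\<in>F. (b k)\<^sup>2) \<le> expectation (\<lambda>\<omega>. (\<Sum>k\<in>F. b k * Y n k \<omega>)\<^sup>2))"
    by eventually_elim (auto simp: spos s2 Y_def intro!: low dpos)
  from AE_dyadic_max_lower[OF gauss this]
  have "AE \<omega> in M. \<forall>\<eta>>0. \<exists>a \<delta>. 0 \<le> a \<and> a + \<delta> \<le> l \<and> 0 < \<delta> \<and> \<delta> \<le> \<eta> \<and>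
       (sqrt c / 2) * (\<delta> powr \<alpha> * sqrt (ln (1 + 1 / \<delta>))) \<le> \<bar>X t (x0 + (a + \<delta>) *\<^sub>R e) \<omega> - X t (x0 + a *\<^sub>R e) \<omega>\<bar>"
  proof eventually_elim
    case (elim \<omega>)
    show ?case
    proof (intro allI impI)
      fix \<eta> :: real assume "\<eta> > 0"
      from order_tendstoD(2)[OF dlim this] have "\<forall>\<^sub>F n in sequentially. \<delta> n < \<eta>" .
      \<comment> \<open>\<open>ln (1 / \<delta> n)\<close> grows like \<open>n * ln 2\<close>, so
        the factor 1/2 absorbs the subtracted 1 and all lower-order terms.\<close>
      moreover have "\<forall>\<^sub>F n in sequentially. sqrt (ln (1 + 1 / \<delta> n)) / 2 \<le> sqrt (real n * ln 2) - 1"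
        unfolding \<delta>_def using l by real_asymp
      ultimately have "\<forall>\<^sub>F n in sequentially. \<delta> n < \<eta> \<and> sqrt (ln (1 + 1 / \<delta> n)) / 2 \<le> sqrt (real n * ln 2) - 1
          \<and> (\<exists>k<2 ^ n. s n * (sqrt (real n * ln 2) - 1) < \<bar>Y n k \<omega>\<bar>)"
        using elim by eventually_elim auto
      from eventually_happens[OF this] obtain n k where n: "\<delta> n < \<eta>" "sqrt (ln (1 + 1 / \<delta> n)) / 2 \<le> sqrt (real n * ln 2) - 1"
        "k < 2 ^ n" "s n * (sqrt (real n * ln 2) - 1) < \<bar>Y n k \<omega>\<bar>" by auto
      have "(sqrt c / 2) * (\<delta> n powr \<alpha> * sqrt (ln (1 + 1 / \<delta> n))) = s n * (sqrt (ln (1 + 1 / \<delta> n)) / 2)"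
        by (simp add: s_def)
      also have "\<dots> \<le> s n * (sqrt (real n * ln 2) - 1)" using spos[of n] n by (intro mult_left_mono) auto
      also have "\<dots> \<le> \<bar>Y n k \<omega>\<bar>" using n by simp
      finally have "(sqrt c / 2) * (\<delta> n powr \<alpha> * sqrt (ln (1 + 1 / \<delta> n))) \<le> \<bar>Y n k \<omega>\<bar>" .
      moreover have "4 * real k * \<delta> n + \<delta> n \<le> l"
      proof -
        have "real k + 1 \<le> 2 ^ n" using n(3) by (metis Suc_eq_plus1 Suc_leI of_nat_1 of_nat_add of_nat_le_iff of_nat_numeral of_nat_power)
        then have "4 * real k + 1 \<le> 5 * 2 ^ n" by linarith
        then have "(4 * real k + 1) * \<delta> n \<le> (5 * 2 ^ n) * \<delta> n" using dpos[of n] by (intro mult_right_mono) auto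
        also have "\<dots> = l" by (simp add: \<delta>_def)
        finally show ?thesis by (simp add: algebra_simps)
      qed
      ultimately show "\<exists>a \<delta>. 0 \<le> a \<and> a + \<delta> \<le> l \<and> 0 < \<delta> \<and> \<delta> \<le> \<eta> \<and>
       (sqrt c / 2) * (\<delta> powr \<alpha> * sqrt (ln (1 + 1 / \<delta>))) \<le> \<bar>X t (x0 + (a + \<delta>) *\<^sub>R e) \<omega> - X t (x0 + a *\<^sub>R e) \<omega>\<bar>"
        using dpos[of n] n(1) by (intro exI[of _ "4 * real k * \<delta> n"] exI[of _ "\<delta> n"]) (auto simp: Y_def)
    qed
  qed
  then show thesis using that[of "sqrt c / 2"] c by simp
qed

end

section \<open>Almost sure upper bound\<close>

lemma pdist_norm:
  "norm ((t, x) - (s, y)) \<le> pdist t x s y" "pdist t x s y \<le> 2 * norm ((t, x) - (s, y))"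
proof -
  show "norm ((t, x) - (s, y)) \<le> pdist t x s y"
    using norm_Pair_le[of "t - s" "x - y"] by (simp add: pdist_def)
  show "pdist t x s y \<le> 2 * norm ((t, x) - (s, y))"
    using norm_fst_le[of "t - s" "x - y"] norm_snd_le[of "x - y" "t - s"] by (simp add: pdist_def)
qed

context wave_field begin

lemma alpha_pos: "0 < \<alpha>"
  using \<beta>H by (simp add: alpha_eq)

lemma AE_modulus_upper:
  assumes t: "0 \<le> t0" "0 < t1"
    and cont: "\<And>\<omega>. \<omega> \<in> space M \<Longrightarrow> continuous_on ({0..} \<times> UNIV) (\<lambda>p. X (fst p) (snd p) \<omega>)"
  shows "AE \<omega> in M. \<exists>C \<delta>. 0 \<le> C \<and> 0 < \<delta> \<and> (\<forall>p\<in>{t0..t1} \<times> cbox x0 x1. \<forall>q\<in>{t0..t1} \<times> cbox x0 x1.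
     0 < norm (p - q) \<and> norm (p - q) \<le> \<delta> \<longrightarrow>
      \<bar>X (fst p) (snd p) \<omega> - X (fst q) (snd q) \<omega>\<bar> \<le> C * (norm (p - q) powr \<alpha> * sqrt (ln (1 + 1 / norm (p - q)))))"
proof -
  let ?S = "{t0..t1} \<times> cbox x0 x1"
  obtain K where K: "K > 0" "\<And>t x s y. 0 \<le> t \<Longrightarrow> t \<le> t1 \<Longrightarrow> 0 \<le> s \<Longrightarrow> s \<le> t1 \<Longrightarrow>
      expectation (\<lambda>\<omega>. (X t x \<omega> - X s y \<omega>)\<^sup>2) \<le> K * pdist t x s y powr (2 * \<alpha>)"
    by (rule increment_variance_upper[OF t(2)]) (rule that)
  define \<sigma> where "\<sigma> = sqrt K * 2 powr \<alpha>"
  have bnd: "bounded ?S" by (intro bounded_Times bounded_closed_interval bounded_cbox)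
  \<comment> \<open>The variance bound is uniform in space, so rounded points may leave the box
    there; only their times must remain in \<open>[0, t1]\<close>.\<close>
  have fst_dyadic: "0 \<le> fst (dyadic n p)" "fst (dyadic n p) \<le> t1" if "p \<in> ?S" for n p
  proof -
    have "fst (dyadic n p) = dyadic n p \<bullet> (1, 0)" by (simp add: inner_prod_def)
    also have "\<dots> = of_int \<lfloor>2 ^ n * (p \<bullet> (1, 0))\<rfloor> / 2 ^ n" by (rule dyadic_inner) (simp add: Basis_prod_def)
    also have "p \<bullet> (1, 0) = fst p" by (simp add: inner_prod_def)
    finally have eq: "fst (dyadic n p) = of_int \<lfloor>2 ^ n * fst p\<rfloor> / 2 ^ n" .
    have p: "0 \<le> fst p" "fst p \<le> t1" using that t by auto
    have "0 \<le> 2 ^ n * fst p" using p by simp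
    then show "0 \<le> fst (dyadic n p)" unfolding eq by simp
    have "of_int \<lfloor>2 ^ n * fst p\<rfloor> / 2 ^ n \<le> (2 ^ n * fst p) / 2 ^ n" by (intro divide_right_mono) auto
    then show "fst (dyadic n p) \<le> t1" unfolding eq using p by simp
  qed
  have d2: "0 \<le> fst p \<and> fst p \<le> t1" if "p \<in> dyadic2 n ?S" for n p
    using that fst_dyadic by auto
  have norm_diff: "centered_normal_rv M (\<lambda>\<omega>. X (fst p) (snd p) \<omega> - X (fst q) (snd q) \<omega>)"
    if "0 \<le> fst p" "0 \<le> fst q" for p q
  proof -
    have "centered_normal_rv M (\<lambda>\<omega>. \<Sum>i\<in>UNIV. (if i then 1 else -1) * (\<lambda>p. X (fst p) (snd p)) (if i then p else q) \<omega>)"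
      by (rule centered_gaussian_field_combination[OF X_gaussian]) (use that in \<open>auto simp: mem_Times_iff\<close>)
    then show ?thesis by (simp add: UNIV_bool)
  qed
  obtain C where C: "0 \<le> C" "AE \<omega> in M. \<forall>\<^sub>F n in sequentially. \<forall>p\<in>dyadic2 n ?S. \<forall>q\<in>dyadic2 n ?S.
      \<bar>X (fst p) (snd p) \<omega> - X (fst q) (snd q) \<omega>\<bar> \<le> C * sqrt (real n) * norm (p - q) powr \<alpha>"
  proof (rule AE_dyadic_increments_bounded[OF bnd, where \<sigma>=\<sigma> and X="\<lambda>p. X (fst p) (snd p)" and a=\<alpha>])
    show "0 < \<sigma>" using K by (simp add: \<sigma>_def)
    fix n p q assume p: "p \<in> dyadic2 n ?S" and q: "q \<in> dyadic2 n ?S"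
    show "centered_normal_rv M (\<lambda>\<omega>. X (fst p) (snd p) \<omega> - X (fst q) (snd q) \<omega>)"
      using d2[OF p] d2[OF q] by (intro norm_diff) auto
    let ?D = "pdist (fst p) (snd p) (fst q) (snd q)"
    have D: "0 \<le> ?D" "?D \<le> 2 * norm (p - q)" using pdist_norm(2)[of "fst p" "snd p" "fst q" "snd q"] by (auto simp: pdist_def)
    have "expectation (\<lambda>\<omega>. (X (fst p) (snd p) \<omega> - X (fst q) (snd q) \<omega>)\<^sup>2) \<le> K * ?D powr (2 * \<alpha>)"
      using d2[OF p] d2[OF q] by (intro K) auto
    also have "\<dots> \<le> K * (2 * norm (p - q)) powr (2 * \<alpha>)"
      using D K alpha_pos by (intro mult_left_mono powr_mono2) auto
    also have "\<dots> = (\<sigma> * norm (p - q) powr \<alpha>)\<^sup>2"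
    proof -
      have "z powr (2 * \<alpha>) = (z powr \<alpha>)\<^sup>2" for z :: real by (simp add: power2_eq_square powr_add[symmetric])
      then show ?thesis using K(1) by (simp add: \<sigma>_def power_mult_distrib powr_mult)
    qed
    finally show "expectation (\<lambda>\<omega>. (X (fst p) (snd p) \<omega> - X (fst q) (snd q) \<omega>)\<^sup>2) \<le> (\<sigma> * norm (p - q) powr \<alpha>)\<^sup>2" .
  qed (rule that)
  from C(2) AE_space show ?thesis
  proof eventually_elim
    case (elim \<omega>)
    then obtain n0 where n0: "\<And>n p q. n0 \<le> n \<Longrightarrow> p \<in> dyadic2 n ?S \<Longrightarrow> q \<in> dyadic2 n ?S \<Longrightarrow>
      \<bar>X (fst p) (snd p) \<omega> - X (fst q) (snd q) \<omega>\<bar> \<le> C * sqrt (real n) * norm (p - q) powr \<alpha>"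
      unfolding eventually_sequentially by blast
    \<comment> \<open>The approximating points need not lie in \<open>?S\<close>, hence continuity
      on all nonnegative times is invoked.\<close>
    have lim: "(\<lambda>n. X (fst (dyadic n p)) (snd (dyadic n p)) \<omega>) \<longlonglongrightarrow> X (fst p) (snd p) \<omega>" if p: "p \<in> ?S" for p
    proof -
      have "((\<lambda>n. (\<lambda>p. X (fst p) (snd p) \<omega>) (dyadic n p)) \<longlongrightarrow> (\<lambda>p. X (fst p) (snd p) \<omega>) p) sequentially"
        by (rule continuous_on_tendsto_compose[OF cont[OF elim(2)] dyadic_tendsto])
           (use p t fst_dyadic[OF p] in \<open>auto simp: mem_Times_iff\<close>)
      then show ?thesis by simp
    qed
    obtain C' \<delta> where "0 \<le> C'" "0 < \<delta>" "\<And>p q. p \<in> ?S \<Longrightarrow> q \<in> ?S \<Longrightarrow> 0 < norm (p - q) \<Longrightarrow> norm (p - q) \<le> \<delta> \<Longrightarrow>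
      \<bar>X (fst p) (snd p) \<omega> - X (fst q) (snd q) \<omega>\<bar> \<le> C' * (norm (p - q) powr \<alpha> * sqrt (ln (1 + 1 / norm (p - q))))"
    proof (rule dyadic_chaining[OF alpha_pos C(1), where f="\<lambda>p. X (fst p) (snd p) \<omega>" and S="?S" and ?n0.0=n0])
      show "\<bar>X (fst p) (snd p) \<omega> - X (fst q) (snd q) \<omega>\<bar> \<le> C * sqrt (real n) * norm (p - q) powr \<alpha>"
        if "n0 \<le> n" "p \<in> dyadic2 n ?S" "q \<in> dyadic2 n ?S" for n p q using n0 that .
    qed (rule lim, assumption, rule that)
    then show ?case by (intro exI[of _ C'] exI[of _ \<delta>]) blast
  qed
qed

text \<open>Cauchy-Schwarz enters as
  \<open>\<bar>U * Z\<bar> \<le> U\<^sup>2 / r + r * Z\<^sup>2\<close> with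
  \<open>r = pdist t x s y powr \<alpha>\<close>. The increment \<open>U\<close> has second moment
  of order \<open>r\<^sup>2\<close>, so both terms are of order \<open>r\<close>.\<close>

lemma covariance_modulus:
  assumes T: "0 < T" and Z[measurable]: "Z \<in> borel_measurable M" and Z2: "integrable M (\<lambda>\<omega>. (Z \<omega>)\<^sup>2)"
  obtains B where "0 \<le> B" "\<And>t x s y. 0 \<le> t \<Longrightarrow> t \<le> T \<Longrightarrow> 0 \<le> s \<Longrightarrow> s \<le> T \<Longrightarrow>
     \<bar>expectation (\<lambda>\<omega>. X t x \<omega> * Z \<omega>) - expectation (\<lambda>\<omega>. X s y \<omega> * Z \<omega>)\<bar> \<le> B * pdist t x s y powr \<alpha>"
proof -
  obtain K where K: "K > 0" "\<And>t x s y. 0 \<le> t \<Longrightarrow> t \<le> T \<Longrightarrow> 0 \<le> s \<Longrightarrow> s \<le> T \<Longrightarrow>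
      expectation (\<lambda>\<omega>. (X t x \<omega> - X s y \<omega>)\<^sup>2) \<le> K * pdist t x s y powr (2 * \<alpha>)"
    by (rule increment_variance_upper[OF T]) (rule that)
  define B where "B = K + expectation (\<lambda>\<omega>. (Z \<omega>)\<^sup>2)"
  have B: "0 \<le> B" unfolding B_def using K by (simp add: integral_nonneg_AE)
  have "\<bar>expectation (\<lambda>\<omega>. X t x \<omega> * Z \<omega>) - expectation (\<lambda>\<omega>. X s y \<omega> * Z \<omega>)\<bar> \<le> B * pdist t x s y powr \<alpha>"
    if ts: "0 \<le> t" "t \<le> T" "0 \<le> s" "s \<le> T" for t x s y
  proof (cases "pdist t x s y = 0")
    case True
    then have "t = s \<and> x = y" unfolding pdist_def
      by (smt (verit) norm_ge_zero norm_eq_zero right_minus_eq)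
    then show ?thesis using B by simp
  next
    case False
    define r where "r = pdist t x s y powr \<alpha>"
    have r: "0 < r" using False by (simp add: r_def pdist_def add_nonneg_nonneg less_le)
    have r2: "pdist t x s y powr (2 * \<alpha>) = r\<^sup>2" by (simp add: r_def power2_eq_square powr_add[symmetric])
    define U where "U \<omega> = X t x \<omega> - X s y \<omega>" for \<omega>
    have [measurable]: "U \<in> borel_measurable M" unfolding U_def using ts by (intro borel_measurable_diff X_measurable)
    have XZ: "integrable M (\<lambda>\<omega>. X t x \<omega> * Z \<omega>)" "integrable M (\<lambda>\<omega>. X s y \<omega> * Z \<omega>)"
      using ts by (auto intro!: integrable_mult_of_squares X_measurable centered_normal_rv_square_integrable X_normal Z2)
    have U2: "integrable M (\<lambda>\<omega>. (U \<omega>)\<^sup>2)"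
    proof -
      have "(U \<omega>)\<^sup>2 = X t x \<omega> * X t x \<omega> - 2 * (X t x \<omega> * X s y \<omega>) + X s y \<omega> * X s y \<omega>" for \<omega>
        by (simp add: U_def power2_eq_square algebra_simps)
      then show ?thesis using ts by (simp add: X_integrable_mult)
    qed
    have "expectation (\<lambda>\<omega>. X t x \<omega> * Z \<omega>) - expectation (\<lambda>\<omega>. X s y \<omega> * Z \<omega>) = expectation (\<lambda>\<omega>. U \<omega> * Z \<omega>)"
      using XZ by (simp add: U_def left_diff_distrib)
    also have "\<bar>\<dots>\<bar> \<le> expectation (\<lambda>\<omega>. \<bar>U \<omega> * Z \<omega>\<bar>)" by (rule integral_abs_bound)
    also have "\<dots> \<le> expectation (\<lambda>\<omega>. (1 / r) * (U \<omega>)\<^sup>2 + r * (Z \<omega>)\<^sup>2)"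
    proof (rule integral_mono)
      show "integrable M (\<lambda>\<omega>. \<bar>U \<omega> * Z \<omega>\<bar>)" by (intro integrable_abs integrable_mult_of_squares U2 Z2) auto
      show "integrable M (\<lambda>\<omega>. (1 / r) * (U \<omega>)\<^sup>2 + r * (Z \<omega>)\<^sup>2)" using U2 Z2 by simp
      fix \<omega>
      have "r * \<bar>U \<omega> * Z \<omega>\<bar> \<le> (U \<omega>)\<^sup>2 + (r * Z \<omega>)\<^sup>2"
      proof -
        have "r * \<bar>U \<omega> * Z \<omega>\<bar> = \<bar>U \<omega>\<bar> * \<bar>r * Z \<omega>\<bar>" using r by (simp add: abs_mult)
        moreover have "2 * \<bar>U \<omega>\<bar> * \<bar>r * Z \<omega>\<bar> \<le> (U \<omega>)\<^sup>2 + (r * Z \<omega>)\<^sup>2"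
          using sum_squares_bound[of "\<bar>U \<omega>\<bar>" "\<bar>r * Z \<omega>\<bar>"] by (simp only: power2_abs)
        moreover have "0 \<le> \<bar>U \<omega>\<bar> * \<bar>r * Z \<omega>\<bar>" by simp
        ultimately show ?thesis by linarith
      qed
      also have "\<dots> = r * ((1 / r) * (U \<omega>)\<^sup>2 + r * (Z \<omega>)\<^sup>2)" using r by (simp add: power2_eq_square field_simps)
      finally show "\<bar>U \<omega> * Z \<omega>\<bar> \<le> (1 / r) * (U \<omega>)\<^sup>2 + r * (Z \<omega>)\<^sup>2" using r by (simp only: mult_le_cancel_left_pos)
    qed
    also have "\<dots> = (1 / r) * expectation (\<lambda>\<omega>. (U \<omega>)\<^sup>2) + r * expectation (\<lambda>\<omega>. (Z \<omega>)\<^sup>2)"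
      using U2 Z2 by simp
    also have "(1 / r) * expectation (\<lambda>\<omega>. (U \<omega>)\<^sup>2) \<le> (1 / r) * (K * r\<^sup>2)"
      using K(2)[OF ts, of x y] r unfolding U_def r2 by (intro mult_left_mono) auto
    also have "(1 / r) * (K * r\<^sup>2) + r * expectation (\<lambda>\<omega>. (Z \<omega>)\<^sup>2) = B * r"
      using r by (simp add: B_def power2_eq_square algebra_simps)
    finally show ?thesis by (simp add: r_def)
  qed
  with B that show thesis by blast
qed

end

section \<open>Joint Gaussianity of independent components\<close>

context prob_space begin

lemma centered_normal_rv_cong_AE:
  assumes "centered_normal_rv M X" "Y \<in> borel_measurable M" "AE \<omega> in M. X \<omega> = Y \<omega>"
  shows "centered_normal_rv M Y"
proof -
  have X: "X \<in> borel_measurable M" by (rule centered_normal_rv_measurable[OF assms(1)])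
  from assms(1) consider "AE \<omega> in M. X \<omega> = 0"
    | \<sigma> where "\<sigma> > 0" "distributed M lborel X (normal_density 0 \<sigma>)"
    unfolding centered_normal_rv_def by blast
  then show ?thesis
  proof cases
    case 1
    with assms(3) have "AE \<omega> in M. Y \<omega> = 0" by eventually_elim simp
    then show ?thesis using assms(2) by (simp add: centered_normal_rv_def)
  next
    case (2 \<sigma>)
    have "distr M lborel Y = distr M lborel X"
      using assms X by (intro distr_cong_AE) (auto elim: eventually_mono)
    then have "distributed M lborel Y (normal_density 0 \<sigma>)"
      using 2(2) assms(2) by (simp add: distributed_def)
    then show ?thesis using assms(2) 2(1) unfolding centered_normal_rv_def by blast
  qed
qed

text \<open>Almost surely zero summands are split off first, since the sum rule for normal laws
  demands positive variances; they alter the sum only on a null set.\<close>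

lemma centered_normal_rv_sum_indep:
  fixes V :: "'j \<Rightarrow> 'a \<Rightarrow> real"
  assumes fin: "finite I" and indep: "indep_vars (\<lambda>_. borel) V I"
    and V: "\<And>j. j \<in> I \<Longrightarrow> centered_normal_rv M (V j)"
  shows "centered_normal_rv M (\<lambda>\<omega>. \<Sum>j\<in>I. V j \<omega>)"
proof -
  define I' where "I' = {j\<in>I. \<not> (AE \<omega> in M. V j \<omega> = 0)}"
  have sub: "I' \<subseteq> I" "finite I'" using fin by (auto simp: I'_def)
  have "\<forall>j\<in>I'. \<exists>\<sigma>>0. distributed M lborel (V j) (normal_density 0 \<sigma>)"
    using V unfolding I'_def centered_normal_rv_def by blast
  then obtain \<sigma> where \<sigma>: "\<And>j. j \<in> I' \<Longrightarrow> 0 < \<sigma> j" "\<And>j. j \<in> I' \<Longrightarrow> distributed M lborel (V j) (normal_density 0 (\<sigma> j))"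
    by metis
  have m: "V j \<in> borel_measurable M" if "j \<in> I" for j using centered_normal_rv_measurable[OF V[OF that]] .
  have main: "centered_normal_rv M (\<lambda>\<omega>. \<Sum>j\<in>I'. V j \<omega>)"
  proof (cases "I' = {}")
    case True
    then show ?thesis by (simp add: centered_normal_rv_def)
  next
    case False
    have "distributed M lborel (\<lambda>\<omega>. \<Sum>j\<in>I'. V j \<omega>) (normal_density (\<Sum>j\<in>I'. 0) (sqrt (\<Sum>j\<in>I'. (\<sigma> j)\<^sup>2)))"
      using sub False \<sigma> by (intro sum_indep_normal indep_vars_subset[OF indep]) auto
    moreover have "0 < sqrt (\<Sum>j\<in>I'. (\<sigma> j)\<^sup>2)"
      using False sub by (intro real_sqrt_gt_zero sum_pos zero_less_power \<sigma>(1)) auto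
    moreover have "(\<lambda>\<omega>. \<Sum>j\<in>I'. V j \<omega>) \<in> borel_measurable M"
      using sub m by (intro borel_measurable_sum) auto
    ultimately show ?thesis unfolding centered_normal_rv_def by (metis sum.neutral_const)
  qed
  have "AE \<omega> in M. \<forall>j\<in>I - I'. V j \<omega> = 0"
    using fin by (intro AE_finite_allI) (auto simp: I'_def)
  then have "AE \<omega> in M. (\<Sum>j\<in>I'. V j \<omega>) = (\<Sum>j\<in>I. V j \<omega>)"
  proof eventually_elim
    case (elim \<omega>)
    then show ?case using sub fin by (intro sum.mono_neutral_left) auto
  qed
  then show ?thesis using m by (intro centered_normal_rv_cong_AE[OF main]) auto
qed

text \<open>The terms of a combination are grouped by component. Each group is Gaussian within its
  own field and a measurable function of that component's path, so the groups are
  independent.\<close>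

lemma centered_gaussian_field_components:
  fixes X :: "'d::finite \<Rightarrow> 'i \<Rightarrow> 'a \<Rightarrow> real"
  assumes indep: "indep_vars (\<lambda>_. PiM S (\<lambda>_. borel)) (\<lambda>j \<omega>. restrict (\<lambda>p. X j p \<omega>) S) UNIV"
    and X: "\<And>j. centered_gaussian_field M S (X j)"
  shows "centered_gaussian_field M (S \<times> UNIV) (\<lambda>(p, j). X j p)"
  unfolding centered_gaussian_field_def
proof (intro allI impI)
  fix F :: "('i \<times> 'd) set" and c :: "'i \<times> 'd \<Rightarrow> real"
  assume "finite F \<and> F \<subseteq> S \<times> UNIV"
  then have F: "finite F" "F \<subseteq> S \<times> UNIV" by auto
  define G where "G j = {p. (p, j) \<in> F}" for j
  have G: "finite (G j)" "G j \<subseteq> S" for j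
  proof -
    have "G j \<subseteq> fst ` F" by (force simp: G_def)
    then show "finite (G j)" using F(1) finite_surj by blast
    show "G j \<subseteq> S" using F(2) by (auto simp: G_def)
  qed
  define g where "g j f = (\<Sum>p\<in>G j. c (p, j) * f p)" for j and f :: "'i \<Rightarrow> real"
  have ind: "indep_vars (\<lambda>_. borel) (\<lambda>j \<omega>. g j (restrict (\<lambda>p. X j p \<omega>) S)) UNIV"
  proof (rule indep_vars_compose2[OF indep])
    fix j
    have "(\<lambda>f. f p) \<in> borel_measurable (PiM S (\<lambda>_. borel))" if "p \<in> G j" for p
      using that G(2) by (intro measurable_component_singleton) auto
    then show "g j \<in> borel_measurable (PiM S (\<lambda>_. borel))"
      unfolding g_def by (intro borel_measurable_sum borel_measurable_times borel_measurable_const)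
  qed
  have geq: "g j (restrict (\<lambda>p. X j p \<omega>) S) = (\<Sum>p\<in>G j. c (p, j) * X j p \<omega>)" for j \<omega>
    unfolding g_def using G(2) by (intro sum.cong) auto
  have nrm: "centered_normal_rv M (\<lambda>\<omega>. \<Sum>p\<in>G j. c (p, j) * X j p \<omega>)" for j
    using X[unfolded centered_gaussian_field_def, rule_format, of "G j" "\<lambda>p. c (p, j)" j] G[of j] by simp
  have "centered_normal_rv M (\<lambda>\<omega>. \<Sum>j\<in>UNIV. \<Sum>p\<in>G j. c (p, j) * X j p \<omega>)"
    by (rule centered_normal_rv_sum_indep[OF finite ind[unfolded geq] nrm])
  moreover have "(\<Sum>j\<in>UNIV. \<Sum>p\<in>G j. c (p, j) * X j p \<omega>) = (\<Sum>q\<in>F. c q * (case q of (p, j) \<Rightarrow> X j p) \<omega>)" for \<omega>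
  proof -
    have "(\<Sum>j\<in>UNIV. \<Sum>p\<in>G j. c (p, j) * X j p \<omega>) = (\<Sum>q\<in>(SIGMA j:UNIV. G j). c (snd q, fst q) * X (fst q) (snd q) \<omega>)"
      using G by (subst sum.Sigma) (auto simp: case_prod_beta')
    also have "\<dots> = (\<Sum>q\<in>F. c q * (case q of (p, j) \<Rightarrow> X j p) \<omega>)"
      by (rule sum.reindex_bij_witness[of _ "\<lambda>(p, j). (j, p)" "\<lambda>(j, p). (p, j)"]) (auto simp: G_def)
    finally show ?thesis .
  qed
  ultimately show "centered_normal_rv M (\<lambda>\<omega>. \<Sum>q\<in>F. c q * (case q of (p, j) \<Rightarrow> X j p) \<omega>)" by simp
qed

end

section \<open>The oscillation functional\<close>

definition log_modulus :: "real \<Rightarrow> real \<Rightarrow> real" where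
  "log_modulus a r = r powr a * sqrt (ln (1 + 1 / r))"

lemma log_modulus_pos: "0 < r \<Longrightarrow> 0 < log_modulus a r"
  by (auto simp: log_modulus_def intro!: mult_pos_pos ln_gt_zero)

text \<open>Serves to compare the Euclidean distance \<open>m\<close> with the distance
  \<open>r\<close> of the theorem. From \<open>1 + 1 / m \<le> (1 + 1 / r)\<^sup>2\<close> the
  logarithm at most doubles, whence \<open>sqrt 2\<close>.\<close>

lemma log_modulus_doubling:
  assumes "0 \<le> a" "0 < m" "m \<le> r" "r \<le> 2 * m"
  shows "log_modulus a m \<le> sqrt 2 * log_modulus a r"
proof -
  have "1 / m \<le> 2 / r" using assms by (simp add: field_simps)
  then have "1 + 1 / m \<le> (1 + 1 / r)\<^sup>2"
  proof -
    have "(1 + 1 / r)\<^sup>2 = 1 + 2 / r + (1 / r)\<^sup>2" by (simp add: power2_eq_square algebra_simps)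
    then show ?thesis using \<open>1 / m \<le> 2 / r\<close> zero_le_power2[of "1 / r"] by linarith
  qed
  moreover have pos: "0 < 1 + 1 / m" "0 < 1 + 1 / r" using assms by (auto intro: add_pos_pos)
  ultimately have "ln (1 + 1 / m) \<le> ln ((1 + 1 / r)\<^sup>2)" by (subst ln_le_cancel_iff) auto
  also have "\<dots> = 2 * ln (1 + 1 / r)" using pos by (subst ln_realpow) auto
  finally have "sqrt (ln (1 + 1 / m)) \<le> sqrt 2 * sqrt (ln (1 + 1 / r))"
    by (simp only: real_sqrt_mult[symmetric] real_sqrt_le_mono)
  moreover have "m powr a \<le> r powr a" using assms by (intro powr_mono2) auto
  moreover have "0 \<le> sqrt (ln (1 + 1 / m))" using assms by simp
  ultimately have "m powr a * sqrt (ln (1 + 1 / m)) \<le> r powr a * (sqrt 2 * sqrt (ln (1 + 1 / r)))"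
    by (intro mult_mono) auto
  then show ?thesis by (simp add: log_modulus_def mult_ac)
qed

abbreviation pd :: "real \<times> (real^'n) \<Rightarrow> real \<times> (real^'n) \<Rightarrow> real" where
  "pd p q \<equiv> pdist (fst p) (snd p) (fst q) (snd q)"

lemma pd_norm: "norm (p - q) \<le> pd p q" "pd p q \<le> 2 * norm (p - q)"
  using pdist_norm[of "fst p" "snd p" "fst q" "snd q"] by auto

definition osc_ratio :: "real \<Rightarrow> (real \<times> (real^'n) \<Rightarrow> real^'d) \<Rightarrow> real \<times> (real^'n) \<Rightarrow> real \<times> (real^'n) \<Rightarrow> real" where
  "osc_ratio a f p q = norm (f p - f q) / log_modulus a (pd p q)"

definition close_pairs :: "(real \<times> (real^'n)) set \<Rightarrow> real \<Rightarrow> ((real \<times> (real^'n)) \<times> (real \<times> (real^'n))) set" where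
  "close_pairs S \<epsilon> = {(p, q). p \<in> S \<and> q \<in> S \<and> 0 < pd p q \<and> pd p q \<le> \<epsilon>}"

text \<open>Valued in \<open>ereal\<close> so that suprema and limits exist before finiteness has
  been proved.\<close>

definition osc :: "real \<Rightarrow> (real \<times> (real^'n) \<Rightarrow> real^'d) \<Rightarrow> (real \<times> (real^'n)) set \<Rightarrow> real \<Rightarrow> ereal" where
  "osc a f S \<epsilon> = (SUP (p, q)\<in>close_pairs S \<epsilon>. ereal (osc_ratio a f p q))"

lemma osc_upper: "(p, q) \<in> close_pairs S \<epsilon> \<Longrightarrow> ereal (osc_ratio a f p q) \<le> osc a f S \<epsilon>"
  unfolding osc_def by (rule SUP_upper2[of "(p, q)"]) auto

lemma osc_least: "(\<And>p q. (p, q) \<in> close_pairs S \<epsilon> \<Longrightarrow> ereal (osc_ratio a f p q) \<le> c) \<Longrightarrow> osc a f S \<epsilon> \<le> c"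
  unfolding osc_def by (rule SUP_least) auto

lemma osc_mono: "S \<subseteq> T \<Longrightarrow> \<epsilon> \<le> \<delta> \<Longrightarrow> osc a f S \<epsilon> \<le> osc a f T \<delta>"
  by (rule osc_least, rule osc_upper) (auto simp: close_pairs_def)

lemma osc_cong: "(\<And>p. p \<in> S \<Longrightarrow> f p = g p) \<Longrightarrow> osc a f S \<epsilon> = osc a g S \<epsilon>"
  unfolding osc_def by (intro SUP_cong) (auto simp: close_pairs_def osc_ratio_def)

text \<open>The infimum runs over countably many radii, which keeps the functional measurable when
  \<open>S\<close> is countable; by monotonicity it is the limit for vanishing radius.\<close>

definition osc_lim :: "real \<Rightarrow> (real \<times> (real^'n) \<Rightarrow> real^'d) \<Rightarrow> (real \<times> (real^'n)) set \<Rightarrow> ereal" where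
  "osc_lim a f S = (INF n::nat. osc a f S (inverse (real (Suc n))))"

text \<open>Pairs from \<open>D\<close> approximating a pair from \<open>S\<close> may be slightly
  farther apart than \<open>\<epsilon>\<close>, and the strict inequality leaves room for that. The
  ratio is continuous off the diagonal and so passes to the limit.\<close>

lemma osc_dense_le:
  fixes f :: "real \<times> (real^'n) \<Rightarrow> real^'d"
  assumes cont: "continuous_on S f" and D: "D \<subseteq> S" "S \<subseteq> closure D" and e: "\<epsilon> < \<delta>"
  shows "osc a f S \<epsilon> \<le> osc a f D \<delta>"
proof (rule osc_least)
  fix p q assume pq: "(p, q) \<in> close_pairs S \<epsilon>"
  then have pS: "p \<in> S" "q \<in> S" and pos: "0 < pd p q" and le: "pd p q \<le> \<epsilon>" by (auto simp: close_pairs_def)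
  obtain P where P: "\<And>n. P n \<in> D" "P \<longlonglongrightarrow> p" using pS D by (meson closure_sequential subsetD)
  obtain Q where Q: "\<And>n. Q n \<in> D" "Q \<longlonglongrightarrow> q" using pS D by (meson closure_sequential subsetD)
  have fP: "(\<lambda>n. f (P n)) \<longlonglongrightarrow> f p"
    by (rule continuous_on_tendsto_compose[OF cont P(2) pS(1)]) (intro always_eventually allI subsetD[OF D(1)] P(1))
  have fQ: "(\<lambda>n. f (Q n)) \<longlonglongrightarrow> f q"
    by (rule continuous_on_tendsto_compose[OF cont Q(2) pS(2)]) (intro always_eventually allI subsetD[OF D(1)] Q(1))
  have pdl: "(\<lambda>n. pd (P n) (Q n)) \<longlonglongrightarrow> pd p q"
    unfolding pdist_def by (intro tendsto_intros P Q)
  have "0 < 1 + 1 / pd p q" using pos by (simp add: add_pos_pos)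
  then have "(\<lambda>n. osc_ratio a f (P n) (Q n)) \<longlonglongrightarrow> osc_ratio a f p q"
    unfolding osc_ratio_def log_modulus_def
    using pos log_modulus_pos[OF pos, of a] by (intro tendsto_intros fP fQ pdl) (auto simp: log_modulus_def)
  then have lim: "(\<lambda>n. ereal (osc_ratio a f (P n) (Q n))) \<longlonglongrightarrow> ereal (osc_ratio a f p q)" by simp
  have "\<forall>\<^sub>F n in sequentially. 0 < pd (P n) (Q n)" using order_tendstoD(1)[OF pdl pos] .
  moreover have "\<forall>\<^sub>F n in sequentially. pd (P n) (Q n) < \<delta>" using order_tendstoD(2)[OF pdl, of \<delta>] le e by simp
  ultimately have "\<forall>\<^sub>F n in sequentially. ereal (osc_ratio a f (P n) (Q n)) \<le> osc a f D \<delta>"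
    by eventually_elim (rule osc_upper, use P Q in \<open>auto simp: close_pairs_def\<close>)
  then show "ereal (osc_ratio a f p q) \<le> osc a f D \<delta>"
    by (intro tendsto_upperbound[OF lim]) auto
qed

text \<open>Links the limit over the whole interval, which the theorem is about, to a functional of
  the values on \<open>D\<close>, to which the zero-one law applies.\<close>

lemma osc_tendsto_osc_lim:
  fixes f :: "real \<times> (real^'n) \<Rightarrow> real^'d"
  assumes cont: "continuous_on S f" and D: "D \<subseteq> S" "S \<subseteq> closure D"
  shows "((\<lambda>\<epsilon>. osc a f S \<epsilon>) \<longlongrightarrow> osc_lim a f D) (at_right 0)"
proof (rule order_tendstoI)
  fix b assume b: "b < osc_lim a f D"
  have "b < osc a f S \<epsilon>" if "0 < \<epsilon>" for \<epsilon>
  proof -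
    obtain m where m: "inverse (real (Suc m)) < \<epsilon>" using reals_Archimedean[OF \<open>0 < \<epsilon>\<close>] by auto
    have "b < osc_lim a f D" by (rule b)
    also have "\<dots> \<le> osc a f D (inverse (real (Suc m)))" unfolding osc_lim_def by (rule INF_lower) simp
    also have "\<dots> \<le> osc a f S \<epsilon>" using m D by (intro osc_mono) auto
    finally show ?thesis .
  qed
  then show "\<forall>\<^sub>F \<epsilon> in at_right 0. b < osc a f S \<epsilon>"
    by (auto intro!: eventually_at_rightI[of 0 1])
next
  fix b assume "osc_lim a f D < b"
  then obtain n where n: "osc a f D (inverse (real (Suc n))) < b" unfolding osc_lim_def INF_less_iff by auto
  have "osc a f S \<epsilon> < b" if "\<epsilon> < inverse (real (Suc n))" for \<epsilon>
    using osc_dense_le[OF cont D that, of a] n by (rule order_le_less_trans)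
  then show "\<forall>\<^sub>F \<epsilon> in at_right 0. osc a f S \<epsilon> < b"
    by (intro eventually_at_rightI[of 0 "inverse (real (Suc n))"]) auto
qed

lemma osc_lim_LIMSEQ: "(\<lambda>n. osc a f S (inverse (real (Suc n)))) \<longlonglongrightarrow> osc_lim a f S"
  unfolding osc_lim_def
  by (intro LIMSEQ_INF decseq_SucI osc_mono) (auto simp: field_simps)

text \<open>A Hoelder perturbation without logarithm raises the ratios at radius
  \<open>1 / (n + 1)\<close> by at most \<open>B / sqrt (ln (n + 2))\<close>, which tends to 0. This
  is why shifts by covariances leave the limit unchanged.\<close>

lemma osc_lim_add_le:
  fixes f g :: "real \<times> (real^'n) \<Rightarrow> real^'d"
  assumes B: "0 \<le> B" and g: "\<And>p q. p \<in> D \<Longrightarrow> q \<in> D \<Longrightarrow> norm (g p - g q) \<le> B * pd p q powr a"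
  shows "osc_lim a (\<lambda>p. f p + g p) D \<le> osc_lim a f D"
proof -
  define e where "e n = B / sqrt (ln (1 + real (Suc n)))" for n
  have "e \<longlonglongrightarrow> 0" unfolding e_def by real_asymp
  then have "(\<lambda>n. ereal (e n)) \<longlonglongrightarrow> 0" by (simp add: zero_ereal_def)
  from tendsto_add_ereal_general[OF _ osc_lim_LIMSEQ[of a f D] this]
  have lim: "(\<lambda>n. osc a f D (inverse (real (Suc n))) + ereal (e n)) \<longlonglongrightarrow> osc_lim a f D" by simp
  have "osc a (\<lambda>p. f p + g p) D (inverse (real (Suc n))) \<le> osc a f D (inverse (real (Suc n))) + ereal (e n)" for n
  proof (rule osc_least)
    fix p q assume pq: "(p, q) \<in> close_pairs D (inverse (real (Suc n)))"
    then have pD: "p \<in> D" "q \<in> D" and pos: "0 < pd p q" and le: "pd p q \<le> inverse (real (Suc n))" by (auto simp: close_pairs_def)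
    have "real (Suc n) \<le> 1 / pd p q" using pos le by (simp add: field_simps)
    then have "ln (1 + real (Suc n)) \<le> ln (1 + 1 / pd p q)" by (subst ln_le_cancel_iff) auto
    then have s: "sqrt (ln (1 + real (Suc n))) \<le> sqrt (ln (1 + 1 / pd p q))" by (rule real_sqrt_le_mono)
    have s0: "0 < sqrt (ln (1 + real (Suc n)))" by simp
    have "norm (f p + g p - (f q + g q)) \<le> norm (f p - f q) + norm (g p - g q)"
      using norm_triangle_ineq[of "f p - f q" "g p - g q"] by (simp add: algebra_simps)
    also have "\<dots> \<le> norm (f p - f q) + B * pd p q powr a" using g[OF pD] by simp
    finally have "osc_ratio a (\<lambda>p. f p + g p) p q \<le> (norm (f p - f q) + B * pd p q powr a) / log_modulus a (pd p q)"
      unfolding osc_ratio_def using log_modulus_pos[OF pos, of a] by (intro divide_right_mono) auto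
    also have "\<dots> = osc_ratio a f p q + B / sqrt (ln (1 + 1 / pd p q))"
      using pos by (simp add: osc_ratio_def add_divide_distrib log_modulus_def)
    also have "\<dots> \<le> osc_ratio a f p q + e n"
      unfolding e_def
      by (intro add_left_mono divide_left_mono[OF s B] mult_pos_pos s0 less_le_trans[OF s0 s])
    finally have "ereal (osc_ratio a (\<lambda>p. f p + g p) p q) \<le> ereal (osc_ratio a f p q) + ereal (e n)" by simp
    also have "\<dots> \<le> osc a f D (inverse (real (Suc n))) + ereal (e n)" by (intro add_right_mono osc_upper pq)
    finally show "ereal (osc_ratio a (\<lambda>p. f p + g p) p q) \<le> osc a f D (inverse (real (Suc n))) + ereal (e n)" .
  qed
  then show ?thesis by (intro LIMSEQ_le[OF osc_lim_LIMSEQ lim]) auto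
qed

lemma osc_lim_add_eq:
  fixes f g :: "real \<times> (real^'n) \<Rightarrow> real^'d"
  assumes B: "0 \<le> B" and g: "\<And>p q. p \<in> D \<Longrightarrow> q \<in> D \<Longrightarrow> norm (g p - g q) \<le> B * pd p q powr a"
  shows "osc_lim a (\<lambda>p. f p + g p) D = osc_lim a f D"
proof (rule antisym)
  show "osc_lim a (\<lambda>p. f p + g p) D \<le> osc_lim a f D" by (rule osc_lim_add_le[OF B g])
  have "osc_lim a (\<lambda>p. (f p + g p) + - g p) D \<le> osc_lim a (\<lambda>p. f p + g p) D"
    by (rule osc_lim_add_le[OF B]) (use g in \<open>simp add: norm_minus_commute\<close>)
  then show "osc_lim a f D \<le> osc_lim a (\<lambda>p. f p + g p) D" by simp
qed

lemma osc_lim_measurable: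
  fixes ix :: "(real \<times> (real^'n)) \<times> 'd::finite \<Rightarrow> nat"
  assumes "countable D"
  shows "(\<lambda>w. osc_lim a (\<lambda>p. \<chi> j. w (ix (p, j))) D) \<in> borel_measurable (PiM UNIV (\<lambda>_. borel :: real measure))"
proof -
  have c: "countable (close_pairs D \<epsilon>)" for \<epsilon>
    by (rule countable_subset[of _ "D \<times> D"]) (use assms in \<open>auto simp: close_pairs_def\<close>)
  have comp[measurable]: "(\<lambda>w. w k) \<in> borel_measurable (PiM UNIV (\<lambda>_. borel :: real measure))" for k :: nat
    by (intro measurable_component_singleton) auto
  have r: "(\<lambda>w. ereal (osc_ratio a (\<lambda>p. \<chi> j. w (ix (p, j))) p q)) \<in> borel_measurable (PiM UNIV (\<lambda>_. borel :: real measure))" for p q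
    unfolding osc_ratio_def norm_vec_def L2_set_def by simp
  show ?thesis
    unfolding osc_lim_def osc_def
    by (intro borel_measurable_INF borel_measurable_SUP c) (auto intro: r simp: case_prod_beta')
qed

text \<open>The smallest of the finitely many radii serves all components, and
  \<open>log_modulus_doubling\<close> passes from Euclidean distance to \<open>pd\<close>.\<close>

lemma osc_bounded_of_components:
  fixes f :: "real \<times> (real^'n) \<Rightarrow> real^'d"
  assumes a: "0 \<le> a" and comp: "\<And>j. \<exists>C \<delta>. 0 \<le> C \<and> 0 < \<delta> \<and> (\<forall>p\<in>S. \<forall>q\<in>S. 0 < norm (p - q) \<and> norm (p - q) \<le> \<delta> \<longrightarrow>
      \<bar>f p $ j - f q $ j\<bar> \<le> C * (norm (p - q) powr a * sqrt (ln (1 + 1 / norm (p - q)))))"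
  obtains C where "\<forall>\<^sub>F \<epsilon> in at_right 0. osc a f S \<epsilon> \<le> ereal C"
proof -
  from comp obtain C \<delta> where C: "\<And>j. 0 \<le> C j" "\<And>j. 0 < \<delta> j"
    and bd: "\<And>j p q. p \<in> S \<Longrightarrow> q \<in> S \<Longrightarrow> 0 < norm (p - q) \<Longrightarrow> norm (p - q) \<le> \<delta> j \<Longrightarrow>
      \<bar>f p $ j - f q $ j\<bar> \<le> C j * log_modulus a (norm (p - q))"
    unfolding log_modulus_def by metis
  have fin: "finite (range \<delta>)" "range \<delta> \<noteq> {}" by auto
  define d where "d = Min (range \<delta>)"
  have d: "0 < d" "\<And>j. d \<le> \<delta> j" unfolding d_def using fin C by auto
  have "osc a f S \<epsilon> \<le> ereal (\<Sum>j\<in>UNIV. C j * sqrt 2)" if e: "\<epsilon> < d" for \<epsilon>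
  proof (rule osc_least)
    fix p q assume pq: "(p, q) \<in> close_pairs S \<epsilon>"
    then have pS: "p \<in> S" "q \<in> S" and pos: "0 < pd p q" and le: "pd p q \<le> \<epsilon>" by (auto simp: close_pairs_def)
    have n0: "0 < norm (p - q)" using pd_norm(2)[of p q] pos by linarith
    have "norm (f p - f q) \<le> (\<Sum>j\<in>UNIV. \<bar>(f p - f q) $ j\<bar>)" by (rule norm_le_l1_cart)
    also have "\<dots> \<le> (\<Sum>j\<in>UNIV. C j * sqrt 2 * log_modulus a (pd p q))"
    proof (rule sum_mono)
      fix j
      have "\<bar>f p $ j - f q $ j\<bar> \<le> C j * log_modulus a (norm (p - q))"
        using pd_norm(1)[of p q] le e d(2)[of j] by (intro bd pS n0) linarith
      also have "\<dots> \<le> C j * (sqrt 2 * log_modulus a (pd p q))"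
        using C by (intro mult_left_mono log_modulus_doubling a n0 pd_norm) auto
      finally show "\<bar>(f p - f q) $ j\<bar> \<le> C j * sqrt 2 * log_modulus a (pd p q)" by (simp add: mult.assoc)
    qed
    finally have "norm (f p - f q) \<le> (\<Sum>j\<in>UNIV. C j * sqrt 2) * log_modulus a (pd p q)"
      by (simp add: sum_distrib_right)
    then show "ereal (osc_ratio a f p q) \<le> ereal (\<Sum>j\<in>UNIV. C j * sqrt 2)"
      unfolding osc_ratio_def using log_modulus_pos[OF pos, of a] by (simp add: pos_divide_le_eq)
  qed
  then have "\<forall>\<^sub>F \<epsilon> in at_right 0. osc a f S \<epsilon> \<le> ereal (\<Sum>j\<in>UNIV. C j * sqrt 2)"
    by (intro eventually_at_rightI[of 0 d]) (use d in auto)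
  with that show thesis by blast
qed

section \<open>The exact uniform modulus of continuity\<close>

theorem theorem3p7:
  fixes M :: "'a measure"
    and u :: "real \<Rightarrow> real^'n \<Rightarrow> 'a \<Rightarrow> real^'d"
    and H \<beta> cH c1 c2 :: real
    and h :: "real^'n \<Rightarrow> real"
    and t0 t1 :: real and x0 x1 :: "real^'n"
  assumes "prob_space M"
    and "1/2 \<le> H" "H < 1"
    and "0 < \<beta>" "\<beta> < real CARD('n)"
    and "real CARD('n) - 2*H - 1 < \<beta>" "\<beta> < real CARD('n) - 2*H + 1"
    and "h \<in> borel_measurable borel"
    and "0 < c1" "c1 \<le> c2"
    and "\<And>\<xi>. \<xi> \<noteq> 0 \<Longrightarrow> c1 * norm \<xi> powr (-\<beta>) \<le> h \<xi> \<and> h \<xi> \<le> c2 * norm \<xi> powr (-\<beta>)"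
    and "\<And>\<xi>. 0 \<le> h \<xi>"
    and "0 < cH"
    \<comment> \<open>components are independent, identically distributed (as processes on [0,\<infinity>) \<times> R^N)\<close>
    and "prob_space.indep_vars M (\<lambda>_. PiM ({0..} \<times> UNIV) (\<lambda>_. borel))
           (\<lambda>j \<omega>. restrict (\<lambda>p. u (fst p) (snd p) \<omega> $ j) ({0..} \<times> UNIV)) (UNIV :: 'd set)"
    and "\<And>j k. distr M (PiM ({0..} \<times> UNIV) (\<lambda>_. borel))
                 (\<lambda>\<omega>. restrict (\<lambda>p. u (fst p) (snd p) \<omega> $ j) ({0..} \<times> UNIV))
             = distr M (PiM ({0..} \<times> UNIV) (\<lambda>_. borel))
                 (\<lambda>\<omega>. restrict (\<lambda>p. u (fst p) (snd p) \<omega> $ k) ({0..} \<times> UNIV))"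
    \<comment> \<open>each component is a centered Gaussian field with the given covariance\<close>
    and "\<And>j. centered_gaussian_field M ({0..} \<times> UNIV) (\<lambda>p \<omega>. u (fst p) (snd p) \<omega> $ j)"
    and "\<And>j t x s y. 0 \<le> t \<Longrightarrow> 0 \<le> s \<Longrightarrow>
           complex_of_real (prob_space.expectation M (\<lambda>\<omega>. u t x \<omega> $ j * u s y \<omega> $ j))
             = cov_kernel cH H h t x s y"
    \<comment> \<open>continuous version\<close>
    and "\<And>\<omega>. \<omega> \<in> space M \<Longrightarrow> continuous_on ({0..} \<times> UNIV) (\<lambda>p. u (fst p) (snd p) \<omega>)"
    \<comment> \<open>the compact interval I = [t0,t1] \<times> [x0,x1] in (0,\<infinity>) \<times> R^N\<close>
    and "0 < t0" "t0 < t1" "\<And>i. x0 $ i < x1 $ i"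
  shows "\<exists>C::real. 0 < C \<and>
     (AE \<omega> in M.
        ((\<lambda>\<epsilon>. SUP p \<in> {((t,x),(s,y)). (t,x) \<in> {t0..t1} \<times> cbox x0 x1 \<and> (s,y) \<in> {t0..t1} \<times> cbox x0 x1
                        \<and> 0 < pdist t x s y \<and> pdist t x s y \<le> \<epsilon>}.
             (case p of ((t,x),(s,y)) \<Rightarrow>
               ereal (norm (u t x \<omega> - u s y \<omega>) /
                 (pdist t x s y powr ((2*H + 1 - real CARD('n) + \<beta>) / 2)
                  * sqrt (ln (1 + 1 / pdist t x s y))))))
         \<longlongrightarrow> ereal C) (at_right 0))"
proof -
  define \<alpha> where "\<alpha> = (2*H + 1 - real CARD('n) + \<beta>) / 2"
  interpret prob_space M by (rule assms(1))
  have W: "wave_field M H \<beta> c1 c2 \<alpha> h cH (\<lambda>t x \<omega>. u t x \<omega> $ j)" for j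
    by unfold_locales (use assms in \<open>auto simp: \<alpha>_def\<close>)
  define S where "S = {t0..t1} \<times> cbox x0 x1"
  define f where "f \<omega> p = u (fst p) (snd p) \<omega>" for \<omega> p
  have S_sub: "S \<subseteq> {0..} \<times> UNIV" using assms(19) by (auto simp: S_def)
  have fcont: "continuous_on S (f \<omega>)" if "\<omega> \<in> space M" for \<omega>
    unfolding f_def by (rule continuous_on_subset[OF assms(18)[OF that] S_sub])
  have comp_cont: "continuous_on ({0..} \<times> UNIV) (\<lambda>p. u (fst p) (snd p) \<omega> $ j)" if "\<omega> \<in> space M" for \<omega> j
    by (intro continuous_on_component assms(18) that)
  have x01: "x0 \<in> cbox x0 x1" using assms(21) by (simp add: mem_box_cart less_imp_le)
  \<comment> \<open>A countable dense set turns the limit into a function of countably many Gaussian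
    values; continuity recovers the supremum over \<open>S\<close>.\<close>
  obtain D where D: "countable D" "D \<subseteq> S" "S \<subseteq> closure D" using separable by blast
  have D0: "D \<noteq> {}"
  proof
    assume "D = {}"
    then have "S = {}" using D by simp
    then show False using x01 assms(20) by (auto simp: S_def)
  qed
  define J where "J = D \<times> (UNIV :: 'd set)"
  have J: "countable J" "J \<noteq> {}" using D D0 by (auto simp: J_def)
  \<comment> \<open>Pairs of a sample point and a component become one sequence, since the norm in
    the ratio involves all components at once; \<open>ix\<close> finds the index of a given
    pair.\<close>
  define e where "e = from_nat_into J"
  define ix where "ix = to_nat_on J"
  have eJ: "e k \<in> J" for k unfolding e_def by (rule from_nat_into[OF J(2)])
  have e_ix: "e (ix q) = q" if "q \<in> J" for q unfolding e_def ix_def using that J(1) by simp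
  have eS: "e k \<in> ({0..} \<times> UNIV) \<times> UNIV" for k
    using eJ[of k] subsetD[OF S_sub subsetD[OF D(2)], of "fst (e k)"] by (simp add: J_def mem_Times_iff)
  define Y where "Y k \<omega> = f \<omega> (fst (e k)) $ snd (e k)" for k \<omega>
  have "centered_gaussian_field M (({0..} \<times> UNIV) \<times> UNIV) (\<lambda>(p, j) \<omega>. u (fst p) (snd p) \<omega> $ j)"
    by (rule centered_gaussian_field_components[OF assms(14,16), unfolded case_prod_eta])
  then have field: "centered_gaussian_field M (({0..} \<times> UNIV) \<times> UNIV) (\<lambda>q \<omega>. f \<omega> (fst q) $ snd q)"
    by (simp add: case_prod_beta' f_def)
  interpret gaussian_sequence M Y
  proof
    show "centered_gaussian_field M UNIV Y"
      unfolding centered_gaussian_field_def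
    proof (intro allI impI)
      fix F :: "nat set" and c :: "nat \<Rightarrow> real" assume "finite F \<and> F \<subseteq> UNIV"
      then show "centered_normal_rv M (\<lambda>\<omega>. \<Sum>k\<in>F. c k * Y k \<omega>)"
        unfolding Y_def using eS by (intro centered_gaussian_field_combination[OF field, of F e c]) auto
    qed
  qed
  define \<Lambda> where "\<Lambda> w = osc_lim \<alpha> (\<lambda>p. \<chi> j. w (ix (p, j))) D" for w
  have Yf: "(\<chi> j. Y (ix (p, j)) \<omega>) = f \<omega> p" if "p \<in> D" for p \<omega>
    using that by (simp add: Y_def e_ix J_def vec_eq_iff)
  have \<Lambda>Y: "\<Lambda> (\<lambda>k. Y k \<omega>) = osc_lim \<alpha> (f \<omega>) D" for \<omega>
    unfolding \<Lambda>_def osc_lim_def by (intro INF_cong refl osc_cong Yf)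
  have "\<exists>c. AE \<omega> in M. \<Lambda> (\<lambda>k. Y k \<omega>) = c"
  proof (rule shift_invariant_AE_const)
    show "\<Lambda> \<in> borel_measurable (PiM UNIV (\<lambda>_. borel))"
      unfolding \<Lambda>_def by (rule osc_lim_measurable[OF D(1)])
    fix w :: "nat \<Rightarrow> real" and Z :: "'a \<Rightarrow> real" assume Z: "Z \<in> borel_measurable M" "integrable M (\<lambda>\<omega>. (Z \<omega>)\<^sup>2)"
    \<comment> \<open>The covariances with \<open>Z\<close> form the Cameron-Martin shift; their
      Hoelder bound in each component makes it invisible to \<open>osc_lim\<close>.\<close>
    define Q where "Q j B \<longleftrightarrow> (\<forall>t x s y. 0 \<le> t \<longrightarrow> t \<le> t1 \<longrightarrow> 0 \<le> s \<longrightarrow> s \<le> t1 \<longrightarrow>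
       \<bar>expectation (\<lambda>\<omega>. u t x \<omega> $ j * Z \<omega>) - expectation (\<lambda>\<omega>. u s y \<omega> $ j * Z \<omega>)\<bar> \<le> B * pdist t x s y powr \<alpha>)" for j B
    have "\<exists>B. 0 \<le> B \<and> Q j B" for j
    proof -
      have "0 < t1" using assms(19,20) by simp
      then obtain B where "0 \<le> B" "\<And>t x s y. 0 \<le> t \<Longrightarrow> t \<le> t1 \<Longrightarrow> 0 \<le> s \<Longrightarrow> s \<le> t1 \<Longrightarrow>
         \<bar>expectation (\<lambda>\<omega>. u t x \<omega> $ j * Z \<omega>) - expectation (\<lambda>\<omega>. u s y \<omega> $ j * Z \<omega>)\<bar> \<le> B * pdist t x s y powr \<alpha>"
        by (rule wave_field.covariance_modulus[OF W _ Z]) (rule that)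
      then show ?thesis unfolding Q_def by (intro exI[of _ B] conjI allI impI)
    qed
    then obtain B where B: "\<And>j. 0 \<le> B j" and QB: "\<And>j. Q j (B j)"
      by metis
    note bd = QB[unfolded Q_def, rule_format]
    define g where "g p = (\<chi> j. expectation (\<lambda>\<omega>. Y (ix (p, j)) \<omega> * Z \<omega>))" for p
    have g: "g p $ j = expectation (\<lambda>\<omega>. u (fst p) (snd p) \<omega> $ j * Z \<omega>)" if "p \<in> D" for p j
      using that by (simp add: g_def Y_def e_ix J_def f_def)
    have "osc_lim \<alpha> (\<lambda>p. (\<chi> j. w (ix (p, j))) + g p) D = osc_lim \<alpha> (\<lambda>p. \<chi> j. w (ix (p, j))) D"
    proof (rule osc_lim_add_eq)
      show "0 \<le> (\<Sum>j\<in>UNIV. B j)" using B by (intro sum_nonneg) auto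
      fix p q assume pq: "p \<in> D" "q \<in> D"
      then have tb: "0 \<le> fst p" "fst p \<le> t1" "0 \<le> fst q" "fst q \<le> t1"
        using D(2) assms(19) by (auto simp: S_def)
      have "norm (g p - g q) \<le> (\<Sum>j\<in>UNIV. \<bar>(g p - g q) $ j\<bar>)" by (rule norm_le_l1_cart)
      also have "\<dots> \<le> (\<Sum>j\<in>UNIV. B j * pd p q powr \<alpha>)"
        by (intro sum_mono) (simp add: g[OF pq(1)] g[OF pq(2)] bd[OF tb])
      finally show "norm (g p - g q) \<le> (\<Sum>j\<in>UNIV. B j) * pd p q powr \<alpha>" by (simp add: sum_distrib_right)
    qed
    moreover have "(\<lambda>p. (\<chi> j. w (ix (p, j))) + g p) = (\<lambda>p. \<chi> j. w (ix (p, j)) + expectation (\<lambda>\<omega>. Y (ix (p, j)) \<omega> * Z \<omega>))"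
      by (simp add: g_def vec_eq_iff fun_eq_iff)
    ultimately show "\<Lambda> (\<lambda>k. w k + expectation (\<lambda>\<omega>. Y k \<omega> * Z \<omega>)) = \<Lambda> w"
      unfolding \<Lambda>_def by simp
  qed
  then obtain c where c: "AE \<omega> in M. osc_lim \<alpha> (f \<omega>) D = c" unfolding \<Lambda>Y by blast
  have lim: "((\<lambda>\<epsilon>. osc \<alpha> (f \<omega>) S \<epsilon>) \<longlongrightarrow> osc_lim \<alpha> (f \<omega>) D) (at_right 0)" if "\<omega> \<in> space M" for \<omega>
    by (rule osc_tendsto_osc_lim[OF fcont[OF that] D(2,3)])
  have alpha0: "0 \<le> \<alpha>" using wave_field.alpha_pos[OF W] by (simp add: less_imp_le)
  have "AE \<omega> in M. \<forall>j\<in>UNIV. \<exists>C \<delta>. 0 \<le> C \<and> 0 < \<delta> \<and> (\<forall>p\<in>S. \<forall>q\<in>S.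
     0 < norm (p - q) \<and> norm (p - q) \<le> \<delta> \<longrightarrow>
      \<bar>f \<omega> p $ j - f \<omega> q $ j\<bar> \<le> C * (norm (p - q) powr \<alpha> * sqrt (ln (1 + 1 / norm (p - q)))))"
    unfolding S_def f_def
    by (intro AE_finite_allI finite wave_field.AE_modulus_upper[OF W] comp_cont) (use assms(19,20) in auto)
  with AE_space have upper: "AE \<omega> in M. osc_lim \<alpha> (f \<omega>) D < \<infinity>"
  proof eventually_elim
    case (elim \<omega>)
    have "\<And>j. \<exists>C \<delta>. 0 \<le> C \<and> 0 < \<delta> \<and> (\<forall>p\<in>S. \<forall>q\<in>S.
     0 < norm (p - q) \<and> norm (p - q) \<le> \<delta> \<longrightarrow>
      \<bar>f \<omega> p $ j - f \<omega> q $ j\<bar> \<le> C * (norm (p - q) powr \<alpha> * sqrt (ln (1 + 1 / norm (p - q)))))"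
      using elim(2) by blast
    from osc_bounded_of_components[OF alpha0 this] obtain C where "\<forall>\<^sub>F \<epsilon> in at_right 0. osc \<alpha> (f \<omega>) S \<epsilon> \<le> ereal C" .
    then have "osc_lim \<alpha> (f \<omega>) D \<le> ereal C"
      by (intro tendsto_upperbound[OF lim[OF elim(1)]]) auto
    then show ?case by auto
  qed
  \<comment> \<open>Any axis and any component will do, and both index types are nonempty.\<close>
  obtain i :: 'n and j :: 'd where True by simp
  have ax: "axis i 1 \<in> (Basis :: (real^'n) set)" by simp
  have "0 < x1 $ i - x0 $ i" using assms(21)[of i] by simp
  then obtain b where b: "0 < b" and low: "AE \<omega> in M. \<forall>\<eta>>0. \<exists>a \<delta>. 0 \<le> a \<and> a + \<delta> \<le> x1 $ i - x0 $ i \<and> 0 < \<delta> \<and> \<delta> \<le> \<eta> \<and>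
       b * (\<delta> powr \<alpha> * sqrt (ln (1 + 1 / \<delta>))) \<le> \<bar>u t0 (x0 + (a + \<delta>) *\<^sub>R axis i 1) \<omega> $ j - u t0 (x0 + a *\<^sub>R axis i 1) \<omega> $ j\<bar>"
    by (rule wave_field.AE_modulus_lower[OF W assms(19) ax]) (rule that)
  from low AE_space have lower: "AE \<omega> in M. ereal b \<le> osc_lim \<alpha> (f \<omega>) D"
  proof eventually_elim
    case (elim \<omega>)
    have "ereal b \<le> osc \<alpha> (f \<omega>) S \<epsilon>" if "0 < \<epsilon>" for \<epsilon>
    proof -
      from elim(1) that obtain a \<delta> where a: "0 \<le> a" "a + \<delta> \<le> x1 $ i - x0 $ i" "0 < \<delta>" "\<delta> \<le> \<epsilon>"
        "b * (\<delta> powr \<alpha> * sqrt (ln (1 + 1 / \<delta>))) \<le> \<bar>u t0 (x0 + (a + \<delta>) *\<^sub>R axis i 1) \<omega> $ j - u t0 (x0 + a *\<^sub>R axis i 1) \<omega> $ j\<bar>"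
        by blast
      let ?p = "(t0, x0 + (a + \<delta>) *\<^sub>R axis i 1)" and ?q = "(t0, x0 + a *\<^sub>R axis i 1)"
      have seg: "x0 + r *\<^sub>R axis i 1 \<in> cbox x0 x1" if "0 \<le> r" "r \<le> x1 $ i - x0 $ i" for r
        using that assms(21) by (auto simp: mem_box_cart axis_def less_imp_le)
      have pd: "pd ?p ?q = \<delta>"
      proof -
        have "x0 + (a + \<delta>) *\<^sub>R axis i 1 - (x0 + a *\<^sub>R axis i 1) = \<delta> *\<^sub>R (axis i 1 :: real^'n)" by (simp add: algebra_simps)
        then show ?thesis using a(3) by (simp add: pdist_def)
      qed
      have "(?p, ?q) \<in> close_pairs S \<epsilon>"
        using a seg[of a] seg[of "a + \<delta>"] assms(20) pd by (auto simp: close_pairs_def S_def)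
      then have "ereal (osc_ratio \<alpha> (f \<omega>) ?p ?q) \<le> osc \<alpha> (f \<omega>) S \<epsilon>" by (rule osc_upper)
      moreover have "b \<le> osc_ratio \<alpha> (f \<omega>) ?p ?q"
      proof -
        have "b * log_modulus \<alpha> \<delta> \<le> \<bar>(f \<omega> ?p - f \<omega> ?q) $ j\<bar>" using a(5) by (simp add: log_modulus_def f_def)
        also have "\<dots> \<le> norm (f \<omega> ?p - f \<omega> ?q)" by (rule component_le_norm_cart)
        finally show ?thesis unfolding osc_ratio_def pd using log_modulus_pos[OF a(3), of \<alpha>] by (simp add: pos_le_divide_eq)
      qed
      ultimately show ?thesis by (metis ereal_less_eq(3) order_trans)
    qed
    then show ?case
      by (intro tendsto_lowerbound[OF lim[OF elim(2)]]) (auto intro!: eventually_at_rightI[of 0 1])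
  qed
  \<comment> \<open>The bounds on \<open>c\<close> do not depend on the sample point, so holding
    almost surely they hold outright.\<close>
  from c upper lower have "AE \<omega> in M. c < \<infinity> \<and> ereal b \<le> c" by eventually_elim auto
  then have "c < \<infinity>" "ereal b \<le> c" by (auto simp: AE_const)
  then obtain C where C: "c = ereal C" "0 < C" using b by (cases c) auto
  have osc_eq: "(SUP p \<in> {((t,x),(s,y)). (t,x) \<in> {t0..t1} \<times> cbox x0 x1 \<and> (s,y) \<in> {t0..t1} \<times> cbox x0 x1
                        \<and> 0 < pdist t x s y \<and> pdist t x s y \<le> \<epsilon>}.
             (case p of ((t,x),(s,y)) \<Rightarrow>
               ereal (norm (u t x \<omega> - u s y \<omega>) /
                 (pdist t x s y powr ((2*H + 1 - real CARD('n) + \<beta>) / 2)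
                  * sqrt (ln (1 + 1 / pdist t x s y)))))) = osc \<alpha> (f \<omega>) S \<epsilon>" for \<epsilon> \<omega>
    unfolding osc_def close_pairs_def S_def osc_ratio_def log_modulus_def \<alpha>_def f_def
    by (intro SUP_cong) (auto simp: case_prod_beta')
  show ?thesis
    unfolding osc_eq
  proof (intro exI conjI)
    show "0 < C" by (rule C)
    from c AE_space show "AE \<omega> in M. ((\<lambda>\<epsilon>. osc \<alpha> (f \<omega>) S \<epsilon>) \<longlongrightarrow> ereal C) (at_right 0)"
    proof eventually_elim
      case (elim \<omega>)
      then show ?case using lim[OF elim(2)] C(1) by simp
    qed
  qed
qed

end
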